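(* Let $\Lambda$ be the de Bruijn–Newman constant, i.e. the real number such that, for $t \in \mathbb{R}$, the entire function $H_t(z) = \int_0^\infty e^{tu^2}\Phi(u)\cos(zu)\,du$ has only real zeroes if and only if $t \ge \Lambda$. Then $\Lambda \ge 0$.
   Context: Here $\Phi(u) = \sum_{n=1}^\infty (2\pi^2 n^4 e^{9u} - 3\pi n^2 e^{5u})\exp(-\pi n^2 e^{4u})$, a super-exponentially decaying even function. For each $t\in\mathbb{R}$ the function $H_t:\mathbb{C}\to\mathbb{C}$ is entire. It is a known theorem (Newman) that there exists a finite real constant $\Lambda$ (the de Bruijn–Newman constant) such that the zeroes of $H_t$ are all real precisely when $t \ge \Lambda$. *)

theory Defs
  imports "HOL-Complex_Analysis.Complex_Analysis"
begin

definition Phi :: "real \<Rightarrow> real" where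
  "Phi u = (\<Sum>k. let n = real (Suc k) in
     (2 * pi\<^sup>2 * n ^ 4 * exp (9 * u) - 3 * pi * n\<^sup>2 * exp (5 * u)) * exp (- pi * n\<^sup>2 * exp (4 * u)))"

definition H :: "real \<Rightarrow> complex \<Rightarrow> complex" where
  "H t z = (LINT u:{0..}|lborel. of_real (exp (t * u\<^sup>2) * Phi u) * cos (z * of_real u))"

definition only_real_zeros :: "(complex \<Rightarrow> complex) \<Rightarrow> bool" where
  "only_real_zeros f \<longleftrightarrow> (\<forall>z. f z = 0 \<longrightarrow> z \<in> \<real>)"

text \<open>
  The existence of a real number with the following property is a theorem of Newman; its uniqueness
  is immediate. It is a predicate and not a constant obtained by definite description, so that
  statements about the constant do not depend on a proof of existence.
\<close>

definition is_de_Bruijn_Newman_constant :: "real \<Rightarrow> bool" where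
  "is_de_Bruijn_Newman_constant L \<longleftrightarrow> (\<forall>t. only_real_zeros (H t) \<longleftrightarrow> L \<le> t)"

end

theory Submission
  imports Defs "HOL-Probability.Probability" "HOL-Real_Asymp.Real_Asymp"
begin

text \<open>
  The argument follows Dobner's proof of Newman's conjecture. Let \<open>T > 0\<close>. Since \<open>Phi\<close> is even (Jacobi's theta
  functional equation), \<open>2 * H (-T) z\<close> is the integral of \<open>exp (- T * u\<^sup>2) * Phi u * exp (\<i> * z * u)\<close> over the
  whole line, and the Gaussian factor makes it the sum of the contributions of the terms of \<open>Phi\<close>. The \<open>n\<close>-th
  contribution is a Gaussian average of Gamma factors. Near \<open>z = 4 * Y + \<i> * (1 - T / 2 * ln (Y / pi)) - 2 * \<i> * \<zeta>\<close>
  Stirling's approximation shows that, up to a nowhere vanishing factor, \<open>H (-T)\<close> is asymptotic for \<open>Y \<rightarrow> \<infinity>\<close> to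
  the sum over \<open>n\<close> of \<open>\<chi>(n) * exp (- T / 4 * (ln n)\<^sup>2) * n powr (- \<zeta>)\<close> with unimodular \<open>\<chi>(n)\<close> depending on \<open>Y\<close>.
  If \<open>H (-T)\<close> had only real zeros, a locally uniform limit of these functions of \<open>\<zeta>\<close> would be zero-free by
  Hurwitz, hence, being of order at most 2, the exponential of a quadratic polynomial. But it tends to a constant for
  \<open>Re \<zeta> \<rightarrow> \<infinity>\<close> without being constant, which is impossible.
\<close>

section \<open>Zero-free entire functions of order two\<close>

text \<open>Without the Gaussian factor the terms of \<open>Phi\<close> would lead to the Dirichlet
  series of zeta, which converges only in a half-plane. For \<open>T > 0\<close> the translation
  \<open>u = v - ln n / 2\<close> turns the Gaussian into the convergence factor
  \<open>exp (- T / 4 * (ln n)\<^sup>2)\<close>, and the series is entire in \<zeta>. The curve and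
  the constants come from a saddle point. With \<open>q = pi * exp (4 * v)\<close> the integrand
  behaves like \<open>q powr (1 + \<i> * Y) * exp (- q)\<close>, which is stationary near
  \<open>q = \<i> * Y\<close>, that is at \<open>v = ln (Y / pi) / 4 + \<i> * pi / 8\<close>. The
  real part of \<open>v\<close> dictates the drift \<open>T / 2 * ln (Y / pi)\<close> of the curve;
  the imaginary part produces the phase \<open>exp (\<i> * pi * T / 8 * ln n)\<close> and the
  constant \<open>exp (T * pi\<^sup>2 / 64)\<close>. The drift also drives the contradiction: in the
  coordinate \<zeta> the real axis of \<open>z\<close> is the line
  \<open>Re \<zeta> = 1/2 - T / 4 * ln (Y / pi)\<close>, which leaves every bounded set. Because the
  phases depend on \<open>Y\<close>, a limit is available only along a subsequence, by Montel's
  theorem. The end of the argument therefore relies only on the leading coefficient 1 and on the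
  moduli of the other coefficients.\<close>

lemma Borel_Caratheodory_entire:
  fixes h :: "complex \<Rightarrow> complex"
  assumes hol: "h holomorphic_on UNIV" and h0: "h 0 = 0"
    and bd: "\<And>z. norm z < 2 * r \<Longrightarrow> Re (h z) < M" and M: "M > 0" and r: "r > 0" and z: "norm z \<le> r"
  shows "norm (h z) \<le> 2 * M"
proof -
  \<comment> \<open>The map \<open>s / (2 * M - s)\<close> sends the half-plane
    \<open>Re s < M\<close> into the unit disc and fixes 0, so Schwarz's lemma applies. At
    \<open>norm w \<le> 1/2\<close> it yields \<open>norm h \<le> (2 * M + norm h) / 2\<close>,
    hence the bound \<open>2 * M\<close>.\<close>
  define \<phi> where "\<phi> w = h (of_real (2*r) * w) / (of_real (2*M) - h (of_real (2*r) * w))" for w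
  have nz: "of_real (2*M) - h (of_real (2*r) * w) \<noteq> 0" and lt: "norm (\<phi> w) < 1" if "norm w < 1" for w
  proof -
    let ?h = "h (of_real (2*r) * w)"
    have "norm (of_real (2*r) * w) < 2 * r" using that r by (simp add: norm_mult)
    from bd[OF this] have re: "Re ?h < M" .
    show nz: "of_real (2*M) - ?h \<noteq> 0"
    proof
      assume "of_real (2*M) - ?h = 0"
      hence "Re ?h = 2 * M" by (simp add: complex_eq_iff)
      with re M show False by simp
    qed
    have "(norm ?h)\<^sup>2 < (norm (of_real (2*M) - ?h))\<^sup>2"
    proof -
      have "M * Re ?h < M * M" using re M by simp
      thus ?thesis unfolding cmod_power2 by (simp add: power2_eq_square algebra_simps)
    qed
    hence "norm ?h < norm (of_real (2*M) - ?h)" by (rule power_less_imp_less_base) simp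
    thus "norm (\<phi> w) < 1" unfolding \<phi>_def using nz by (simp add: norm_divide)
  qed
  have holphi: "\<phi> holomorphic_on ball 0 1"
    unfolding \<phi>_def using nz
    by (intro holomorphic_intros holomorphic_on_compose_gen[OF _ hol, unfolded o_def]) (auto)
  define w where "w = z / of_real (2*r)"
  have w: "norm w \<le> 1/2" "z = of_real (2*r) * w" using z r by (auto simp: w_def norm_divide field_simps)
  have "norm (\<phi> w) \<le> norm w"
    by (rule Schwarz_Lemma(1)[OF holphi _ lt]) (use w in \<open>auto simp: \<phi>_def h0\<close>)
  hence le: "norm (\<phi> w) \<le> 1/2" using w by simp
  have nzw: "of_real (2*M) - h z \<noteq> 0" using nz[of w] w by auto
  have "norm (h z) \<le> 1/2 * norm (of_real (2*M) - h z)"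
    using le nzw unfolding \<phi>_def w(2)[symmetric] by (simp add: norm_divide field_simps)
  also have "norm (of_real (2*M) - h z) \<le> 2*M + norm (h z)"
    using norm_triangle_ineq4[of "of_real (2*M)" "h z"] M by (simp del: of_real_mult)
  finally show ?thesis by simp
qed

text \<open>The growth bound controls only the real part of a logarithm of \<open>G\<close>, and
  only from above. Borel-Caratheodory on the disc of twice the radius makes it a quadratic bound on
  the modulus, and Liouville's theorem for polynomial growth applies.\<close>

lemma zero_free_entire_quadratic:
  fixes G :: "complex \<Rightarrow> complex"
  assumes hol: "G holomorphic_on UNIV" and nz: "\<And>z. G z \<noteq> 0"
    and bd: "\<And>z. norm (G z) \<le> K * exp (L * (norm z)\<^sup>2)"
  obtains a b c where "\<And>z. G z = exp (a + b * z + c * z\<^sup>2)"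
proof -
  obtain g where g: "g holomorphic_on UNIV" "\<And>x. exp (g x) = G x"
    using holomorphic_logarithm_exists[of UNIV G 0] hol nz by auto
  define h where "h z = g z - g 0" for z
  have holh: "h holomorphic_on UNIV" unfolding h_def by (intro holomorphic_intros g)
  have h0: "h 0 = 0" by (simp add: h_def)
  have K: "K > 0"
    using bd[of 0] nz[of 0] by (metis exp_zero mult.right_neutral mult_zero_right norm_zero order_less_le_trans power_zero_numeral zero_less_norm_iff)
  define M0 where "M0 = \<bar>ln K - Re (g 0)\<bar> + 1"
  have re: "Re (h z) \<le> M0 + \<bar>L\<bar> * (norm z)\<^sup>2" for z
  proof -
    have "exp (Re (g z)) \<le> exp (ln K + L * (norm z)\<^sup>2)"
      using bd[of z] K unfolding g(2)[symmetric] by (simp add: exp_add)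
    hence "Re (g z) \<le> ln K + L * (norm z)\<^sup>2" by simp
    moreover have "L * (norm z)\<^sup>2 \<le> \<bar>L\<bar> * (norm z)\<^sup>2" by (intro mult_right_mono) auto
    ultimately show ?thesis unfolding h_def M0_def by simp
  qed
  have hb: "norm (h z) \<le> 2 * (M0 + 1 + 4 * \<bar>L\<bar>) * (norm z)\<^sup>2" if z: "norm z \<ge> 1" for z
  proof -
    let ?r = "norm z"
    have "norm (h z) \<le> 2 * (M0 + 1 + \<bar>L\<bar> * (2 * ?r)\<^sup>2)"
    proof (rule Borel_Caratheodory_entire[OF holh h0, of ?r])
      fix w :: complex assume w: "norm w < 2 * ?r"
      have "Re (h w) \<le> M0 + \<bar>L\<bar> * (norm w)\<^sup>2" by (rule re)
      also have "\<bar>L\<bar> * (norm w)\<^sup>2 \<le> \<bar>L\<bar> * (2 * ?r)\<^sup>2"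
        using w by (intro mult_left_mono power_mono) auto
      finally show "Re (h w) < M0 + 1 + \<bar>L\<bar> * (2 * ?r)\<^sup>2" by simp
    next
      show "0 < M0 + 1 + \<bar>L\<bar> * (2 * ?r)\<^sup>2" by (simp add: M0_def add_pos_nonneg)
    qed (use z in auto)
    also have "\<dots> \<le> 2 * (M0 + 1 + 4 * \<bar>L\<bar>) * ?r\<^sup>2"
    proof -
      have "1 \<le> ?r\<^sup>2" using z by simp
      hence "(M0 + 1) * 1 \<le> (M0 + 1) * ?r\<^sup>2" by (intro mult_left_mono) (auto simp: M0_def)
      thus ?thesis by (simp add: algebra_simps power_mult_distrib)
    qed
    finally show ?thesis .
  qed
  have "h \<xi> = (\<Sum>k\<le>2. (deriv ^^ k) h 0 / fact k * \<xi> ^ k)" for \<xi>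
    using Liouville_polynomial[OF holh hb] by blast
  hence hq: "h \<xi> = deriv h 0 * \<xi> + (deriv ^^ 2) h 0 / 2 * \<xi>\<^sup>2" for \<xi>
    by (simp add: numeral_2_eq_2 h0)
  have gh: "g z = g 0 + h z" for z by (simp add: h_def)
  have "G z = exp (g 0 + deriv h 0 * z + (deriv ^^ 2) h 0 / 2 * z\<^sup>2)" for z
    using g(2)[of z] unfolding gh[of z] hq[of z] by (simp add: add.assoc)
  thus ?thesis by (rule that)
qed

text \<open>Rescaling a nonzero \<open>w\<close> to modulus 1 puts its imaginary part strictly
  between \<open>- pi\<close> and \<open>pi\<close>, where \<open>Ln\<close> inverts
  \<open>exp\<close>; the single equation \<open>exp u = 1\<close> then forces
  \<open>u = 0\<close>.\<close>

lemma exp_line_eq_1: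
  fixes w :: complex
  assumes "\<And>s::real. s \<ge> 0 \<Longrightarrow> exp (of_real s * w) = 1"
  shows "w = 0"
proof (rule ccontr)
  assume w: "w \<noteq> 0"
  define u where "u = of_real (1 / norm w) * w"
  have u: "norm u = 1" using w by (simp add: u_def norm_divide)
  have "\<bar>Im u\<bar> \<le> 1" using abs_Im_le_cmod[of u] u by simp
  hence "Ln (exp u) = u" using pi_gt3 by (intro Ln_exp) auto
  moreover have "exp u = 1" unfolding u_def by (rule assms) simp
  ultimately show False using u by auto
qed

text \<open>Along every horizontal line \<open>G\<close> tends to the same \<open>C\<close>, so the
  quotient of its values on two such lines tends to 1. That quotient is the exponential of an
  expression affine in \<open>x\<close>, which eliminates first the quadratic and then the linear
  coefficient.\<close>

lemma zero_free_entire_impossible: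
  fixes G :: "complex \<Rightarrow> complex"
  assumes hol: "G holomorphic_on UNIV" and nz: "\<And>z. G z \<noteq> 0"
    and bd: "\<And>z. norm (G z) \<le> K * exp (L * (norm z)\<^sup>2)"
    and C: "C \<noteq> 0"
    and lim: "\<And>z. Re z \<ge> 0 \<Longrightarrow> norm (G z - C) \<le> K' * 2 powr (- Re z)"
    and ne: "\<And>x::real. x \<ge> x0 \<Longrightarrow> G (of_real x) \<noteq> C"
  shows False
proof -
  obtain a b c where G: "\<And>z. G z = exp (a + b * z + c * z\<^sup>2)"
    using zero_free_entire_quadratic[OF hol nz bd] by blast
  have limG: "((\<lambda>x::real. G (of_real x + \<i> * of_real y)) \<longlongrightarrow> C) at_top" for y :: real
  proof -
    have "((\<lambda>x::real. K' * 2 powr (-x)) \<longlongrightarrow> 0) at_top" by real_asymp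
    hence "((\<lambda>x::real. G (of_real x + \<i> * of_real y) - C) \<longlongrightarrow> 0) at_top"
    proof (rule Lim_null_comparison[rotated])
      show "\<forall>\<^sub>F x::real in at_top. norm (G (of_real x + \<i> * of_real y) - C) \<le> K' * 2 powr (-x)"
        using eventually_ge_at_top[of 0]
      proof eventually_elim
        case (elim x)
        thus ?case using lim[of "of_real x + \<i> * of_real y"] by simp
      qed
    qed
    thus ?thesis by (simp add: LIM_zero_iff)
  qed
  have ratio: "((\<lambda>x::real. G (of_real x + \<i> * of_real y) / G (of_real x + \<i> * of_real 0)) \<longlongrightarrow> 1) at_top" for y :: real
    using tendsto_divide[OF limG[of y] limG[of 0] C] C by simp
  have quot: "G (of_real x + \<i> * of_real y) / G (of_real x + \<i> * of_real 0) 
     = exp (b * \<i> * of_real y + c * (2 * \<i> * of_real x * of_real y - of_real (y\<^sup>2)))" for x y :: real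
    unfolding G by (simp add: exp_diff[symmetric] power2_eq_square algebra_simps)
  have lim1: "((\<lambda>x::real. exp (b * \<i> * of_real y + c * (2 * \<i> * of_real x * of_real y - of_real (y\<^sup>2)))) \<longlongrightarrow> 1) at_top" for y :: real
    using ratio[of y] unfolding quot .
  have "exp (of_real s * (- 2 * c)) = 1" if s: "s \<ge> 0" for s :: real
  proof -
    define y where "y = sqrt s"
    have y: "y\<^sup>2 = s" using s by (simp add: y_def)
    \<comment> \<open>A second difference: the exponent at height \<open>2 * y\<close> minus twice
      the exponent at height \<open>y\<close> loses both \<open>b\<close> and \<open>x\<close> and
      leaves \<open>- 2 * c * y\<^sup>2\<close>.\<close>
    have "((\<lambda>x::real. exp (of_real s * (- 2 * c))) \<longlongrightarrow> 1 / 1 ^ 2) at_top"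
    proof (rule Lim_transform_eventually[OF tendsto_divide[OF lim1[of "2*y"] tendsto_power[OF lim1[of y], of 2]]])
      show "\<forall>\<^sub>F x in at_top. exp (b * \<i> * of_real (2*y) + c * (2 * \<i> * of_real x * of_real (2*y) - of_real ((2*y)\<^sup>2))) /
              (exp (b * \<i> * of_real y + c * (2 * \<i> * of_real x * of_real y - of_real (y\<^sup>2))))\<^sup>2
            = exp (of_real s * (- 2 * c))"
        unfolding y[symmetric] exp_double[symmetric] exp_diff[symmetric]
        by (intro always_eventually allI arg_cong[where f = exp]) (simp add: algebra_simps power2_eq_square)
    qed auto
    thus ?thesis by (simp add: tendsto_const_iff)
  qed
  hence "- 2 * c = 0" by (rule exp_line_eq_1)
  hence 1: "c = 0" by simp
  have "exp (of_real y * (b * \<i>)) = 1" for y :: real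
    using lim1[of y] unfolding 1 by (simp add: tendsto_const_iff mult_ac)
  hence "b * \<i> = 0" by (rule exp_line_eq_1)
  hence 2: "b = 0" by simp
  have "G z = exp a" for z by (simp add: G 1 2)
  moreover from this limG[of 0] have "C = exp a" by (simp add: tendsto_const_iff)
  ultimately show False using ne[of x0] by simp
qed

section \<open>Ratios of the Gamma function on vertical lines\<close>

text \<open>The derivative of \<open>Ln (1 + w) - w\<close> is \<open>- w / (1 + w)\<close>, and
  \<open>norm (1 + w) \<ge> 1\<close> in the right half-plane; \<open>u\<close> may therefore be
  large.\<close>

lemma norm_Ln_1_plus_minus_le:
  assumes "Re u \<ge> 0"
  shows "norm (Ln (1 + u) - u) \<le> (norm u)\<^sup>2"
proof -
  have seg: "Re w \<ge> 0 \<and> norm w \<le> norm u" if "w \<in> closed_segment 0 u" for w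
    using that assms by (auto simp: in_segment norm_mult mult_left_le_one_le)
  have "norm ((Ln (1 + u) - u) - (Ln (1 + 0) - 0)) \<le> norm u * norm (u - 0)"
  proof (rule field_differentiable_bound[of "closed_segment 0 u" "\<lambda>w. Ln (1 + w) - w" "\<lambda>w. inverse (1 + w) - 1"])
    fix w assume w: "w \<in> closed_segment 0 u"
    have re: "Re (1 + w) \<ge> 1" using seg[OF w] by simp
    hence nz: "1 + w \<noteq> 0" and np: "1 + w \<notin> \<real>\<^sub>\<le>\<^sub>0" 
      by (auto simp: complex_nonpos_Reals_iff complex_eq_iff)
    show "((\<lambda>w. Ln (1 + w) - w) has_field_derivative inverse (1 + w) - 1) (at w within closed_segment 0 u)"
      by (rule derivative_eq_intros refl np | simp)+
    have "inverse (1 + w) - 1 = - w / (1 + w)" using nz by (simp add: field_simps)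
    also have "norm \<dots> \<le> norm w / 1"
      unfolding norm_divide norm_minus_cancel using re complex_Re_le_cmod[of "1+w"] by (intro divide_left_mono) auto
    finally show "norm (inverse (1 + w) - 1) \<le> norm u" using seg[OF w] by simp
  qed auto
  thus ?thesis by (simp add: power2_eq_square)
qed

text \<open>\<open>Digamma s\<close> is the limit of \<open>ln m\<close> minus the sum of
  \<open>1 / (s + k)\<close> for \<open>k < m\<close>. Telescoping writes
  \<open>Ln (s + m) - Ln s\<close> as the sum of \<open>Ln (1 + 1 / (s + k))\<close>, so the
  difference is a sum of errors \<open>Ln (1 + u) - u\<close> with
  \<open>u = 1 / (s + k)\<close>.\<close>

lemma norm_Digamma_minus_Ln_le:
  fixes s :: complex
  assumes s: "Re s \<ge> 1" and B: "\<And>m. (\<Sum>k<m. 1 / (norm (s + of_nat k))\<^sup>2) \<le> B"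
  shows "norm (Digamma s - Ln s) \<le> B"
proof -
  have sk: "Re (s + of_nat k) \<ge> 1" "s + of_nat k \<noteq> 0" for k
    using s by (auto simp: complex_eq_iff)
  have inv: "Re (1 / (s + of_nat k)) \<ge> 0" for k
    using sk[of k] by (simp add: Re_divide)
  have Lnsum: "Ln (s + of_nat m) = Ln s + (\<Sum>k<m. Ln (1 + 1 / (s + of_nat k)))" for m
  proof (induction m)
    case (Suc m)
    have eq: "s + of_nat (Suc m) = (s + of_nat m) * (1 + 1 / (s + of_nat m))" using sk[of m] by (simp add: field_simps)
    have "Re (1 + 1 / (s + of_nat m)) > 0" using inv[of m] by simp
    moreover have "Re (s + of_nat m) > 0" using sk[of m] by simp
    ultimately have "Ln (s + of_nat (Suc m)) = Ln (s + of_nat m) + Ln (1 + 1 / (s + of_nat m))"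
      unfolding eq using Re_Ln_pos_lt_imp[of "s + of_nat m"] Re_Ln_pos_lt_imp[of "1 + 1 / (s + of_nat m)"]
      by (intro Ln_times_simple) (auto simp: complex_eq_iff abs_less_iff)
    thus ?case using Suc by simp
  qed simp
  have "(\<lambda>m. of_real (ln (real m)) - (\<Sum>n<m. inverse (s + of_nat n)) - Ln s) \<longlonglongrightarrow> Digamma s - Ln s"
    by (intro tendsto_intros Digamma_LIMSEQ) (use s in auto)
  \<comment> \<open>Adding this null sequence replaces \<open>ln m\<close> by
    \<open>Ln (s + m)\<close>, the quantity that telescopes.\<close>
  moreover have "(\<lambda>m. Ln (1 + s / of_nat m)) \<longlonglongrightarrow> Ln (1 + 0)"
    by (intro tendsto_intros lim_const_over_n) auto
  ultimately have lim: "(\<lambda>m. of_real (ln (real m)) - (\<Sum>n<m. inverse (s + of_nat n)) - Ln s + Ln (1 + s / of_nat m)) \<longlonglongrightarrow> Digamma s - Ln s"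
    using tendsto_add by fastforce
  show ?thesis
  proof (rule tendsto_upperbound[OF tendsto_norm[OF lim]])
    show "\<forall>\<^sub>F m in sequentially. norm (of_real (ln (real m)) - (\<Sum>n<m. inverse (s + of_nat n)) - Ln s + Ln (1 + s / of_nat m)) \<le> B"
      using eventually_gt_at_top[of 0]
    proof eventually_elim
      case (elim m)
      have eq: "s + of_nat m = of_real (real m) * (1 + s / of_nat m)" using elim by (simp add: field_simps)
      have "Re (1 + s / of_nat m) > 0" using s by (simp add: add_pos_nonneg)
      hence "1 + s / of_nat m \<noteq> 0" by (auto simp: complex_eq_iff)
      hence "Ln (s + of_nat m) = of_real (ln (real m)) + Ln (1 + s / of_nat m)"
        unfolding eq using elim by (subst Ln_times_of_real) auto
      hence "of_real (ln (real m)) - (\<Sum>n<m. inverse (s + of_nat n)) - Ln s + Ln (1 + s / of_nat m)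
          = (\<Sum>k<m. Ln (1 + 1 / (s + of_nat k)) - 1 / (s + of_nat k))"
        unfolding sum_subtractf using Lnsum[of m] by (simp add: inverse_eq_divide algebra_simps)
      also have "norm \<dots> \<le> (\<Sum>k<m. (norm (1 / (s + of_nat k)))\<^sup>2)"
        by (intro sum_norm_le norm_Ln_1_plus_minus_le inv)
      also have "\<dots> \<le> B" using B[of m] by (simp add: norm_divide power_divide)
      finally show ?case .
    qed
  qed auto
qed

text \<open>The exponent -2 of \<open>norm (s + k)\<close> is split: \<open>-3/2\<close> buys
  summability through \<open>norm (s + k) \<ge> k + 1\<close>, and \<open>-1/2\<close> buys decay
  through \<open>norm (s + k) \<ge> Im s\<close>. Any rate of decay suffices for the later
  limits.\<close>

lemma Digamma_minus_Ln_bounds: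
  obtains C where "C > 0" "\<And>s. Re s \<ge> 1 \<Longrightarrow> norm (Digamma s - Ln s) \<le> C"
    "\<And>s. Re s \<ge> 1 \<Longrightarrow> Im s > 0 \<Longrightarrow> norm (Digamma s - Ln s) \<le> C * Im s powr (- 1 / 2)"
proof
  define C where "C = (\<Sum>k. real (Suc k) powr (- 3 / 2))"
  have sm: "summable (\<lambda>k. real (Suc k) powr (- 3 / 2))"
    by (subst summable_Suc_iff) (simp add: summable_real_powr_iff)
  show "C > 0" unfolding C_def by (rule suminf_pos[OF sm]) auto
  have Csum: "(\<Sum>k<m. real (Suc k) powr (- 3 / 2)) \<le> C" for m
    unfolding C_def by (rule sum_le_suminf[OF sm]) auto
  have cm: "norm (s + of_nat k) \<ge> real (Suc k)" "norm (s + of_nat k) \<ge> \<bar>Im s\<bar>" if "Re s \<ge> 1" for s k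
    using that complex_Re_le_cmod[of "s + of_nat k"] abs_Im_le_cmod[of "s + of_nat k"] by simp_all
  have C1: "1 / (norm (s + of_nat k))\<^sup>2 \<le> real (Suc k) powr (-3/2)" if "Re s \<ge> 1" for s k
  proof -
    have "1 / (norm (s + of_nat k))\<^sup>2 \<le> 1 / (real (Suc k))\<^sup>2"
      using cm[OF that, of k] by (intro divide_left_mono power_mono mult_pos_pos zero_less_power) auto
    also have "\<dots> = real (Suc k) powr (-2)" by (simp add: powr_minus powr_numeral divide_simps)
    also have "\<dots> \<le> real (Suc k) powr (-3/2)" by (intro powr_mono) auto
    finally show ?thesis .
  qed
  have C2: "1 / (norm (s + of_nat k))\<^sup>2 \<le> real (Suc k) powr (-3/2) * Im s powr (-1/2)" if "Re s \<ge> 1" "Im s > 0" for s k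
  proof -
    let ?N = "norm (s + of_nat k)"
    have N: "?N > 0" using cm(1)[OF that(1), of k] by (smt (verit) of_nat_0_less_iff zero_less_Suc)
    have "1 / ?N\<^sup>2 = ?N powr (-3/2) * ?N powr (-1/2)"
      using N by (simp add: powr_add[symmetric] powr_minus powr_numeral divide_simps)
    also have "\<dots> \<le> real (Suc k) powr (-3/2) * Im s powr (-1/2)"
      using cm[OF that(1), of k] that(2) by (intro mult_mono powr_mono2') auto
    finally show ?thesis .
  qed
  show "norm (Digamma s - Ln s) \<le> C" if "Re s \<ge> 1" for s
  proof (rule norm_Digamma_minus_Ln_le[OF that])
    show "(\<Sum>k<m. 1 / (norm (s + of_nat k))\<^sup>2) \<le> C" for m
      using sum_mono[of "{..<m}", OF C1[OF that]] Csum[of m] by (rule order_trans)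
  qed
  show "norm (Digamma s - Ln s) \<le> C * Im s powr (- 1 / 2)" if "Re s \<ge> 1" "Im s > 0" for s
  proof (rule norm_Digamma_minus_Ln_le[OF that(1)])
    fix m
    have "(\<Sum>k<m. 1 / (norm (s + of_nat k))\<^sup>2) \<le> (\<Sum>k<m. real (Suc k) powr (-3/2) * Im s powr (-1/2))"
      by (intro sum_mono C2 that)
    also have "\<dots> \<le> C * Im s powr (-1/2)"
      unfolding sum_distrib_right[symmetric] by (intro mult_right_mono Csum) auto
    finally show "(\<Sum>k<m. 1 / (norm (s + of_nat k))\<^sup>2) \<le> C * Im s powr (- 1 / 2)" by simp
  qed
qed


text \<open>Relative error of approximating \<open>Gamma (P + d)\<close> by
  \<open>Gamma P * (\<i> * Y) powr d\<close> at \<open>P = 1 + \<i> * Y\<close>. It is the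
  exponential of the integral of \<open>Digamma (P + w) - Ln (\<i> * Y)\<close> along the segment
  from 0 to \<open>d\<close>, which reduces it to estimates for \<open>Digamma\<close>.\<close>

definition Gamma_ratio :: "real \<Rightarrow> complex \<Rightarrow> complex" where
  "Gamma_ratio Y d = Gamma (1 + \<i> * of_real Y + d) / Gamma (1 + \<i> * of_real Y) * exp (- d * Ln (\<i> * of_real Y))"

lemma Ln_i_times: "Y > 0 \<Longrightarrow> Ln (\<i> * of_real Y) = of_real (ln Y) + \<i> * of_real (pi / 2)"
  using Ln_times_of_real[of Y \<i>] by (simp add: mult.commute Ln_of_real)

lemma Gamma_ratio_eq_exp:
  assumes d: "Re d \<ge> 0"
    and B: "\<And>w. w \<in> closed_segment 0 d \<Longrightarrow> norm (Digamma (1 + \<i> * of_real Y + w) - Ln (\<i> * of_real Y)) \<le> B"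
  obtains w where "Gamma_ratio Y d = exp w" "norm w \<le> B * norm d"
proof -
  let ?P = "1 + \<i> * of_real Y" and ?L = "Ln (\<i> * of_real Y)"
  define f where "f w = ln_Gamma (?P + w) - w * ?L" for w
  have re: "Re (?P + w) \<ge> 1" if "w \<in> closed_segment 0 d" for w
    using that d by (auto simp: in_segment)
  have np: "?P + w \<notin> \<real>\<^sub>\<le>\<^sub>0" "?P + w \<notin> \<int>\<^sub>\<le>\<^sub>0" if "w \<in> closed_segment 0 d" for w
    using re[OF that] nonpos_Ints_subset_nonpos_Reals by (auto simp: complex_nonpos_Reals_iff)
  have "norm (f d - f 0) \<le> B * norm (d - 0)"
  proof (rule field_differentiable_bound[of "closed_segment 0 d" f "\<lambda>w. Digamma (?P + w) - ?L"])
    fix w assume w: "w \<in> closed_segment 0 d"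
    show "(f has_field_derivative Digamma (?P + w) - ?L) (at w within closed_segment 0 d)"
      unfolding f_def by (rule derivative_eq_intros refl np[OF w] | simp)+
  qed (use B in auto)
  moreover have "Gamma_ratio Y d = exp (f d - f 0)"
    using np[of d] np[of 0] unfolding Gamma_ratio_def f_def
    by (simp add: exp_diff exp_minus Gamma_complex_altdef exp_add field_simps)
  ultimately show ?thesis using that by auto
qed

text \<open>Uniformity in \<open>Y\<close> holds because \<open>Y\<close> and
  \<open>norm (P + w)\<close> agree up to the factor \<open>2 + norm d\<close> in both directions;
  the arguments differ by at most \<open>pi\<close>. The resulting growth in \<open>d\<close> is
  weaker than any Gaussian, as a dominating function requires.\<close>

lemma Gamma_ratio_bound:
  obtains C where "C > 0" "\<And>Y d. Y \<ge> 1 \<Longrightarrow> Re d \<ge> 0 \<Longrightarrow> norm (Gamma_ratio Y d) \<le> exp (norm d * (C + ln (2 + norm d)))"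
proof -
  obtain C where C: "C > 0" "\<And>s. Re s \<ge> 1 \<Longrightarrow> norm (Digamma s - Ln s) \<le> C"
    using Digamma_minus_Ln_bounds by metis
  have "norm (Gamma_ratio Y d) \<le> exp (norm d * (C + pi + ln (2 + norm d)))" if Y: "Y \<ge> 1" and d: "Re d \<ge> 0" for Y d
  proof -
    let ?P = "1 + \<i> * of_real Y" and ?L = "Ln (\<i> * of_real Y)"
    have B: "norm (Digamma (?P + w) - ?L) \<le> C + pi + ln (2 + norm d)" if w: "w \<in> closed_segment 0 d" for w
    proof -
      have wd: "norm w \<le> norm d" "Re w \<ge> 0"
        using w d by (auto simp: in_segment norm_mult mult_left_le_one_le)
      define p where "p = ?P + w"
      have p1: "Re p \<ge> 1" using wd by (simp add: p_def)
      hence np: "norm p \<ge> 1" using complex_Re_le_cmod[of p] by simp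
      have p0: "p \<noteq> 0" using np by auto
      have d2: "2 + norm d > 0" by (simp add: add_pos_nonneg)
      have "norm p \<le> norm ?P + norm d" using wd norm_triangle_ineq[of ?P w] by (simp add: p_def)
      also have "norm ?P \<le> 1 + Y" using norm_triangle_ineq[of 1 "\<i> * of_real Y"] Y by (simp add: norm_mult)
      finally have "norm p \<le> Y * (2 + norm d)" using Y
        mult_right_mono[of 1 Y "norm d"] by (simp add: algebra_simps)
      hence 1: "ln (norm p) \<le> ln Y + ln (2 + norm d)"
        using np Y d2 by (subst ln_mult_pos[symmetric]) (auto intro!: ln_mono)
      have "Y \<le> norm p + 1 + norm d"
      proof -
        have "Y = norm (p - (1 + w))" using Y by (simp add: p_def norm_mult)
        also have "\<dots> \<le> norm p + norm (1 + w)" by (rule norm_triangle_ineq4)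
        also have "norm (1 + w) \<le> 1 + norm d" using norm_triangle_ineq[of 1 w] wd by simp
        finally show ?thesis by simp
      qed
      also have "\<dots> \<le> norm p * (2 + norm d)" using np mult_right_mono[of 1 "norm p" "norm d"]
        by (simp add: algebra_simps)
      finally have 2: "ln Y \<le> ln (norm p) + ln (2 + norm d)"
        using np Y d2 by (subst ln_mult_pos[symmetric]) (auto intro!: ln_mono simp del: norm_le_zero_iff zero_less_norm_iff)
      have re: "\<bar>Re (Ln p - ?L)\<bar> \<le> ln (2 + norm d)"
        using 1 2 Y p0 by (simp add: Ln_i_times)
      have im: "\<bar>Im (Ln p - ?L)\<bar> \<le> pi"
        using Re_Ln_pos_lt_imp[of p] p1 Y by (simp add: Ln_i_times abs_le_iff abs_less_iff)
      have "norm (Digamma p - ?L) \<le> norm (Digamma p - Ln p) + norm (Ln p - ?L)"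
        using norm_triangle_ineq[of "Digamma p - Ln p" "Ln p - ?L"] by simp
      also have "norm (Ln p - ?L) \<le> ln (2 + norm d) + pi"
        using cmod_le[of "Ln p - ?L"] re im by linarith
      finally show ?thesis using C(2)[OF p1] by (simp add: p_def)
    qed
    obtain w where w: "Gamma_ratio Y d = exp w" "norm w \<le> (C + pi + ln (2 + norm d)) * norm d"
      by (rule Gamma_ratio_eq_exp[OF d B])
    have "norm (exp w) \<le> exp (norm w)" by (rule norm_exp)
    also have "\<dots> \<le> exp (norm d * (C + pi + ln (2 + norm d)))" using w by (simp add: mult.commute)
    finally show ?thesis using w by simp
  qed
  thus ?thesis using that[of "C + pi"] C pi_gt_zero by auto
qed

text \<open>For fixed \<open>d\<close> and large \<open>Y\<close> the whole segment keeps its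
  imaginary part above \<open>Y / 2\<close>, and \<open>P + w = \<i> * Y * (1 + u)\<close> with
  \<open>u\<close> of size \<open>1 / Y\<close>; so the exponent of
  \<open>Gamma_ratio_eq_exp\<close> is a null function of \<open>Y\<close>.\<close>

lemma tendsto_Gamma_ratio:
  assumes d: "Re d \<ge> 0"
  shows "((\<lambda>Y. Gamma_ratio Y d) \<longlongrightarrow> 1) at_top"
proof -
  obtain C where C: "C > 0" "\<And>s. Re s \<ge> 1 \<Longrightarrow> Im s > 0 \<Longrightarrow> norm (Digamma s - Ln s) \<le> C * Im s powr (- 1 / 2)"
    using Digamma_minus_Ln_bounds by metis
  define B where "B Y = C * (Y / 2) powr (-1/2) + 2 * ((1 + norm d) / Y)" for Y
  have ev: "\<forall>\<^sub>F Y in at_top. \<exists>w. Gamma_ratio Y d = exp w \<and> norm w \<le> B Y * norm d"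
    using eventually_gt_at_top[of "2 * norm d + 2"]
  proof eventually_elim
    case (elim Y)
    let ?P = "1 + \<i> * of_real Y" and ?L = "Ln (\<i> * of_real Y)"
    have elim': "Y > 2 * norm d + 2" by fact
    have Y: "Y > 0" using elim by (smt (verit) norm_ge_zero)
    have "norm (Digamma (?P + w) - ?L) \<le> B Y" if w: "w \<in> closed_segment 0 d" for w
    proof -
      have wd: "norm w \<le> norm d" "Re w \<ge> 0"
        using w d by (auto simp: in_segment norm_mult mult_left_le_one_le)
      define p where "p = ?P + w"
      have p1: "Re p \<ge> 1" using wd by (simp add: p_def)
      have imp: "Im p \<ge> Y / 2" using wd abs_Im_le_cmod[of w] elim by (simp add: p_def)
      have 1: "norm (Digamma p - Ln p) \<le> C * (Y / 2) powr (-1/2)"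
        using C(2)[OF p1] imp Y C(1) by (smt (verit, ccfv_SIG) mult_left_mono powr_mono2' divide_minus_left half_gt_zero zero_less_divide_1_iff)
      define u where "u = (1 + w) / (\<i> * of_real Y)"
      have pu: "p = \<i> * of_real Y * (1 + u)" using Y by (simp add: u_def p_def field_simps)
      have "norm (1 + w) \<le> 1 + norm d" using norm_triangle_ineq[of 1 w] wd by simp
      hence nu: "norm u \<le> (1 + norm d) / Y" using Y by (simp add: u_def norm_divide norm_mult divide_right_mono)
      also have "\<dots> < 1/2" using elim' Y by (simp add: field_simps)
      finally have nu2: "norm u < 1/2" .
      have re: "Re (1 + u) > 0" using nu2 abs_Re_le_cmod[of u] by simp
      have "Ln p = ?L + Ln (1 + u)"
        unfolding pu using Re_Ln_pos_lt_imp[OF re] re Y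
        by (intro Ln_times_simple) (auto simp: Ln_i_times complex_eq_iff abs_less_iff)
      hence "norm (Ln p - ?L) \<le> 2 * norm u" using norm_Ln_le[OF nu2] by simp
      also have "\<dots> \<le> 2 * ((1 + norm d) / Y)" by (intro mult_left_mono nu) auto
      finally have "norm (Ln p - ?L) \<le> 2 * ((1 + norm d) / Y)" .
      with 1 show ?thesis 
        using norm_triangle_ineq[of "Digamma p - Ln p" "Ln p - ?L"] by (simp add: B_def p_def)
    qed
    then obtain w where "Gamma_ratio Y d = exp w" "norm w \<le> B Y * norm d" by (rule Gamma_ratio_eq_exp[OF d])
    thus ?case by blast
  qed
  have B0: "((\<lambda>Y. B Y * norm d) \<longlongrightarrow> 0) at_top" unfolding B_def by real_asymp
  \<comment> \<open>The exponents were obtained for each \<open>Y\<close> separately; a choice turns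
    them into one function whose limit can be taken.\<close>
  define W where "W Y = (SOME w. Gamma_ratio Y d = exp w \<and> norm w \<le> B Y * norm d)" for Y
  have W: "\<forall>\<^sub>F Y in at_top. Gamma_ratio Y d = exp (W Y) \<and> norm (W Y) \<le> B Y * norm d"
    using ev by eventually_elim (unfold W_def, rule someI_ex)
  have "(W \<longlongrightarrow> 0) at_top"
    by (rule Lim_null_comparison[OF _ B0]) (use W in \<open>auto elim: eventually_mono\<close>)
  from tendsto_exp[OF this] have "((\<lambda>Y. exp (W Y)) \<longlongrightarrow> 1) at_top" by simp
  thus ?thesis by (rule Lim_transform_eventually) (use W in \<open>auto elim: eventually_mono\<close>)
qed

text \<open>\<open>x * ln x\<close> is negligible against \<open>\<epsilon> * x\<^sup>2\<close>, so
  \<epsilon> may be fitted to the Gaussian weight later. The linear factor, paid for by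
  \<open>exp x\<close>, is the \<open>2 * p - 3\<close> in the transform of a single term of
  \<open>Phi\<close>.\<close>

lemma Gamma_ratio_gaussian_bound:
  fixes \<epsilon> :: real
  assumes "\<epsilon> > 0"
  obtains K where "K > 0" "\<And>Y d. Y \<ge> 1 \<Longrightarrow> Re d \<ge> 0 \<Longrightarrow>
     norm (Gamma_ratio Y d * (2 * (1 + \<i> * of_real Y + d) - 3) / (2 * (1 + \<i> * of_real Y))) \<le> K * exp (\<epsilon> * (norm d)\<^sup>2)"
proof -
  obtain C where C: "C > 0" "\<And>Y d. Y \<ge> 1 \<Longrightarrow> Re d \<ge> 0 \<Longrightarrow> norm (Gamma_ratio Y d) \<le> exp (norm d * (C + ln (2 + norm d)))"
    using Gamma_ratio_bound by blast
  \<comment> \<open>These are the constants of the tangent bound \<open>ln y \<le> y - 1\<close> at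
    \<open>y = \<epsilon>/2 * (2 + x)\<close>; the summand 1 makes room for the factor
    \<open>exp x\<close>.\<close>
  define D where "D = C + 1 + \<epsilon> + \<bar>ln (\<epsilon>/2)\<bar>"
  have "norm (Gamma_ratio Y d * (2 * (1 + \<i> * of_real Y + d) - 3) / (2 * (1 + \<i> * of_real Y))) \<le> (2 * exp (D\<^sup>2 / (2*\<epsilon>))) * exp (\<epsilon> * (norm d)\<^sup>2)"
    if Y: "Y \<ge> 1" and d: "Re d \<ge> 0" for Y d
  proof -
    define x where "x = norm d"
    have x: "x \<ge> 0" by (simp add: x_def)
    have P: "norm (1 + \<i> * of_real Y) \<ge> Y" using abs_Im_le_cmod[of "1 + \<i> * of_real Y"] Y by simp
    have "norm (2 * (1 + \<i> * of_real Y + d) - 3) = norm (2 * d + 2 * (\<i> * of_real Y) - 1)" by (simp add: algebra_simps)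
    also have "\<dots> \<le> 2 * x + 2 * Y + 1"
      using norm_triangle_ineq4[of "2 * d + 2 * (\<i> * of_real Y)" 1] norm_triangle_ineq[of "2*d" "2 * (\<i> * of_real Y)"] Y
      by (simp add: norm_mult x_def)
    also have "\<dots> \<le> (2 * (1 + x)) * (2 * Y)"
    proof -
      have "x * 1 \<le> x * Y" by (rule mult_left_mono) (use Y x in auto)
      thus ?thesis using Y x by (simp add: algebra_simps)
    qed
    finally have "norm ((2 * (1 + \<i> * of_real Y + d) - 3) / (2 * (1 + \<i> * of_real Y))) \<le> (2 * (1 + x)) * (2 * Y) / (2 * Y)"
      unfolding norm_divide norm_mult[of 2] using P Y x by (intro frac_le) (auto simp: norm_mult)
    also have "\<dots> = 2 * (1 + x)" using Y by simp
    also have "\<dots> \<le> 2 * exp x" by (intro mult_left_mono exp_ge_add_one_self) auto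
    finally have 1: "norm ((2 * (1 + \<i> * of_real Y + d) - 3) / (2 * (1 + \<i> * of_real Y))) \<le> 2 * exp x" .
    have "ln (\<epsilon>/2 * (2 + x)) \<le> \<epsilon>/2 * (2 + x) - 1"
      using assms x by (intro ln_le_minus_one) auto
    moreover have "ln (\<epsilon>/2 * (2 + x)) = ln (\<epsilon>/2) + ln (2 + x)"
      using assms x by (intro ln_mult_pos) auto
    ultimately have "C + ln (2 + x) \<le> D - 1 + \<epsilon>/2 * x" unfolding D_def by (simp add: algebra_simps)
    hence "x * (C + ln (2 + x)) \<le> x * (D - 1 + \<epsilon>/2 * x)" by (intro mult_left_mono x)
    hence "x * (C + ln (2 + x)) + x \<le> D * x + \<epsilon>/2 * x\<^sup>2" by (simp add: algebra_simps power2_eq_square)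
    also have "D * x \<le> D\<^sup>2 / (2 * \<epsilon>) + \<epsilon>/2 * x\<^sup>2"
    proof -
      have "0 \<le> (D - \<epsilon> * x)\<^sup>2 / (2 * \<epsilon>)" using assms by simp
      also have "\<dots> = D\<^sup>2 / (2 * \<epsilon>) + \<epsilon>/2 * x\<^sup>2 - D * x" using assms
        by (simp add: power2_eq_square field_simps)
      finally show ?thesis by simp
    qed
    finally have 2: "x * (C + ln (2 + x)) + x \<le> D\<^sup>2 / (2 * \<epsilon>) + \<epsilon> * x\<^sup>2" by simp
    have "norm (Gamma_ratio Y d * (2 * (1 + \<i> * of_real Y + d) - 3) / (2 * (1 + \<i> * of_real Y)))
       = norm (Gamma_ratio Y d) * norm ((2 * (1 + \<i> * of_real Y + d) - 3) / (2 * (1 + \<i> * of_real Y)))"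
      by (simp add: norm_mult norm_divide)
    also have "\<dots> \<le> exp (x * (C + ln (2 + x))) * (2 * exp x)"
      using C(2)[OF Y d] 1 by (intro mult_mono) (auto simp: x_def)
    also have "\<dots> = 2 * exp (x * (C + ln (2 + x)) + x)" by (simp add: exp_add)
    also have "\<dots> \<le> 2 * exp (D\<^sup>2 / (2 * \<epsilon>) + \<epsilon> * x\<^sup>2)" using 2 by simp
    also have "\<dots> = (2 * exp (D\<^sup>2 / (2*\<epsilon>))) * exp (\<epsilon> * x\<^sup>2)" by (simp add: exp_add)
    finally show ?thesis by (simp add: x_def)
  qed
  thus ?thesis by (rule that[rotated]) simp_all
qed

section \<open>Gaussian integrals\<close>

lemma integrable_exp_neg_square:
  assumes A: "A > 0"
  shows "integrable lborel (\<lambda>r::real. exp (- (A * r\<^sup>2)))"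
proof -
  have "integrable lborel (\<lambda>r. sqrt (pi / A) * normal_density 0 (sqrt (1 / (2 * A))) r)"
    using A by (intro integrable_mult_right integrable_normal_density) auto
  also have "(\<lambda>r. sqrt (pi / A) * normal_density 0 (sqrt (1 / (2 * A))) r) = (\<lambda>r. exp (- (A * r\<^sup>2)))"
    using A by (auto simp: normal_density_def fun_eq_iff real_sqrt_divide real_sqrt_mult field_simps)
  finally show ?thesis .
qed

text \<open>The characteristic function of the standard normal distribution, rescaled by
  \<open>c = sqrt (2 * A)\<close>.\<close>

lemma gaussian_fourier_real:
  assumes A: "A > 0"
  shows "(LINT r|lborel. exp (of_real (- (A * r\<^sup>2)) + \<i> * of_real (t * r))) = complex_of_real (sqrt (pi / A) * exp (- t\<^sup>2 / (4 * A)))"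
proof -
  define c where "c = sqrt (2 * A)"
  have c: "c > 0" "c\<^sup>2 = 2 * A" using A by (auto simp: c_def)
  have "complex_of_real (exp (- ((t/c)\<^sup>2) / 2)) = char std_normal_distribution (t/c)"
    by (simp add: char_std_normal_distribution)
  also have "\<dots> = (LINT y|lborel. std_normal_density y *\<^sub>R iexp (t/c * y))"
    unfolding char_def by (subst integral_density) auto
  also have "\<dots> = \<bar>c\<bar> *\<^sub>R (LINT r|lborel. std_normal_density (0 + c * r) *\<^sub>R iexp (t/c * (0 + c * r)))"
    by (rule lborel_integral_real_affine) (use c in auto)
  also have "(\<lambda>r. std_normal_density (0 + c * r) *\<^sub>R iexp (t/c * (0 + c * r)))
     = (\<lambda>r. of_real (1 / sqrt (2 * pi)) * exp (of_real (- (A * r\<^sup>2)) + \<i> * of_real (t * r)))"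
    using c by (auto simp: fun_eq_iff std_normal_density_def scaleR_conv_of_real exp_add[symmetric] power_mult_distrib exp_of_real[symmetric])
  also have "\<bar>c\<bar> *\<^sub>R (LINT r|lborel. of_real (1 / sqrt (2 * pi)) * exp (of_real (- (A * r\<^sup>2)) + \<i> * of_real (t * r)))
    = of_real (c / sqrt (2 * pi)) * (LINT r|lborel. exp (of_real (- (A * r\<^sup>2)) + \<i> * of_real (t * r)))"
    using c by (simp add: scaleR_conv_of_real)
  finally have eq: "complex_of_real (exp (- ((t/c)\<^sup>2) / 2)) = of_real (c / sqrt (2 * pi)) * (LINT r|lborel. exp (of_real (- (A * r\<^sup>2)) + \<i> * of_real (t * r)))" .
  define I where "I = (LINT r|lborel. exp (of_real (- (A * r\<^sup>2)) + \<i> * of_real (t * r)))"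
  have 1: "sqrt (pi / A) = sqrt (2 * pi) / c" using A by (simp add: c_def real_sqrt_divide real_sqrt_mult)
  have 2: "- t\<^sup>2 / (4 * A) = - ((t/c)\<^sup>2) / 2" using c by (simp add: power_divide)
  have "I = of_real (sqrt (2 * pi) / c) * (of_real (c / sqrt (2 * pi)) * I)" using c by simp
  also have "of_real (c / sqrt (2 * pi)) * I = of_real (exp (- ((t/c)\<^sup>2) / 2))" using eq unfolding I_def by (rule sym)
  finally show ?thesis unfolding 1 2 I_def by simp
qed

lemma integrable_gaussian:
  fixes w :: complex
  assumes A: "A > 0"
  shows "integrable lborel (\<lambda>r::real. exp (of_real (- (A * r\<^sup>2)) + w * of_real r))"
proof -
  have "integrable lborel (\<lambda>r::real. exp (Re w ^ 2 / (2 * A)) * exp (- (A/2 * r\<^sup>2)))"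
    using A by (intro integrable_mult_right integrable_exp_neg_square) auto
  thus ?thesis
  proof (rule Bochner_Integration.integrable_bound)
    show "AE r in lborel. norm (exp (of_real (- (A * r\<^sup>2)) + w * of_real r)) \<le> norm (exp (Re w ^ 2 / (2 * A)) * exp (- (A/2 * r\<^sup>2)))"
    proof (rule AE_I2)
      fix r :: real
      have "0 \<le> (A * r - Re w)\<^sup>2 / (2 * A)" using A by simp
      also have "\<dots> = A/2 * r\<^sup>2 - Re w * r + Re w ^ 2 / (2 * A)" using A by (simp add: power2_eq_square field_simps)
      finally have "- (A * r\<^sup>2) + Re w * r \<le> Re w ^ 2 / (2 * A) + - (A/2 * r\<^sup>2)" by simp
      thus "norm (exp (of_real (- (A * r\<^sup>2)) + w * of_real r)) \<le> norm (exp (Re w ^ 2 / (2 * A)) * exp (- (A/2 * r\<^sup>2)))"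
        unfolding exp_add[symmetric] norm_exp_eq_Re by simp
    qed
  qed simp
qed

text \<open>Only a real translation, by \<open>Re w / (2 * A)\<close>, is made: it absorbs
  \<open>Re w\<close>, and \<open>Im w\<close> is left to the Fourier transform, so that no contour
  is moved.\<close>

lemma gaussian_integral:
  fixes w :: complex
  assumes A: "A > 0"
  shows "(LINT r|lborel. exp (of_real (- (A * r\<^sup>2)) + w * of_real r)) = of_real (sqrt (pi / A)) * exp (w\<^sup>2 / of_real (4 * A))"
proof -
  define p q where "p = Re w" and "q = Im w"
  have w: "w = of_real p + \<i> * of_real q" by (simp add: p_def q_def complex_eq)
  have "(LINT r|lborel. exp (of_real (- (A * r\<^sup>2)) + w * of_real r))
     = \<bar>1\<bar> *\<^sub>R (LINT r|lborel. exp (of_real (- (A * (p / (2 * A) + 1 * r)\<^sup>2)) + w * of_real (p / (2 * A) + 1 * r)))"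
    by (rule lborel_integral_real_affine) auto
  also have "(\<lambda>r. exp (of_real (- (A * (p / (2 * A) + 1 * r)\<^sup>2)) + w * of_real (p / (2 * A) + 1 * r)))
     = (\<lambda>r. exp (of_real (p\<^sup>2 / (4 * A)) + \<i> * of_real (p * q / (2 * A))) * exp (of_real (- (A * r\<^sup>2)) + \<i> * of_real (q * r)))"
    unfolding exp_add[symmetric] w
  proof (intro ext arg_cong[where f = exp])
    fix r :: real
    have [simp]: "complex_of_real A \<noteq> 0" using A by simp
    show "of_real (- (A * (p / (2 * A) + 1 * r)\<^sup>2)) + (of_real p + \<i> * of_real q) * of_real (p / (2 * A) + 1 * r)
       = complex_of_real (p\<^sup>2 / (4 * A)) + \<i> * of_real (p * q / (2 * A)) + (of_real (- (A * r\<^sup>2)) + \<i> * of_real (q * r))"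
      using A by (simp add: power2_eq_square field_simps)
  qed
  also have "\<bar>1\<bar> *\<^sub>R (LINT r|lborel. \<dots> r) = exp (of_real (p\<^sup>2 / (4 * A)) + \<i> * of_real (p * q / (2 * A))) *
       of_real (sqrt (pi / A) * exp (- q\<^sup>2 / (4 * A)))"
    by (simp only: integral_mult_right_zero gaussian_fourier_real[OF A] abs_one scaleR_one)
  also have "\<dots> = of_real (sqrt (pi / A)) * exp (of_real (p\<^sup>2 / (4 * A)) + \<i> * of_real (p * q / (2 * A)) + of_real (- q\<^sup>2 / (4 * A)))"
    by (simp only: exp_add exp_of_real of_real_mult mult_ac)
  also have "of_real (p\<^sup>2 / (4 * A)) + \<i> * of_real (p * q / (2 * A)) + of_real (- q\<^sup>2 / (4 * A)) = w\<^sup>2 / of_real (4 * A)"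
    using A unfolding w by (simp add: power2_eq_square field_simps)
  finally show ?thesis .
qed

section \<open>The theta function and the evenness of Phi\<close>

text \<open>By its symmetry, \<open>h\<close> is a continuous function of \<open>cos (2 * pi * a)\<close>, hence a uniform limit of cosine polynomials.\<close>

lemma cosine_coefficients_determine:
  fixes h :: "real \<Rightarrow> real"
  assumes cont: "continuous_on {0..1} h" and sym: "\<And>a. a \<in> {0..1} \<Longrightarrow> h (1 - a) = h a"
    and coeff: "\<And>k::nat. integral {0..1} (\<lambda>a. h a * cos (2 * pi * real k * a)) = 0"
    and a: "a \<in> {0..1}"
  shows "h a = 0"
proof -
  let ?c = "\<lambda>a. cos (2 * pi * a)"
  have int: "(\<lambda>a. h a * f a) integrable_on {0..1}" if "continuous_on {0..1} f" for f :: "real \<Rightarrow> real"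
    by (intro integrable_continuous_real continuous_intros cont that)
  \<comment> \<open>The product formula trades one power of \<open>?c\<close> for the frequencies
    \<open>k + 1\<close> and \<open>k - 1\<close>, hence the induction over all \<open>k\<close> at
    once. The case \<open>k = 0\<close> just raises the frequency to 1.\<close>
  have pow: "integral {0..1} (\<lambda>a. h a * (?c a ^ j * cos (2 * pi * real k * a))) = 0" for j k :: nat
  proof (induction j arbitrary: k)
    case (Suc j)
    show ?case
    proof (cases k)
      case 0
      thus ?thesis using Suc[of 1] by (simp add: mult_ac)
    next
      case (Suc k')
      have "cos (2 * pi * a) * cos (2 * pi * real k * a) = cos (2 * pi * real (Suc k) * a) / 2 + cos (2 * pi * real k' * a) / 2" for a
      proof -
        have "cos (2 * pi * real (Suc k) * a) = cos (2 * pi * real k * a + 2 * pi * a)" by (simp add: algebra_simps)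
        moreover have "cos (2 * pi * real k' * a) = cos (2 * pi * real k * a - 2 * pi * a)" using Suc by (simp add: algebra_simps)
        ultimately show ?thesis unfolding cos_add cos_diff by (simp add: field_simps)
      qed
      note eq = this
      have "h a * (?c a ^ Suc j * cos (2 * pi * real k * a)) = h a * ?c a ^ j * (?c a * cos (2 * pi * real k * a))" for a
        by (simp add: mult_ac)
      hence "h a * (?c a ^ Suc j * cos (2 * pi * real k * a)) =
          (h a * (?c a ^ j * cos (2 * pi * real (Suc k) * a))) / 2 + (h a * (?c a ^ j * cos (2 * pi * real k' * a))) / 2" for a
        unfolding eq by (simp add: distrib_left mult.assoc)
      hence "integral {0..1} (\<lambda>a. h a * (?c a ^ Suc j * cos (2 * pi * real k * a))) =
          integral {0..1} (\<lambda>a. (h a * (?c a ^ j * cos (2 * pi * real (Suc k) * a))) / 2 + (h a * (?c a ^ j * cos (2 * pi * real k' * a))) / 2)"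
        by simp
      also have "\<dots> = 0"
        by (subst integral_add) (auto intro!: integrable_continuous_real continuous_intros cont simp: Suc.IH simp del: of_nat_Suc)
      finally show ?thesis .
    qed
  qed (use coeff in simp)
  have poly: "integral {0..1} (\<lambda>a. h a * p (?c a)) = 0" if rp: "real_polynomial_function p" for p :: "real \<Rightarrow> real"
  proof -
    obtain b n where p: "p = (\<lambda>x. \<Sum>i\<le>n. b i * x ^ i)"
      using iffD1[OF real_polynomial_function_iff_sum rp] by auto
    have "integral {0..1} (\<lambda>a. h a * p (?c a)) = integral {0..1} (\<lambda>a. \<Sum>i\<le>n. b i * (h a * (?c a ^ i * cos (2 * pi * real 0 * a))))"
      unfolding p by (simp add: sum_distrib_left mult_ac)
    also have "\<dots> = (\<Sum>i\<le>n. integral {0..1} (\<lambda>a. b i * (h a * (?c a ^ i * cos (2 * pi * real 0 * a)))))"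
      by (intro integral_sum) (auto intro!: integrable_continuous_real continuous_intros cont)
    also have "\<dots> = 0" using pow[of _ 0] by simp
    finally show ?thesis .
  qed
  define H where "H c = h (arccos c / (2 * pi))" for c
  have Hc: "H (?c a) = h a" if "a \<in> {0..1}" for a
  proof (cases "a \<le> 1/2")
    case True
    thus ?thesis using that unfolding H_def by (subst arccos_cos) auto
  next
    case False
    have "cos (2 * pi * a) = cos (2 * pi * (1 - a))"
      by (simp add: right_diff_distrib cos_diff)
    moreover have "arccos (cos (2 * pi * (1 - a))) = 2 * pi * (1 - a)"
      using False that by (intro arccos_cos) auto
    ultimately show ?thesis using sym[OF that] unfolding H_def by simp
  qed
  have contH: "continuous_on {-1..1} H"
  proof -
    have "(\<lambda>c. arccos c / (2 * pi)) ` {-1..1} \<subseteq> {0..1}"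
      using arccos_lbound arccos_ubound by (force simp: field_simps)
    thus ?thesis unfolding H_def
      by (intro continuous_on_compose2[OF cont]) (auto intro!: continuous_intros)
  qed
  define B where "B = integral {0..1} (\<lambda>a. \<bar>h a\<bar>)"
  have "integral {0..1} (\<lambda>a. (h a)\<^sup>2) \<le> e * B" if e: "e > 0" for e
  proof -
    obtain p where p: "real_polynomial_function p" "\<And>x. x \<in> {-1..1} \<Longrightarrow> \<bar>H x - p x\<bar> < e"
      using Stone_Weierstrass_real_polynomial_function[OF _ contH e] by auto
    have contp: "continuous_on {0..1} (\<lambda>a. p (?c a))"
      by (intro continuous_on_compose2[OF continuous_on_polymonial_function[of p UNIV]] continuous_intros)
         (use p in \<open>auto simp: real_polynomial_function_eq\<close>)
    \<comment> \<open>\<open>h\<close> is orthogonal to every polynomial in \<open>?c\<close>, so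
      one factor \<open>h\<close> may be replaced by the approximation error, which is below
      \<open>e\<close>.\<close>
    have "integral {0..1} (\<lambda>a. (h a)\<^sup>2) = integral {0..1} (\<lambda>a. h a * (h a - p (?c a)))"
      unfolding right_diff_distrib using poly[OF p(1)]
      by (subst integral_diff) (auto intro!: int cont contp simp: power2_eq_square)
    also have "\<dots> \<le> integral {0..1} (\<lambda>a. e * \<bar>h a\<bar>)"
    proof (rule integral_le)
      fix a :: real assume a: "a \<in> {0..1}"
      have "\<bar>h a - p (?c a)\<bar> \<le> e" using p(2)[of "?c a"] Hc[OF a] by simp
      hence "\<bar>h a\<bar> * \<bar>h a - p (?c a)\<bar> \<le> \<bar>h a\<bar> * e" by (intro mult_left_mono) auto
      thus "h a * (h a - p (?c a)) \<le> e * \<bar>h a\<bar>"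
        using abs_ge_self[of "h a * (h a - p (?c a))"] unfolding abs_mult by (simp add: mult.commute)
    qed (auto intro!: integrable_continuous_real continuous_intros cont contp)
    also have "\<dots> = e * B" by (simp add: B_def)
    finally show ?thesis .
  qed
  hence "((\<lambda>e. e * B) \<longlongrightarrow> 0 * B) (at_right 0) \<Longrightarrow> integral {0..1} (\<lambda>a. (h a)\<^sup>2) \<le> 0 * B"
    by (intro tendsto_lowerbound[where F = "at_right 0"]) (auto simp: eventually_at_filter)
  moreover have "((\<lambda>e. e * B) \<longlongrightarrow> 0 * B) (at_right 0)" by (intro tendsto_intros)
  moreover have "integral {0..1} (\<lambda>a. (h a)\<^sup>2) \<ge> 0"
    by (intro integral_nonneg integrable_continuous_real continuous_intros cont) auto
  ultimately have "integral {0..1} (\<lambda>a. (h a)\<^sup>2) = 0" by simp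
  hence "\<forall>a\<in>{0..1}. (h a)\<^sup>2 = 0"
    by (subst (asm) integral_eq_0_iff) (auto intro!: continuous_intros cont)
  thus ?thesis using a by simp
qed

text \<open>By evenness the summand pairs the translates by \<open>n\<close> and
  \<open>- n - 1\<close>. This runs through all integers with a natural index, keeps the partial
  sums symmetric under \<open>a \<mapsto> 1 - a\<close>, and the translated unit intervals tile the
  symmetric interval.\<close>

lemma integral_periodization_partial:
  fixes F :: "real \<Rightarrow> real"
  assumes cont: "continuous_on UNIV F" and even: "\<And>y. F (- y) = F y"
  shows "integral {0..1} (\<lambda>a. \<Sum>n<N. F (real n + a) + F (real n + 1 - a)) = integral {- real N..real N} F"
proof (induction N)
  case (Suc N)
  have io: "F integrable_on {a..b}" for a b
    by (intro integrable_continuous_real continuous_on_subset[OF cont]) auto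
  have c1: "continuous_on {0..1} (\<lambda>a. F (real n + a))" "continuous_on {0..1} (\<lambda>a. F (real n + 1 - a))" for n
    by (rule continuous_on_compose2[OF cont]; (intro continuous_intros | simp))+
  have "integral {0..1} (\<lambda>a. F (real N + a)) = integral {real N..real (Suc N)} F"
    using integral_shift_real_ivl[of "real N" "real N" "real (Suc N)" F] by (simp add: add_ac)
  moreover have "integral {0..1} (\<lambda>a. F (real N + 1 - a)) = integral {- real (Suc N)..- real N} F"
  proof -
    have "F (real N + 1 - a) = F (a + - real (Suc N))" for a using even[of "a + - real (Suc N)"] by (simp add: algebra_simps)
    thus ?thesis using integral_shift_real_ivl[of "- real (Suc N)" "- real (Suc N)" "- real N" F] by simp
  qed
  moreover have "integral {- real (Suc N)..real (Suc N)} F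
     = integral {- real (Suc N)..- real N} F + integral {- real N..real N} F + integral {real N..real (Suc N)} F"
    by (simp add: Henstock_Kurzweil_Integration.integral_combine io)
  ultimately show ?case using Suc
    by (simp add: integral_add integrable_continuous_real c1 continuous_intros)
qed simp

lemma tendsto_integral_symmetric_interval:
  fixes f :: "real \<Rightarrow> real"
  assumes f: "integrable lborel f"
  shows "(\<lambda>N. integral {- real N..real N} f) \<longlonglongrightarrow> (LINT y|lborel. f y)"
proof -
  have "(\<lambda>N. LINT y|lborel. indicator {- real N..real N} y *\<^sub>R f y) \<longlonglongrightarrow> (LINT y|lborel. f y)"
  proof (rule integral_dominated_convergence[where w = "\<lambda>y. \<bar>f y\<bar>"])
    show "AE y in lborel. (\<lambda>N. indicat_real {- real N..real N} y *\<^sub>R f y) \<longlonglongrightarrow> f y"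
    proof (rule AE_I2, rule tendsto_eventually)
      fix y :: real
      obtain N0 where N0: "\<bar>y\<bar> \<le> real N0" using real_arch_simple by blast
      show "\<forall>\<^sub>F N in sequentially. indicat_real {- real N..real N} y *\<^sub>R f y = f y"
        using eventually_ge_at_top[of N0] by eventually_elim (use N0 in \<open>auto simp: indicator_def\<close>)
    qed
  qed (use f in \<open>auto simp: indicator_def\<close>)
  moreover have "(LINT y|lborel. indicator {- real N..real N} y *\<^sub>R f y) = integral {- real N..real N} f" for N
  proof -
    have "set_integrable lborel {- real N..real N} f"
      unfolding set_integrable_def using f by (intro integrable_mult_indicator) auto
    from set_borel_integral_eq_integral(2)[OF this] show ?thesis unfolding set_lebesgue_integral_def .
  qed
  ultimately show ?thesis by simp
qed

lemma summable_exp_neg_square: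
  assumes x: "x > (0::real)"
  shows "summable (\<lambda>n. exp (- pi * x * (real n)\<^sup>2))"
proof (rule summable_comparison_test')
  have e: "exp (- pi * x) < 1" using x by simp
  show "summable (\<lambda>n. exp (- pi * x) ^ n)" by (rule summable_geometric) (use e in simp)
  fix n :: nat
  have "real n \<le> (real n)\<^sup>2" by (cases n) (auto simp: power2_eq_square)
  hence "exp (- pi * x * (real n)\<^sup>2) \<le> exp (- pi * x * real n)" using x by simp
  thus "norm (exp (- pi * x * (real n)\<^sup>2)) \<le> exp (- pi * x) ^ n"
    by (simp add: exp_of_nat2_mult[symmetric])
qed

lemma integral_cos_2pi:
  "integral {0..1} (\<lambda>a. cos (2 * pi * of_int m * a)) = (if m = 0 then 1 else 0)"
proof (cases "m = 0")
  case False
  let ?c = "2 * pi * of_int m"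
  have "((\<lambda>a. cos (?c * a)) has_integral (sin (?c * 1) / ?c - sin (?c * 0) / ?c)) {0..1}"
    using False by (intro fundamental_theorem_of_calculus)
      (auto intro!: derivative_eq_intros simp: has_real_derivative_iff_has_vector_derivative[symmetric])
  moreover have "sin (?c * 1) = 0" using sin_integer_2pi[of "of_int m"] by (simp add: mult_ac)
  ultimately show ?thesis using False by (simp add: integral_unique)
qed simp

lemma tendsto_integral_uniform_limit:
  fixes f :: "nat \<Rightarrow> real \<Rightarrow> real"
  assumes "uniform_limit {a..b} f g sequentially" "\<And>n. continuous_on {a..b} (f n)"
  shows "(\<lambda>n. integral {a..b} (f n)) \<longlonglongrightarrow> integral {a..b} g"
proof -
  obtain I J where IJ: "\<And>n. (f n has_integral I n) {a..b}" "(g has_integral J) {a..b}" "I \<longlonglongrightarrow> J"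
    using uniform_limit_integral[OF assms] by auto
  have "I = (\<lambda>n. integral {a..b} (f n))" "J = integral {a..b} g"
    using integral_unique[OF IJ(1)] integral_unique[OF IJ(2)] by auto
  thus ?thesis using IJ(3) by simp
qed

text \<open>Poisson summation: the periodized Gaussian \<open>f\<close> and the cosine series
  \<open>g\<close> are continuous, symmetric under \<open>a \<mapsto> 1 - a\<close>, and have the
  same cosine coefficients, because unfolding the periodization turns those of \<open>f\<close> into
  Gaussian Fourier integrals over the line. The claim is \<open>f 0 = g 0\<close>.\<close>

lemma theta_functional_equation:
  assumes x: "x > 0"
  shows "1 + 2 * (\<Sum>n. exp (- pi * x * (real (Suc n))\<^sup>2)) =
    1 / sqrt x * (1 + 2 * (\<Sum>n. exp (- pi * (1/x) * (real (Suc n))\<^sup>2)))"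
proof -
  define F where "F y = exp (- pi * x * y\<^sup>2)" for y :: real
  define q where "q k = exp (- pi * (1/x) * (real k)\<^sup>2)" for k :: nat
  define f where "f a = (\<Sum>n. F (real n + a) + F (real n + 1 - a))" for a
  define g where "g a = 1 / sqrt x * (1 + 2 * (\<Sum>k. q (Suc k) * cos (2 * pi * real (Suc k) * a)))" for a
  have contF: "continuous_on A F" for A unfolding F_def by (intro continuous_intros)
  have Fle: "\<bar>F (real n + a) + F (real n + 1 - a)\<bar> \<le> 2 * F (real n)" if "a \<in> {0..1}" for n a
  proof -
    have "(real n)\<^sup>2 \<le> (real n + a)\<^sup>2" "(real n)\<^sup>2 \<le> (real n + 1 - a)\<^sup>2" using that by (auto intro!: power_mono)
    thus ?thesis using x unfolding F_def by (smt (verit, best) exp_ge_zero exp_le_cancel_iff mult_left_mono_neg mult_nonneg_nonneg pi_ge_zero mult_minus_left)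
  qed
  have sF: "summable (\<lambda>n. 2 * F (real n))" unfolding F_def by (intro summable_mult summable_exp_neg_square x)
  have q: "summable q" unfolding q_def using x by (intro summable_exp_neg_square) auto
  have q1: "summable (\<lambda>k. q (Suc k))" using q by (simp add: summable_Suc_iff)
  have q0: "q k \<ge> 0" for k by (simp add: q_def)
  have ulf: "uniform_limit {0..1} (\<lambda>N a. \<Sum>n<N. F (real n + a) + F (real n + 1 - a)) f sequentially"
    unfolding f_def by (rule Weierstrass_m_test[OF _ sF]) (use Fle in auto)
  have ulg: "uniform_limit {0..1} (\<lambda>N a. \<Sum>k<N. q (Suc k) * cos (2 * pi * real (Suc k) * a)) (\<lambda>a. \<Sum>k. q (Suc k) * cos (2 * pi * real (Suc k) * a)) sequentially"
    by (rule Weierstrass_m_test[OF _ q1]) (auto simp: abs_mult q0 intro!: mult_left_le)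
  have contpf: "continuous_on {0..1} (\<lambda>a. \<Sum>n<N. F (real n + a) + F (real n + 1 - a))" for N
    by (intro continuous_intros continuous_on_compose2[OF contF[of UNIV]]) auto
  have contf: "continuous_on {0..1} f"
    by (rule uniform_limit_theorem[OF _ ulf]) (auto intro!: always_eventually contpf)
  have contgs: "continuous_on {0..1} (\<lambda>a. \<Sum>k. q (Suc k) * cos (2 * pi * real (Suc k) * a))"
    by (rule uniform_limit_theorem[OF _ ulg]) (auto intro!: always_eventually continuous_intros)
  hence contg: "continuous_on {0..1} g" unfolding g_def by (intro continuous_intros)
  have fcoef: "integral {0..1} (\<lambda>a. f a * cos (2 * pi * real k * a)) = 1 / sqrt x * q k" for k
  proof -
    let ?F = "\<lambda>y. F y * cos (2 * pi * real k * y)"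
    have per: "cos (2 * pi * real k * (real n + a)) = cos (2 * pi * real k * a)"
       "cos (2 * pi * real k * (real n + 1 - a)) = cos (2 * pi * real k * a)" for n a
    proof -
      have s: "sin (2 * pi * real k * real m) = 0" "cos (2 * pi * real k * real m) = 1" for m
        using sin_integer_2pi[of "real (k * m)"] cos_integer_2pi[of "real (k * m)"] by (simp_all add: mult_ac)
      show "cos (2 * pi * real k * (real n + a)) = cos (2 * pi * real k * a)"
        unfolding distrib_left cos_add s by simp
      show "cos (2 * pi * real k * (real n + 1 - a)) = cos (2 * pi * real k * a)"
        using s[of "Suc n"] unfolding right_diff_distrib cos_diff by (simp add: add_ac)
    qed
    have ul: "uniform_limit {0..1} (\<lambda>N a. (\<Sum>n<N. F (real n + a) + F (real n + 1 - a)) * cos (2 * pi * real k * a)) (\<lambda>a. f a * cos (2 * pi * real k * a)) sequentially"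
      by (intro uniform_lim_mult ulf uniform_limit_const compact_imp_bounded compact_continuous_image contf continuous_intros) auto
    have "(\<lambda>N. integral {0..1} (\<lambda>a. (\<Sum>n<N. F (real n + a) + F (real n + 1 - a)) * cos (2 * pi * real k * a))) \<longlonglongrightarrow> integral {0..1} (\<lambda>a. f a * cos (2 * pi * real k * a))"
      by (rule tendsto_integral_uniform_limit[OF ul]) (auto intro!: continuous_intros contpf)
    moreover have "integral {0..1} (\<lambda>a. (\<Sum>n<N. F (real n + a) + F (real n + 1 - a)) * cos (2 * pi * real k * a))
       = integral {- real N..real N} ?F" for N
      using integral_periodization_partial[of ?F N]
      by (simp add: per sum_distrib_right distrib_right F_def continuous_intros)
    moreover have "integrable lborel (\<lambda>y. Re (exp (of_real (- (pi * x * y\<^sup>2)) + \<i> * of_real (2 * pi * real k) * of_real y)))"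
      using x by (intro integrable_Re integrable_gaussian) auto
    moreover have Fre: "(\<lambda>y. Re (exp (of_real (- (pi * x * y\<^sup>2)) + \<i> * of_real (2 * pi * real k) * of_real y))) = ?F"
      by (auto simp: fun_eq_iff F_def Re_exp)
    ultimately have "integral {0..1} (\<lambda>a. f a * cos (2 * pi * real k * a)) = (LINT y|lborel. ?F y)"
      using LIMSEQ_unique tendsto_integral_symmetric_interval[of ?F] by simp
    also have "\<dots> = Re (LINT y|lborel. exp (of_real (- (pi * x * y\<^sup>2)) + \<i> * of_real (2 * pi * real k) * of_real y))"
      unfolding Fre[symmetric] using x by (intro integral_Re integrable_gaussian) auto
    also have "\<dots> = 1 / sqrt x * q k"
      using x by (subst gaussian_integral) (auto simp: q_def real_sqrt_divide Re_exp power_mult_distrib power2_eq_square field_simps)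
    finally show ?thesis .
  qed
  have gcoef: "integral {0..1} (\<lambda>a. g a * cos (2 * pi * real k * a)) = 1 / sqrt x * q k" for k
  proof -
    let ?C = "\<lambda>a. cos (2 * pi * real k * a)"
    have prod: "cos (2 * pi * real j * a) * ?C a = (cos (2 * pi * of_int (int j + int k) * a) + cos (2 * pi * of_int (int j - int k) * a)) / 2" for j a
      by (simp add: cos_times_cos algebra_simps)
    have orth: "integral {0..1} (\<lambda>a. cos (2 * pi * real j * a) * ?C a) = (if j = k then if k = 0 then 1 else 1/2 else 0)" for j
    proof -
      have "integral {0..1} (\<lambda>a. cos (2 * pi * real j * a) * ?C a) =
        (integral {0..1} (\<lambda>a. cos (2 * pi * of_int (int j + int k) * a)) + integral {0..1} (\<lambda>a. cos (2 * pi * of_int (int j - int k) * a))) / 2"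
        unfolding prod by (subst integral_add[symmetric]) (auto intro!: integrable_continuous_real continuous_intros)
      also have "\<dots> = (if j = k then if k = 0 then 1 else 1/2 else 0)"
        unfolding integral_cos_2pi by auto
      finally show ?thesis .
    qed
    have ul: "uniform_limit {0..1} (\<lambda>N a. (\<Sum>j<N. q (Suc j) * cos (2 * pi * real (Suc j) * a)) * ?C a) (\<lambda>a. (\<Sum>j. q (Suc j) * cos (2 * pi * real (Suc j) * a)) * ?C a) sequentially"
      by (intro uniform_lim_mult ulg uniform_limit_const compact_imp_bounded compact_continuous_image contgs continuous_intros) auto
    have "(\<lambda>N. integral {0..1} (\<lambda>a. (\<Sum>j<N. q (Suc j) * cos (2 * pi * real (Suc j) * a)) * ?C a)) \<longlonglongrightarrow> integral {0..1} (\<lambda>a. (\<Sum>j. q (Suc j) * cos (2 * pi * real (Suc j) * a)) * ?C a)"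
      by (rule tendsto_integral_uniform_limit[OF ul]) (auto intro!: continuous_intros)
    moreover have "integral {0..1} (\<lambda>a. (\<Sum>j<N. q (Suc j) * cos (2 * pi * real (Suc j) * a)) * ?C a)
       = (\<Sum>j<N. q (Suc j) * (if Suc j = k then 1/2 else 0))" for N
    proof -
      have "integral {0..1} (\<lambda>a. (\<Sum>j<N. q (Suc j) * cos (2 * pi * real (Suc j) * a)) * ?C a)
         = (\<Sum>j<N. integral {0..1} (\<lambda>a. q (Suc j) * (cos (2 * pi * real (Suc j) * a) * ?C a)))"
        unfolding sum_distrib_right mult.assoc
        by (intro integral_sum) (auto intro!: integrable_continuous_real continuous_intros)
      also have "\<dots> = (\<Sum>j<N. q (Suc j) * (if Suc j = k then 1/2 else 0))"
        unfolding integral_mult_right orth by (intro sum.cong) auto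
      finally show ?thesis .
    qed
    ultimately have lim: "(\<lambda>N. \<Sum>j<N. q (Suc j) * (if Suc j = k then 1/2 else 0)) \<longlonglongrightarrow> integral {0..1} (\<lambda>a. (\<Sum>j. q (Suc j) * cos (2 * pi * real (Suc j) * a)) * ?C a)"
      by simp
    have "(\<Sum>j<N. q (Suc j) * (if Suc j = k then 1/2 else 0)) = (if k = 0 then 0 else q k / 2)" if "N \<ge> k" for N
    proof (cases k)
      case (Suc k')
      have "(\<Sum>j<N. q (Suc j) * (if Suc j = k then 1/2 else 0)) = (\<Sum>j<N. if j = k' then q (Suc j) / 2 else 0)"
        using Suc by (intro sum.cong) auto
      thus ?thesis using Suc that by simp
    qed simp
    hence "(\<lambda>N. \<Sum>j<N. q (Suc j) * (if Suc j = k then 1/2 else 0)) \<longlonglongrightarrow> (if k = 0 then 0 else q k / 2)"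
      by (intro tendsto_eventually eventually_sequentiallyI[of k]) auto
    with lim have int_s: "integral {0..1} (\<lambda>a. (\<Sum>j. q (Suc j) * cos (2 * pi * real (Suc j) * a)) * ?C a) = (if k = 0 then 0 else q k / 2)"
      using LIMSEQ_unique by blast
    have "integral {0..1} (\<lambda>a. g a * ?C a) = integral {0..1} (\<lambda>a. 1 / sqrt x * (cos (2 * pi * real 0 * a) * ?C a) + 2 / sqrt x * ((\<Sum>j. q (Suc j) * cos (2 * pi * real (Suc j) * a)) * ?C a))"
      by (intro arg_cong[where f = "integral {0..1}"] ext) (simp add: g_def algebra_simps)
    also have "\<dots> = 1 / sqrt x * integral {0..1} (\<lambda>a. cos (2 * pi * real 0 * a) * ?C a) + 2 / sqrt x * integral {0..1} (\<lambda>a. (\<Sum>j. q (Suc j) * cos (2 * pi * real (Suc j) * a)) * ?C a)"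
      using contgs by (subst integral_add) (intro integrable_continuous_real continuous_intros | simp)+
    also have "\<dots> = 1 / sqrt x * q k"
      unfolding orth int_s by (auto simp: q_def)
    finally show ?thesis .
  qed
  have "f 0 - g 0 = 0"
  proof (rule cosine_coefficients_determine[where h = "\<lambda>a. f a - g a"])
    show "continuous_on {0..1} (\<lambda>a. f a - g a)" by (intro continuous_intros contf contg)
    show "f (1 - a) - g (1 - a) = f a - g a" if "a \<in> {0..1}" for a
    proof -
      have "cos (2 * pi * real m * (1 - a)) = cos (2 * pi * real m * a)" for m
        using sin_integer_2pi[of "real m"] cos_integer_2pi[of "real m"] unfolding right_diff_distrib cos_diff by simp
      thus ?thesis by (simp add: f_def g_def algebra_simps del: of_nat_Suc)
    qed
    show "integral {0..1} (\<lambda>a. (f a - g a) * cos (2 * pi * real k * a)) = 0" for k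
      unfolding left_diff_distrib
      by (subst integral_diff) (auto intro!: integrable_continuous_real continuous_intros contf contg simp: fcoef gcoef)
  qed auto
  moreover have "f 0 = 1 + 2 * (\<Sum>n. exp (- pi * x * (real (Suc n))\<^sup>2))"
  proof -
    have s0: "summable (\<lambda>n. F (real n))" unfolding F_def by (intro summable_exp_neg_square x)
    have s1: "summable (\<lambda>n. F (real (Suc n)))" using s0 by (subst summable_Suc_iff)
    have "f 0 = (\<Sum>n. F (real n) + F (real (Suc n)))" by (simp add: f_def add_ac)
    also have "\<dots> = (\<Sum>n. F (real n)) + (\<Sum>n. F (real (Suc n)))" by (rule suminf_add[OF s0 s1, symmetric])
    also have "(\<Sum>n. F (real n)) = F 0 + (\<Sum>n. F (real (Suc n)))" using suminf_split_head[OF s0] by simp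
    finally show ?thesis by (simp add: F_def)
  qed
  moreover have "g 0 = 1 / sqrt x * (1 + 2 * (\<Sum>n. exp (- pi * (1/x) * (real (Suc n))\<^sup>2)))"
    by (simp add: g_def q_def)
  ultimately show ?thesis by simp
qed

section \<open>Moments of the theta series and the symmetry of \<open>Phi\<close>\<close>

lemma summable_power_exp_neg_square:
  assumes c: "c > (0::real)"
  shows "summable (\<lambda>n. real n ^ m * exp (- c * (real n)\<^sup>2))"
proof (rule summable_comparison_test_bigo)
  show "summable (\<lambda>n. norm (1 / (real n ^ 2)))" 
    using inverse_power_summable[of 2, where 'a = real] by (simp add: inverse_eq_divide)
  have "((\<lambda>n::nat. real n powr real m * exp (- c * (real n)\<^sup>2)) \<in> O(\<lambda>n. 1 / (real n ^ 2)))"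
    using c by real_asymp
  also have "?this \<longleftrightarrow> (\<lambda>n::nat. real n ^ m * exp (- c * (real n)\<^sup>2)) \<in> O(\<lambda>n. 1 / (real n ^ 2))"
    by (intro landau_o.big.in_cong) (use eventually_gt_at_top[of 0] in eventually_elim, simp add: powr_realpow)
  finally show "(\<lambda>n::nat. real n ^ m * exp (- c * (real n)\<^sup>2)) \<in> O(\<lambda>n. 1 / (real n ^ 2))" .
qed

text \<open>Differentiation in \<open>u\<close> raises \<open>j\<close> by one, up to the factor
  \<open>- 4 * pi * exp (4 * u)\<close>; so the derivatives of theta, and \<open>Phi\<close> itself,
  are combinations of finitely many moments.\<close>

definition theta_moment :: "nat \<Rightarrow> real \<Rightarrow> real" where
  "theta_moment j u = (\<Sum>k. real (Suc k) ^ (2 * j) * exp (- pi * (real (Suc k))\<^sup>2 * exp (4 * u)))"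

lemma summable_theta_moment: "summable (\<lambda>k. real (Suc k) ^ m * exp (- pi * (real (Suc k))\<^sup>2 * exp (4 * u)))"
proof -
  have "summable (\<lambda>k. real k ^ m * exp (- (pi * exp (4 * u)) * (real k)\<^sup>2))"
    by (intro summable_power_exp_neg_square) auto
  hence "summable (\<lambda>k. real (Suc k) ^ m * exp (- (pi * exp (4 * u)) * (real (Suc k))\<^sup>2))"
    by (subst summable_Suc_iff)
  thus ?thesis by (simp add: mult_ac)
qed

lemma has_real_derivative_theta_moment:
  "(theta_moment j has_real_derivative - 4 * pi * exp (4 * u) * theta_moment (Suc j) u) (at u)"
proof -
  define R where "R = \<bar>u\<bar> + 1"
  let ?f = "\<lambda>k u. real (Suc k) ^ (2 * j) * exp (- pi * (real (Suc k))\<^sup>2 * exp (4 * u))"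
  let ?f' = "\<lambda>k u. - 4 * pi * exp (4 * u) * (real (Suc k) ^ (2 * Suc j) * exp (- pi * (real (Suc k))\<^sup>2 * exp (4 * u)))"
  have "((\<lambda>u. \<Sum>k. ?f k u) has_field_derivative (\<Sum>k. ?f' k u)) (at u)"
  proof (rule has_field_derivative_series')
    show "convex {-R..R}" by simp
    show "(?f n has_field_derivative ?f' n x) (at x within {-R..R})" for n x
      by (auto intro!: derivative_eq_intros simp: power2_eq_square)
    show "uniformly_convergent_on {-R..R} (\<lambda>n x. \<Sum>i<n. ?f' i x)"
    proof (rule Weierstrass_m_test')
      show "summable (\<lambda>k. 4 * pi * exp (4 * R) * (real (Suc k) ^ (2 * Suc j) * exp (- pi * (real (Suc k))\<^sup>2 * exp (4 * (- R)))))"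
        by (intro summable_mult summable_theta_moment)
      fix k x assume x: "x \<in> {-R..R}"
      have "exp (- pi * (real (Suc k))\<^sup>2 * exp (4 * x)) \<le> exp (- pi * (real (Suc k))\<^sup>2 * exp (4 * (- R)))"
        using x by (simp add: mult_left_mono)
      thus "norm (?f' k x) \<le> 4 * pi * exp (4 * R) * (real (Suc k) ^ (2 * Suc j) * exp (- pi * (real (Suc k))\<^sup>2 * exp (4 * (- R))))"
        using x unfolding norm_mult by (intro mult_mono) auto
    qed
    show "summable (\<lambda>n. ?f n u)" by (rule summable_theta_moment)
  qed (auto simp: R_def abs_if)
  also have "(\<Sum>k. ?f' k u) = - 4 * pi * exp (4 * u) * theta_moment (Suc j) u"
    unfolding theta_moment_def by (rule suminf_mult[OF summable_theta_moment])
  finally show ?thesis unfolding theta_moment_def[abs_def] .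
qed

lemma Phi_eq_theta_moments:
  "Phi u = 2 * pi\<^sup>2 * exp (9 * u) * theta_moment 2 u - 3 * pi * exp (5 * u) * theta_moment 1 u"
proof -
  have "2 * pi\<^sup>2 * exp (9 * u) * theta_moment 2 u - 3 * pi * exp (5 * u) * theta_moment 1 u
    = (\<Sum>k. 2 * pi\<^sup>2 * exp (9 * u) * (real (Suc k) ^ (2 * 2) * exp (- pi * (real (Suc k))\<^sup>2 * exp (4 * u)))
       - 3 * pi * exp (5 * u) * (real (Suc k) ^ (2 * 1) * exp (- pi * (real (Suc k))\<^sup>2 * exp (4 * u))))"
    unfolding theta_moment_def
    by (subst suminf_diff[symmetric], intro summable_mult summable_theta_moment, intro summable_mult summable_theta_moment,
        subst (1 2) suminf_mult[OF summable_theta_moment]) (rule refl)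
  also have "\<dots> = Phi u" unfolding Phi_def Let_def by (intro suminf_cong) (simp add: algebra_simps power2_eq_square del: of_nat_Suc)
  finally show ?thesis by simp
qed

text \<open>With \<open>\<Theta> u = exp u * theta (exp (4 * u))\<close>, which is even by the functional equation, \<open>16 * Phi = \<Theta>'' - \<Theta>\<close>.\<close>

lemma Phi_even: "Phi (- u) = Phi u"
proof -
  define \<Theta> where "\<Theta> u = exp u * (1 + 2 * theta_moment 0 u)" for u
  \<comment> \<open>\<open>D\<close> and \<open>D2\<close> are the first two derivatives of
    \<open>\<Theta>\<close> in closed form. Since differentiation exchanges even and odd functions,
    \<open>D2\<close> inherits evenness from \<open>\<Theta>\<close>.\<close>
  define D where "D u = exp u * (1 + 2 * theta_moment 0 u) - 8 * pi * exp (5 * u) * theta_moment 1 u" for u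
  define D2 where "D2 u = exp u * (1 + 2 * theta_moment 0 u) - 48 * pi * exp (5 * u) * theta_moment 1 u
     + 32 * pi\<^sup>2 * exp (9 * u) * theta_moment 2 u" for u
  have e: "exp (u * 9) = exp u * (exp (u * 4) * exp (u * 4))" "exp (u * 5) = exp u * exp (u * 4)" for u :: real
    by (simp_all add: exp_add[symmetric])
  have D: "(\<Theta> has_real_derivative D u) (at u)" for u
    unfolding \<Theta>_def D_def
    by (rule derivative_eq_intros has_real_derivative_theta_moment refl)+ (simp add: e algebra_simps)
  have D2: "(D has_real_derivative D2 u) (at u)" for u
    unfolding D_def D2_def
    by (rule derivative_eq_intros has_real_derivative_theta_moment refl)+ 
       (simp add: e algebra_simps power2_eq_square numeral_2_eq_2)
  have even: "\<Theta> (- u) = \<Theta> u" for u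
  proof -
    have "sqrt (exp (4 * u)) = exp (2 * u)"
      by (rule real_sqrt_unique) (auto simp: power2_eq_square exp_add[symmetric])
    hence "1 + 2 * theta_moment 0 u = 1 / exp (2 * u) * (1 + 2 * theta_moment 0 (- u))"
      using theta_functional_equation[of "exp (4 * u)"] unfolding theta_moment_def
      by (simp add: exp_minus inverse_eq_divide mult_ac)
    hence "\<Theta> u = exp u / exp (2 * u) * (1 + 2 * theta_moment 0 (- u))" by (simp add: \<Theta>_def)
    also have "exp u / exp (2 * u) = exp (- u)" by (simp add: exp_diff[symmetric])
    finally show ?thesis by (simp add: \<Theta>_def)
  qed
  have odd: "D (- u) = - D u" for u
  proof -
    have "((\<lambda>u. \<Theta> (- u)) has_real_derivative (- D (- u))) (at u)"
      using DERIV_chain2[OF D[of "- u"] DERIV_minus[OF DERIV_ident]] by simp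
    thus ?thesis unfolding even using DERIV_unique[OF _ D[of u]] by fastforce
  qed
  have "((\<lambda>u. D (- u)) has_real_derivative (- D2 (- u))) (at u)"
    using DERIV_chain2[OF D2[of "- u"] DERIV_minus[OF DERIV_ident]] by simp
  hence "((\<lambda>u. - D u) has_real_derivative (- D2 (- u))) (at u)" unfolding odd .
  hence "D2 (- u) = D2 u" using DERIV_unique[OF _ DERIV_minus[OF D2[of u]]] by fastforce
  moreover have "16 * Phi u = D2 u - \<Theta> u" for u
    unfolding Phi_eq_theta_moments D2_def \<Theta>_def by (simp add: algebra_simps)
  ultimately have "16 * Phi (- u) = 16 * Phi u" using even[of u] by simp
  thus ?thesis by simp
qed

section \<open>Gaussian transforms of Phi\<close>

text \<open>Euler's integral under \<open>t = pi * exp (4 * v)\<close>: here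
  \<open>exp (p * (ln pi + 4 * v))\<close> is \<open>t powr p\<close> and
  \<open>dt = 4 * t * dv\<close>, whence the division by 4.\<close>

lemma Gamma_integral_exp_substitution:
  fixes p :: complex
  assumes p: "Re p > 0"
  shows "integrable lborel (\<lambda>v. exp (p * of_real (ln pi + 4 * v) - of_real (pi * exp (4 * v))))"
    and "(LINT v|lborel. exp (p * of_real (ln pi + 4 * v) - of_real (pi * exp (4 * v)))) = Gamma p / 4"
proof -
  let ?h = "\<lambda>t. complex_of_real t powr (p - 1) / of_real (exp t)"
  let ?g = "\<lambda>v::real. pi * exp (4 * v)" and ?g' = "\<lambda>v::real. 4 * pi * exp (4 * v)"
  let ?E = "\<lambda>v. exp (p * of_real (ln pi + 4 * v) - of_real (pi * exp (4 * v)))"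
  have img: "?g ` UNIV = {0<..}"
  proof (intro equalityI subsetI)
    fix t :: real assume "t \<in> {0<..}"
    hence "t = ?g (ln (t / pi) / 4)" by simp
    thus "t \<in> ?g ` UNIV" by blast
  qed auto
  have hai: "?h absolutely_integrable_on {0<..}"
    using absolutely_integrable_Gamma_integral[OF p, of 1] by simp
  have hint: "(?h has_integral Gamma p) {0<..}"
    by (rule iffD1[OF has_integral_spike_set_eq[of "{0..}" "{0<..}" ?h] Gamma_integral_complex[OF p]])
       (rule negligible_subset[of "{0}"]; force)+
  have eq: "of_real (?g' v) * ?h (?g v) = 4 * ?E v" for v
  proof -
    have l: "Ln (of_real (pi * exp (4 * v))) = of_real (ln pi + 4 * v)"
      by (subst Ln_of_real) (simp_all add: ln_mult_pos)
    have a: "of_real (?g' v) = 4 * exp (complex_of_real (ln pi + 4 * v))"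
      by (simp add: exp_of_real[symmetric] exp_add exp_of_real del: of_real_add)
    have nz: "complex_of_real (pi * exp (4 * v)) \<noteq> 0" by simp
    have h: "?h (?g v) = exp ((p - 1) * of_real (ln pi + 4 * v)) / exp (of_real (?g v))"
      unfolding powr_def l exp_of_real[symmetric] using nz by (simp only: if_False)
    have "4 * exp L * (exp ((p - 1) * L) / exp Q) = 4 * exp (p * L - Q)" for L Q
      by (simp add: exp_diff[symmetric] exp_add[symmetric] algebra_simps)
    thus ?thesis unfolding a h .
  qed
  have inj: "inj_on ?g UNIV" by (auto simp: inj_on_def)
  have der: "(?g has_field_derivative ?g' x) (at x within UNIV)" for x
    by (auto intro!: derivative_eq_intros)
  have part: "(\<lambda>v. \<bar>?g' v\<bar> * f (?g v)) absolutely_integrable_on UNIV \<and> integral UNIV (\<lambda>v. \<bar>?g' v\<bar> * f (?g v)) = c"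
    if "f absolutely_integrable_on {0<..}" "(f has_integral c) {0<..}" for f c
    using has_absolute_integral_change_of_variables_1'[of UNIV ?g ?g' f c, OF _ der inj] that
    unfolding img by (auto simp: integral_unique)
  have lb: "integrable lborel F \<and> (LINT v|lborel. F v) = c"
    if "F absolutely_integrable_on UNIV \<and> integral UNIV F = c" "F \<in> borel_measurable borel" for F :: "real \<Rightarrow> real" and c
  proof -
    have "integrable lborel F"
      using that integrable_completion[of F lborel] by (simp add: set_integrable_def)
    moreover from integral_lborel[OF this] that have "(LINT v|lborel. F v) = c" by simp
    ultimately show ?thesis by simp
  qed
  have [measurable]: "?E \<in> borel_measurable borel"
    by (intro borel_measurable_continuous_onI continuous_intros)
  have R: "integrable lborel (\<lambda>v. 4 * Re (?E v)) \<and> (LINT v|lborel. 4 * Re (?E v)) = Re (Gamma p)"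
  proof (rule lb)
    have 1: "(\<lambda>v. \<bar>?g' v\<bar> * Re (?h (?g v))) = (\<lambda>v. 4 * Re (?E v))"
    proof
      fix v
      have gen: "\<bar>x\<bar> * Re z = Re (of_real x * z)" if "x \<ge> 0" for x z using that by simp
      have "\<bar>?g' v\<bar> * Re (?h (?g v)) = Re (of_real (?g' v) * ?h (?g v))" by (rule gen) simp
      thus "\<bar>?g' v\<bar> * Re (?h (?g v)) = 4 * Re (?E v)" unfolding eq by simp
    qed
    have 2: "(\<lambda>t. Re (?h t)) absolutely_integrable_on {0<..}"
      using absolutely_integrable_linear[OF hai bounded_linear_Re] by (simp add: o_def)
    have 3: "((\<lambda>t. Re (?h t)) has_integral Re (Gamma p)) {0<..}"
      using has_integral_linear[OF hint bounded_linear_Re] by (simp add: o_def)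
    show "(\<lambda>v. 4 * Re (?E v)) absolutely_integrable_on UNIV \<and> integral UNIV (\<lambda>v. 4 * Re (?E v)) = Re (Gamma p)"
      using part[OF 2 3] unfolding 1 .
  qed measurable
  have I: "integrable lborel (\<lambda>v. 4 * Im (?E v)) \<and> (LINT v|lborel. 4 * Im (?E v)) = Im (Gamma p)"
  proof (rule lb)
    have 1: "(\<lambda>v. \<bar>?g' v\<bar> * Im (?h (?g v))) = (\<lambda>v. 4 * Im (?E v))"
    proof
      fix v
      have gen: "\<bar>x\<bar> * Im z = Im (of_real x * z)" if "x \<ge> 0" for x z using that by simp
      have "\<bar>?g' v\<bar> * Im (?h (?g v)) = Im (of_real (?g' v) * ?h (?g v))" by (rule gen) simp
      thus "\<bar>?g' v\<bar> * Im (?h (?g v)) = 4 * Im (?E v)" unfolding eq by simp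
    qed
    have 2: "(\<lambda>t. Im (?h t)) absolutely_integrable_on {0<..}"
      using absolutely_integrable_linear[OF hai bounded_linear_Im] by (simp add: o_def)
    have 3: "((\<lambda>t. Im (?h t)) has_integral Im (Gamma p)) {0<..}"
      using has_integral_linear[OF hint bounded_linear_Im] by (simp add: o_def)
    show "(\<lambda>v. 4 * Im (?E v)) absolutely_integrable_on UNIV \<and> integral UNIV (\<lambda>v. 4 * Im (?E v)) = Im (Gamma p)"
      using part[OF 2 3] unfolding 1 .
  qed measurable
  have iR: "integrable lborel (\<lambda>v. Re (?E v))" and iI: "integrable lborel (\<lambda>v. Im (?E v))"
    using R I by simp_all
  have "integrable lborel (\<lambda>v. complex_of_real (Re (?E v)) + \<i> * complex_of_real (Im (?E v)))"
    by (intro Bochner_Integration.integrable_add integrable_mult_right integrable_of_real iR iI)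
  thus int: "integrable lborel ?E" by (simp only: complex_eq[symmetric])
  have "(LINT v|lborel. Re (?E v)) = Re (Gamma p) / 4" "(LINT v|lborel. Im (?E v)) = Im (Gamma p) / 4"
    using R I by simp_all
  thus "(LINT v|lborel. ?E v) = Gamma p / 4"
    using integral_Re[OF int] integral_Im[OF int] by (simp add: complex_eq_iff)
qed

section \<open>Single terms of \<open>Phi\<close> and their transforms\<close>

definition Phi_term :: "nat \<Rightarrow> real \<Rightarrow> real" where
  "Phi_term k u = (2 * pi\<^sup>2 * real (Suc k) ^ 4 * exp (9 * u) - 3 * pi * (real (Suc k))\<^sup>2 * exp (5 * u)) *
     exp (- pi * (real (Suc k))\<^sup>2 * exp (4 * u))"

lemma Phi_eq_suminf: "Phi u = (\<Sum>k. Phi_term k u)"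
  by (simp add: Phi_def Phi_term_def Let_def)

text \<open>In this form the index \<open>n = Suc k\<close> occurs only in
  \<open>n\<^sup>2 * exp (4 * u)\<close>, so the translation \<open>u = v - ln n / 2\<close> turns
  every term into the first one, up to the factor \<open>exp (- ln n / 2)\<close>.\<close>

lemma Phi_term_altdef:
  fixes k u defines "q \<equiv> pi * (real (Suc k))\<^sup>2 * exp (4 * u)"
  shows "Phi_term k u = exp u * (2 * q\<^sup>2 - 3 * q) * exp (- q)"
proof -
  have e: "exp (9 * u) = exp u * (exp (4 * u))\<^sup>2" "exp (5 * u) = exp u * exp (4 * u)"
    by (simp_all add: exp_add[symmetric] power2_eq_square)
  show ?thesis unfolding Phi_term_def e q_def by (simp add: algebra_simps power2_eq_square power4_eq_xxxx del: of_nat_Suc)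
qed

text \<open>Single summands of the exponential series give
  \<open>2 * q ^ 3 + 3 * q\<^sup>2 \<le> (12 + 6) * exp q\<close>. The bound grows for negative
  \<open>u\<close>, but it is summable in \<open>k\<close>, and a Gaussian absorbs the
  growth.\<close>

lemma Phi_term_bound: "\<bar>Phi_term k u\<bar> \<le> 18 / pi * exp (- 3 * u) / (real (Suc k))\<^sup>2"
proof -
  define q where "q = pi * (real (Suc k))\<^sup>2 * exp (4 * u)"
  have q: "q > 0" by (simp add: q_def)
  have ex: "q ^ n / fact n \<le> exp q" for n
    using exp_ge_zero sum_le_suminf[OF summable_exp[of q], of "{n}"] q by (auto simp: exp_def field_simps)
  have "\<bar>2 * q\<^sup>2 - 3 * q\<bar> * q \<le> (2 * q\<^sup>2 + 3 * q) * q" using q by (intro mult_right_mono) (auto simp: abs_le_iff)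
  also have "\<dots> = 12 * (q ^ 3 / fact 3) + 6 * (q ^ 2 / fact 2)"
    by (simp add: fact_numeral power2_eq_square power3_eq_cube algebra_simps)
  also have "\<dots> \<le> 18 * exp q" using ex[of 3] ex[of 2] by linarith
  finally have "\<bar>2 * q\<^sup>2 - 3 * q\<bar> * exp (- q) \<le> 18 / q" using q by (simp add: exp_minus field_simps)
  hence "exp u * (\<bar>2 * q\<^sup>2 - 3 * q\<bar> * exp (- q)) \<le> exp u * (18 / q)" by (intro mult_left_mono) auto
  moreover have "\<bar>Phi_term k u\<bar> = exp u * (\<bar>2 * q\<^sup>2 - 3 * q\<bar> * exp (- q))"
    unfolding Phi_term_altdef q_def[symmetric] by (simp add: abs_mult)
  moreover have "exp u * (18 / q) = 18 / pi * exp (- 3 * u) / (real (Suc k))\<^sup>2"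
  proof -
    have "exp (- 3 * u) * exp (4 * u) = exp u" by (simp add: exp_add[symmetric])
    thus ?thesis unfolding q_def by (simp add: field_simps del: of_nat_Suc)
  qed
  ultimately show ?thesis by simp
qed

lemma summable_inverse_square_Suc: "summable (\<lambda>k. c / (real (Suc k))\<^sup>2)"
proof -
  have "summable (\<lambda>k. inverse (real (Suc k) ^ 2))" by (subst summable_Suc_iff) (rule inverse_power_summable, simp)
  from summable_mult[OF this, of c] show ?thesis by (simp add: divide_inverse)
qed

lemma summable_Phi_term: "summable (\<lambda>k. \<bar>Phi_term k u\<bar>)"
  by (rule summable_comparison_test'[OF summable_inverse_square_Suc[of "18 / pi * exp (- 3 * u)"]]) (use Phi_term_bound in simp)

lemma Phi_term_measurable [measurable]: "Phi_term k \<in> borel_measurable borel"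
  unfolding Phi_term_def by measurable

lemma Phi_measurable [measurable]: "Phi \<in> borel_measurable borel"
  unfolding Phi_eq_suminf[abs_def] by measurable

lemma Phi_bound: "\<bar>Phi u\<bar> \<le> (\<Sum>k. 18 / pi / (real (Suc k))\<^sup>2) * exp (- 3 * u)"
proof -
  have "\<bar>Phi u\<bar> \<le> (\<Sum>k. \<bar>Phi_term k u\<bar>)" unfolding Phi_eq_suminf by (rule summable_rabs[OF summable_Phi_term])
  also have "\<dots> \<le> (\<Sum>k. 18 / pi * exp (- 3 * u) / (real (Suc k))\<^sup>2)"
    by (intro suminf_le Phi_term_bound summable_Phi_term summable_inverse_square_Suc)
  also have "\<dots> = (\<Sum>k. 18 / pi / (real (Suc k))\<^sup>2 * exp (- 3 * u))" by (simp add: field_simps)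
  also have "\<dots> = (\<Sum>k. 18 / pi / (real (Suc k))\<^sup>2) * exp (- 3 * u)"
    by (rule suminf_mult2[OF summable_inverse_square_Suc, symmetric])
  finally show ?thesis .
qed

text \<open>In the variable \<open>q\<close> the integrand is a multiple of
  \<open>(2 * q powr (p + 1) - 3 * q powr p) * exp (- q)\<close>, and
  \<open>2 * Gamma (p + 1) - 3 * Gamma p = (2 * p - 3) * Gamma p\<close>.\<close>

lemma Phi_term_0_transform:
  fixes w :: complex
  assumes w: "Re w > -5"
  defines "p \<equiv> (5 + w) / 4"
  shows "integrable lborel (\<lambda>v. of_real (Phi_term 0 v) * exp (w * of_real v))"
    and "(LINT v|lborel. of_real (Phi_term 0 v) * exp (w * of_real v)) = exp ((1 - p) * of_real (ln pi)) * Gamma p * (2 * p - 3) / 4"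
proof -
  let ?E = "\<lambda>p v. exp (p * of_real (ln pi + 4 * v) - of_real (pi * exp (4 * v)))"
  have p: "Re p > 0" "Re (p + 1) > 0" using w by (simp_all add: p_def field_simps)
  have eq: "of_real (Phi_term 0 v) * exp (w * of_real v) = exp ((1 - p) * of_real (ln pi)) * (2 * ?E (p + 1) v - 3 * ?E p v)" for v
  proof -
    define q where "q = pi * exp (4 * v)"
    have q: "q = exp (ln pi + 4 * v)" by (simp add: q_def exp_add)
    have w': "w = 4 * p - 5" by (simp add: p_def add_divide_distrib)
    have 1: "complex_of_real (Phi_term 0 v) = exp (of_real v) * (2 * (of_real q)\<^sup>2 - 3 * of_real q) * exp (- of_real q)"
      using Phi_term_altdef[of 0 v] by (simp add: q_def exp_of_real[symmetric])
    have 2: "?E (p + 1) v = of_real q * ?E p v"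
      unfolding q exp_of_real[symmetric] by (simp add: exp_add[symmetric] algebra_simps)
    have "exp ((1 - p) * of_real (ln pi)) * ?E p v = exp (of_real (ln pi) + 4 * p * of_real v - of_real q)"
      unfolding exp_add[symmetric] q_def by (intro arg_cong[where f = exp]) (simp add: algebra_simps)
    also have "of_real (ln pi) + 4 * p * of_real v - of_real q = of_real (ln pi + 4 * v) + w * of_real v + of_real v + - of_real q"
      by (simp add: w' algebra_simps)
    also have "exp \<dots> = of_real q * exp (w * of_real v) * exp (of_real v) * exp (- of_real q)"
      unfolding q by (simp only: exp_add exp_of_real)
    finally have 3: "exp ((1 - p) * of_real (ln pi)) * ?E p v = of_real q * exp (w * of_real v) * exp (of_real v) * exp (- of_real q)" .
    have "exp ((1 - p) * of_real (ln pi)) * (2 * ?E (p + 1) v - 3 * ?E p v) = (2 * of_real q - 3) * (exp ((1 - p) * of_real (ln pi)) * ?E p v)"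
      unfolding 2 by (simp only: algebra_simps)
    thus ?thesis unfolding 3 1 by (simp add: algebra_simps power2_eq_square)
  qed
  note G = Gamma_integral_exp_substitution
  show "integrable lborel (\<lambda>v. of_real (Phi_term 0 v) * exp (w * of_real v))"
    unfolding eq by (intro integrable_mult_right Bochner_Integration.integrable_diff G p)
  have "(LINT v|lborel. of_real (Phi_term 0 v) * exp (w * of_real v)) = exp ((1 - p) * of_real (ln pi)) * (2 * (Gamma (p + 1) / 4) - 3 * (Gamma p / 4))"
    unfolding eq integral_mult_right_zero
    by (subst Bochner_Integration.integral_diff) (intro integrable_mult_right G p | simp only: integral_mult_right_zero G(2)[OF p(1)] G(2)[OF p(2)])+
  also have "Gamma (p + 1) = p * Gamma p" by (rule Gamma_plus1) (use p in \<open>auto elim!: nonpos_Ints_cases\<close>)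
  finally show "(LINT v|lborel. of_real (Phi_term 0 v) * exp (w * of_real v)) = exp ((1 - p) * of_real (ln pi)) * Gamma p * (2 * p - 3) / 4"
    by (simp add: field_simps)
qed

lemma integrable_gaussian_exp_real: "A > 0 \<Longrightarrow> integrable lborel (\<lambda>r::real. exp (- (A * r\<^sup>2) + c * r))"
  using integrable_norm[OF integrable_gaussian[of A "of_real c"]] by (simp add: norm_exp_eq_Re)

text \<open>Completing the square around an arbitrary real centre \<open>\<mu>\<close> before writing the Gaussian as a Fourier integral
  is what replaces a shift of contour: for \<open>\<mu> = 0\<close> the integrand on the right would be much larger than the integral.\<close>

lemma Phi_term_gaussian_transform:
  fixes a :: complex and T \<mu> :: real and k :: nat
  assumes T: "T > 0" and w: "Re a + 5 - 2 * T * \<mu> > 0"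
  defines "l \<equiv> ln (real (Suc k))"
  defines "p \<equiv> \<lambda>r::real. (5 + a + of_real (T * l - 2 * T * \<mu>) + \<i> * of_real r) / 4"
  shows "(LINT u|lborel. of_real (exp (- T * u\<^sup>2) * Phi_term k u) * exp (a * of_real u)) =
    exp (- (1 + a) / 2 * of_real l + of_real (- T * l\<^sup>2 / 4 + T * \<mu>\<^sup>2)) / of_real (sqrt (4 * pi * T)) *
      (LINT r|lborel. exp (of_real (- r\<^sup>2 / (4 * T)) - \<i> * of_real (r * \<mu>)) *
         (exp ((1 - p r) * of_real (ln pi)) * Gamma (p r) * (2 * p r - 3) / 4))"
proof -
  \<comment> \<open>The linear coefficient that remains when the translated Gaussian is recentred at
    \<open>\<mu>\<close>. Since \<open>l \<ge> 0\<close> can only increase its real part, one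
    condition on \<open>a\<close> and \<open>\<mu>\<close> serves all \<open>k\<close>.\<close>
  define w where "w = a + of_real (T * l - 2 * T * \<mu>)"
  have l: "l \<ge> 0" by (simp add: l_def)
  have "T * l \<ge> 0" using T l by simp
  hence rew: "Re w > -5" using w unfolding w_def by (simp add: algebra_simps)
  define E where "E = exp (- (1 + a) / 2 * of_real l + of_real (- T * l\<^sup>2 / 4 + T * \<mu>\<^sup>2))"
  define \<psi> where "\<psi> v = of_real (Phi_term 0 v) * exp (w * of_real v)" for v
  define s where "s = complex_of_real (sqrt (4 * pi * T))"
  have s: "s \<noteq> 0" using T by (simp add: s_def)
  have int\<psi>: "integrable lborel \<psi>" unfolding \<psi>_def by (rule Phi_term_0_transform(1)[OF rew])
  have shift: "Phi_term k (- l / 2 + v) = exp (- l / 2) * Phi_term 0 v" for v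
  proof -
    have "4 * (- l / 2 + v) = 4 * v - (l + l)" by simp
    hence "exp (4 * (- l / 2 + v)) = exp (4 * v) / (exp l)\<^sup>2"
      by (simp only: exp_diff exp_add power2_eq_square)
    hence "pi * (real (Suc k))\<^sup>2 * exp (4 * (- l / 2 + v)) = pi * (real (Suc 0))\<^sup>2 * exp (4 * v)" 
      by (simp add: l_def)
    thus ?thesis unfolding Phi_term_altdef by (simp only: exp_add mult_ac)
  qed
  define f where "f u = of_real (exp (- T * u\<^sup>2) * Phi_term k u) * exp (a * of_real u)" for u
  have "(LINT u|lborel. f u) = \<bar>1\<bar> *\<^sub>R (LINT v|lborel. f (- l / 2 + 1 * v))"
    by (rule lborel_integral_real_affine[of 1 f "- l / 2"]) simp
  also have "(\<lambda>v. f (- l / 2 + 1 * v)) = (\<lambda>v. E * (exp (of_real (- T * (v - \<mu>)\<^sup>2)) * \<psi> v))"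
  proof
    fix v
    have "f (- l / 2 + 1 * v) = of_real (Phi_term 0 v) * exp (of_real (- T * (- l / 2 + v)\<^sup>2) + of_real (- l / 2) + a * of_real (- l / 2 + v))"
    proof -
      have "of_real (exp X * (exp Y * P)) * exp Z = of_real P * exp (of_real X + of_real Y + Z)" for X Y P :: real and Z :: complex
        by (simp add: exp_add exp_of_real)
      thus ?thesis unfolding f_def mult_1 shift .
    qed
    also have "of_real (- T * (- l / 2 + v)\<^sup>2) + of_real (- l / 2) + a * of_real (- l / 2 + v) =
        - (1 + a) / 2 * of_real l + of_real (- T * l\<^sup>2 / 4 + T * \<mu>\<^sup>2) + (of_real (- T * (v - \<mu>)\<^sup>2) + w * of_real v)"
      unfolding w_def by (simp add: field_simps power2_eq_square)
    also have "of_real (Phi_term 0 v) * exp \<dots> = E * (exp (of_real (- T * (v - \<mu>)\<^sup>2)) * \<psi> v)"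
      unfolding E_def \<psi>_def exp_add by (simp only: mult_ac)
    finally show "f (- l / 2 + 1 * v) = E * (exp (of_real (- T * (v - \<mu>)\<^sup>2)) * \<psi> v)" .
  qed
  also have "\<bar>1\<bar> *\<^sub>R (LINT v|lborel. E * (exp (of_real (- T * (v - \<mu>)\<^sup>2)) * \<psi> v)) = E * (LINT v|lborel. exp (of_real (- T * (v - \<mu>)\<^sup>2)) * \<psi> v)"
    by (simp only: integral_mult_right_zero abs_one scaleR_one)
  also have "(LINT v|lborel. exp (of_real (- T * (v - \<mu>)\<^sup>2)) * \<psi> v) = 
     (LINT v|lborel. LINT r|lborel. exp (of_real (- (1 / (4 * T) * r\<^sup>2)) + \<i> * of_real (v - \<mu>) * of_real r) * \<psi> v) / s"
  proof -
    have "(LINT r|lborel. exp (of_real (- (1 / (4 * T) * r\<^sup>2)) + \<i> * of_real (v - \<mu>) * of_real r) * \<psi> v) = s * (exp (of_real (- T * (v - \<mu>)\<^sup>2)) * \<psi> v)" for v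
    proof -
      have 1: "pi / (1 / (4 * T)) = 4 * pi * T" "4 * (1 / (4 * T)) = 1 / T" using T by simp_all
      have "(\<i> * of_real (v - \<mu>))\<^sup>2 / of_real (1 / T) = complex_of_real (- T * (v - \<mu>)\<^sup>2)"
        by (simp add: power_mult_distrib mult_ac)
      moreover have "1 / (4 * T) > 0" using T by simp
      ultimately have "(LINT r|lborel. exp (of_real (- (1 / (4 * T) * r\<^sup>2)) + \<i> * of_real (v - \<mu>) * of_real r)) = s * exp (of_real (- T * (v - \<mu>)\<^sup>2))"
        using gaussian_integral[of "1 / (4 * T)" "\<i> * of_real (v - \<mu>)"] unfolding 1 s_def by simp
      thus ?thesis unfolding integral_mult_left_zero by (simp only: mult.assoc)
    qed
    thus ?thesis using s by (simp only: integral_mult_right_zero) (simp only: nonzero_mult_div_cancel_left not_False_eq_True)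
  qed
  also have "(LINT v|lborel. LINT r|lborel. exp (of_real (- (1 / (4 * T) * r\<^sup>2)) + \<i> * of_real (v - \<mu>) * of_real r) * \<psi> v)
     = (LINT r|lborel. LINT v|lborel. exp (of_real (- (1 / (4 * T) * r\<^sup>2)) + \<i> * of_real (v - \<mu>) * of_real r) * \<psi> v)"
  proof (rule lborel_pair.Fubini_integral)
    have [measurable]: "\<psi> \<in> borel_measurable borel" using int\<psi> by simp
    have meas: "(\<lambda>x. exp (of_real (- (1 / (4 * T) * (fst x)\<^sup>2)) + \<i> * of_real (snd x - \<mu>) * of_real (fst x)) * \<psi> (snd x)) \<in> borel_measurable (lborel \<Otimes>\<^sub>M lborel)"
    proof -
      have "(\<lambda>x::real\<times>real. exp (of_real (- (1 / (4 * T) * (fst x)\<^sup>2)) + \<i> * of_real (snd x - \<mu>) * of_real (fst x))) \<in> borel_measurable borel"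
        using T by (intro borel_measurable_continuous_onI continuous_intros) auto
      hence "(\<lambda>x::real\<times>real. exp (of_real (- (1 / (4 * T) * (fst x)\<^sup>2)) + \<i> * of_real (snd x - \<mu>) * of_real (fst x))) \<in> borel_measurable (lborel \<Otimes>\<^sub>M lborel)"
        unfolding lborel_prod by simp
      thus ?thesis by measurable
    qed
    have nrm: "norm (exp (of_real (- (1 / (4 * T) * r\<^sup>2)) + \<i> * of_real (v - \<mu>) * of_real r) * \<psi> v) = exp (- (1 / (4 * T) * r\<^sup>2)) * norm (\<psi> v)" for r v
      unfolding norm_mult norm_exp_eq_Re by simp
    show "integrable (lborel \<Otimes>\<^sub>M lborel) (\<lambda>(r, v). exp (of_real (- (1 / (4 * T) * r\<^sup>2)) + \<i> * of_real (v - \<mu>) * of_real r) * \<psi> v)"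
    proof (rule lborel_pair.Fubini_integrable)
      show "(\<lambda>(r, v). exp (of_real (- (1 / (4 * T) * r\<^sup>2)) + \<i> * of_real (v - \<mu>) * of_real r) * \<psi> v) \<in> borel_measurable (lborel \<Otimes>\<^sub>M lborel)"
        using meas by (simp add: case_prod_beta')
      show "integrable lborel (\<lambda>x. LINT y|lborel. norm (case (x, y) of (r, v) \<Rightarrow> exp (of_real (- (1 / (4 * T) * r\<^sup>2)) + \<i> * of_real (v - \<mu>) * of_real r) * \<psi> v))"
        unfolding prod.case nrm integral_mult_right_zero using T by (intro integrable_mult_left integrable_exp_neg_square) auto
      show "AE x in lborel. integrable lborel (\<lambda>y. case (x, y) of (r, v) \<Rightarrow> exp (of_real (- (1 / (4 * T) * r\<^sup>2)) + \<i> * of_real (v - \<mu>) * of_real r) * \<psi> v)"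
      proof (rule AE_I2, unfold prod.case)
        fix r :: real
        show "integrable lborel (\<lambda>v. exp (of_real (- (1 / (4 * T) * r\<^sup>2)) + \<i> * of_real (v - \<mu>) * of_real r) * \<psi> v)"
        proof (rule Bochner_Integration.integrable_bound[OF integrable_norm[OF int\<psi>]])
          show "(\<lambda>v. exp (of_real (- (1 / (4 * T) * r\<^sup>2)) + \<i> * of_real (v - \<mu>) * of_real r) * \<psi> v) \<in> borel_measurable lborel"
            by measurable
          show "AE v in lborel. norm (exp (of_real (- (1 / (4 * T) * r\<^sup>2)) + \<i> * of_real (v - \<mu>) * of_real r) * \<psi> v) \<le> norm (norm (\<psi> v))"
            unfolding nrm using T by (intro AE_I2) (auto intro!: mult_left_le_one_le)
        qed
      qed
    qed
  qed
  also have "(\<lambda>r. LINT v|lborel. exp (of_real (- (1 / (4 * T) * r\<^sup>2)) + \<i> * of_real (v - \<mu>) * of_real r) * \<psi> v)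
      = (\<lambda>r. exp (of_real (- r\<^sup>2 / (4 * T)) - \<i> * of_real (r * \<mu>)) * (exp ((1 - p r) * of_real (ln pi)) * Gamma (p r) * (2 * p r - 3) / 4))"
  proof
    fix r :: real
    have p: "p r = (5 + (w + \<i> * of_real r)) / 4" by (simp add: p_def w_def)
    have "exp (of_real (- (1 / (4 * T) * r\<^sup>2)) + \<i> * of_real (v - \<mu>) * of_real r) * \<psi> v =
       exp (of_real (- r\<^sup>2 / (4 * T)) - \<i> * of_real (r * \<mu>)) * (of_real (Phi_term 0 v) * exp ((w + \<i> * of_real r) * of_real v))" for v
    proof -
      have "of_real (- (1 / (4 * T) * r\<^sup>2)) + \<i> * of_real (v - \<mu>) * of_real r + w * of_real v =
        of_real (- r\<^sup>2 / (4 * T)) - \<i> * of_real (r * \<mu>) + (w + \<i> * of_real r) * of_real v"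
        by (simp add: algebra_simps)
      hence "exp (of_real (- (1 / (4 * T) * r\<^sup>2)) + \<i> * of_real (v - \<mu>) * of_real r) * exp (w * of_real v) =
        exp (of_real (- r\<^sup>2 / (4 * T)) - \<i> * of_real (r * \<mu>)) * exp ((w + \<i> * of_real r) * of_real v)"
        unfolding exp_add[symmetric] by (rule arg_cong)
      note eq = this
      have "x * (c * y) = x' * (c * y')" if "x * y = x' * y'" for x y x' y' c :: complex
        using arg_cong[OF that, of "\<lambda>z. c * z"] by (simp add: mult.left_commute)
      from this[OF eq] show ?thesis unfolding \<psi>_def .
    qed
    hence "(LINT v|lborel. exp (of_real (- (1 / (4 * T) * r\<^sup>2)) + \<i> * of_real (v - \<mu>) * of_real r) * \<psi> v)
       = exp (of_real (- r\<^sup>2 / (4 * T)) - \<i> * of_real (r * \<mu>)) * (LINT v|lborel. of_real (Phi_term 0 v) * exp ((w + \<i> * of_real r) * of_real v))"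
      by simp
    also have "(LINT v|lborel. of_real (Phi_term 0 v) * exp ((w + \<i> * of_real r) * of_real v)) = exp ((1 - p r) * of_real (ln pi)) * Gamma (p r) * (2 * p r - 3) / 4"
      unfolding p by (rule Phi_term_0_transform(2)) (use rew in simp)
    finally show "(LINT v|lborel. exp (of_real (- (1 / (4 * T) * r\<^sup>2)) + \<i> * of_real (v - \<mu>) * of_real r) * \<psi> v)
       = exp (of_real (- r\<^sup>2 / (4 * T)) - \<i> * of_real (r * \<mu>)) * (exp ((1 - p r) * of_real (ln pi)) * Gamma (p r) * (2 * p r - 3) / 4)" .
  qed
  finally show ?thesis unfolding E_def s_def f_def by (simp only: times_divide_eq_left times_divide_eq_right)
qed

section \<open>The transform of \<open>Phi\<close> over the whole line\<close>

definition Phi_transform :: "real \<Rightarrow> complex \<Rightarrow> complex" where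
  "Phi_transform T a = (LINT u|lborel. of_real (exp (- T * u\<^sup>2) * Phi u) * exp (a * of_real u))"

lemma integrable_Phi_gaussian:
  assumes T: "T > 0"
  shows "integrable lborel (\<lambda>u. exp (- T * u\<^sup>2) * \<bar>Phi u\<bar> * exp (c * u))"
proof (rule Bochner_Integration.integrable_bound)
  define K where "K = (\<Sum>k. 18 / pi / (real (Suc k))\<^sup>2)"
  have K: "K \<ge> 0" unfolding K_def by (intro suminf_nonneg summable_inverse_square_Suc) auto
  show "integrable lborel (\<lambda>u. K * exp (- (T * u\<^sup>2) + (c - 3) * u))"
    using T by (intro integrable_mult_right integrable_gaussian_exp_real) auto
  show "AE u in lborel. norm (exp (- T * u\<^sup>2) * \<bar>Phi u\<bar> * exp (c * u)) \<le> norm (K * exp (- (T * u\<^sup>2) + (c - 3) * u))"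
  proof (rule AE_I2)
    fix u :: real
    have "exp (- T * u\<^sup>2) * \<bar>Phi u\<bar> * exp (c * u) \<le> exp (- T * u\<^sup>2) * (K * exp (- 3 * u)) * exp (c * u)"
      unfolding K_def by (intro mult_right_mono mult_left_mono Phi_bound) auto
    also have "\<dots> = K * exp (- (T * u\<^sup>2) + (c - 3) * u)" by (simp add: exp_add[symmetric] algebra_simps)
    finally show "norm (exp (- T * u\<^sup>2) * \<bar>Phi u\<bar> * exp (c * u)) \<le> norm (K * exp (- (T * u\<^sup>2) + (c - 3) * u))"
      using K by (simp add: abs_mult)
  qed
qed measurable

lemma integrable_Phi_transform:
  fixes a :: complex
  assumes T: "T > 0"
  shows "integrable lborel (\<lambda>u. of_real (exp (- T * u\<^sup>2) * Phi u) * exp (a * of_real u))"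
  by (rule Bochner_Integration.integrable_bound[OF integrable_Phi_gaussian[OF T, of "Re a"]])
     (auto simp: norm_mult norm_exp_eq_Re abs_mult)

lemma H_eq_Phi_transform:
  assumes T: "T > 0"
  shows "2 * H (- T) z = Phi_transform T (\<i> * z)"
proof -
  define f where "f u = of_real (exp (- T * u\<^sup>2) * Phi u) * exp (\<i> * z * of_real u)" for u
  have int: "integrable lborel f" unfolding f_def by (rule integrable_Phi_transform[OF T])
  have f': "f (- u) = of_real (exp (- T * u\<^sup>2) * Phi u) * exp (- (\<i> * z * of_real u))" for u
    by (simp add: f_def Phi_even)
  have int': "integrable lborel (\<lambda>u. f (- u))"
    using lborel_integrable_real_affine[OF int, of "-1" 0] by simp
  have "(LINT u|lborel. f u) = (LINT u|lborel. indicator {0..} u *\<^sub>R f u + indicator {..<0} u *\<^sub>R f u)"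
    by (intro Bochner_Integration.integral_cong) (auto simp: indicator_def)
  also have "\<dots> = (LINT u|lborel. indicator {0..} u *\<^sub>R f u) + (LINT u|lborel. indicator {..<0} u *\<^sub>R f u)"
    by (intro Bochner_Integration.integral_add integrable_mult_indicator int) auto
  also have "(LINT u|lborel. indicator {..<0} u *\<^sub>R f u) = (LINT u|lborel. indicator {..<0} (0 + (-1) * u) *\<^sub>R f (0 + (-1) * u))"
    using lborel_integral_real_affine[of "-1" "\<lambda>u. indicator {..<0} u *\<^sub>R f u" 0] by simp
  also have "\<dots> = (LINT u|lborel. indicator {0..} u *\<^sub>R f (- u))"
  proof (rule integral_cong_AE)
    show "AE u in lborel. indicat_real {..<0} (0 + (-1) * u) *\<^sub>R f (0 + (-1) * u) = indicat_real {0..} u *\<^sub>R f (- u)"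
      using AE_lborel_singleton[of "0::real"] by eventually_elim (auto simp: indicator_def)
  qed (use int int' in measurable)
  also have "(LINT u|lborel. indicator {0..} u *\<^sub>R f u) + (LINT u|lborel. indicator {0..} u *\<^sub>R f (- u))
     = (LINT u|lborel. indicator {0..} u *\<^sub>R f u + indicator {0..} u *\<^sub>R f (- u))"
    by (intro Bochner_Integration.integral_add[symmetric] integrable_mult_indicator int int') auto
  also have "\<dots> = (LINT u|lborel. 2 * (indicator {0..} u *\<^sub>R (of_real (exp ((- T) * u\<^sup>2) * Phi u) * cos (z * of_real u))))"
    unfolding f' unfolding f_def cos_exp_eq
    by (intro Bochner_Integration.integral_cong refl) (auto simp: indicator_def algebra_simps)
  also have "\<dots> = 2 * H (- T) z" unfolding H_def set_lebesgue_integral_def by (simp only: integral_mult_right_zero)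
  finally show ?thesis by (simp add: Phi_transform_def f_def)
qed

text \<open>Sum and integral may be interchanged because the Gaussian makes the bound of
  \<open>Phi_term_bound\<close>, which grows exponentially to the left, integrable over the whole
  line.\<close>

lemma Phi_transform_sums:
  assumes T: "T > 0"
  shows "(\<lambda>k. LINT u|lborel. of_real (exp (- T * u\<^sup>2) * Phi_term k u) * exp (a * of_real u)) sums Phi_transform T a"
proof -
  define f where "f k u = of_real (exp (- T * u\<^sup>2) * Phi_term k u) * exp (a * of_real u)" for k u
  define g where "g u = 18 / pi * exp (- (T * u\<^sup>2) + (Re a - 3) * u)" for u
  have intg: "integrable lborel g"
    unfolding g_def using T by (intro integrable_mult_right integrable_gaussian_exp_real) auto
  have g0: "g u \<ge> 0" for u by (simp add: g_def)
  have bound: "norm (f k u) \<le> g u / (real (Suc k))\<^sup>2" for k u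
  proof -
    have "norm (f k u) = exp (- T * u\<^sup>2) * \<bar>Phi_term k u\<bar> * exp (Re a * u)"
      by (simp add: f_def norm_mult norm_exp_eq_Re abs_mult)
    also have "\<dots> \<le> exp (- T * u\<^sup>2) * (18 / pi * exp (- 3 * u) / (real (Suc k))\<^sup>2) * exp (Re a * u)"
      by (intro mult_right_mono mult_left_mono Phi_term_bound) auto
    also have "\<dots> = 18 / pi * (exp (- T * u\<^sup>2) * exp (- 3 * u) * exp (Re a * u)) / (real (Suc k))\<^sup>2" by simp
    also have "exp (- T * u\<^sup>2) * exp (- 3 * u) * exp (Re a * u) = exp (- (T * u\<^sup>2) + (Re a - 3) * u)"
      by (simp add: exp_add[symmetric] algebra_simps)
    finally show ?thesis by (simp add: g_def)
  qed
  have [measurable]: "f k \<in> borel_measurable borel" for k unfolding f_def by measurable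
  have intf: "integrable lborel (f k)" for k
    by (rule Bochner_Integration.integrable_bound[OF integrable_divide_zero[OF intg, of "(real (Suc k))\<^sup>2"]])
       (use bound g0 in auto)
  have "(\<lambda>k. integral\<^sup>L lborel (f k)) sums (LINT u|lborel. (\<Sum>k. f k u))"
  proof (rule sums_integral[OF intf])
    show "AE u in lborel. summable (\<lambda>k. norm (f k u))"
      by (intro AE_I2 summable_comparison_test'[OF summable_inverse_square_Suc]) (use bound in auto)
    show "summable (\<lambda>k. LINT u|lborel. norm (f k u))"
    proof (rule summable_comparison_test'[OF summable_inverse_square_Suc[of "LINT u|lborel. g u"]])
      fix k
      have "(LINT u|lborel. norm (f k u)) \<le> (LINT u|lborel. g u / (real (Suc k))\<^sup>2)"
        using intg intf bound by (intro integral_mono integrable_divide_zero) auto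
      thus "norm (LINT u|lborel. norm (f k u)) \<le> (LINT u|lborel. g u) / (real (Suc k))\<^sup>2" by simp
    qed
  qed
  also have "(\<lambda>u. \<Sum>k. f k u) = (\<lambda>u. of_real (exp (- T * u\<^sup>2) * Phi u) * exp (a * of_real u))"
  proof
    fix u
    have "(\<lambda>k. complex_of_real (exp (- T * u\<^sup>2) * Phi_term k u)) sums of_real (exp (- T * u\<^sup>2) * Phi u)"
      unfolding Phi_eq_suminf
      by (rule sums_of_real[OF sums_mult[OF summable_sums[OF summable_rabs_cancel[OF summable_Phi_term]]]])
    from sums_mult2[OF this] show "(\<Sum>k. f k u) = of_real (exp (- T * u\<^sup>2) * Phi u) * exp (a * of_real u)"
      unfolding f_def by (rule sums_unique[symmetric])
  qed
  finally show ?thesis unfolding f_def Phi_transform_def .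
qed

text \<open>Expanding \<open>exp (a * u)\<close> gives a power series in \<open>a\<close> that
  converges everywhere. The partial sums of norms are dominated through \<open>exp (norm a *
  \<bar>u\<bar>) \<le> exp (norm a * u) + exp (- norm a * u)\<close>.\<close>

lemma holomorphic_Phi_transform:
  assumes T: "T > 0"
  shows "Phi_transform T holomorphic_on UNIV"
proof -
  define \<rho> where "\<rho> u = exp (- T * u\<^sup>2) * Phi u" for u
  define c where "c n = (LINT u|lborel. of_real (\<rho> u) * (of_real u ^ n / fact n) :: complex)" for n :: nat
  have [measurable]: "\<rho> \<in> borel_measurable borel" unfolding \<rho>_def by measurable
  have "(\<lambda>n. c n * (a - 0) ^ n) sums Phi_transform T a" for a
  proof -
    define f where "f n u = of_real (\<rho> u) * ((a * of_real u) ^ n / fact n)" for n u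
    define G where "G u = exp (- T * u\<^sup>2) * \<bar>Phi u\<bar> * exp (norm a * u) + exp (- T * u\<^sup>2) * \<bar>Phi u\<bar> * exp (- norm a * u)" for u
    have intG: "integrable lborel G" unfolding G_def
      using integrable_Phi_gaussian[OF T, of "norm a"] integrable_Phi_gaussian[OF T, of "- norm a"] by simp
    have nf: "norm (f n u) = \<bar>\<rho> u\<bar> * ((norm a * \<bar>u\<bar>) ^ n / fact n)" for n u
      by (simp add: f_def norm_mult norm_divide norm_power)
    have esums: "(\<lambda>n. norm (f n u)) sums (\<bar>\<rho> u\<bar> * exp (norm a * \<bar>u\<bar>))" for u
      unfolding nf using exp_converges[of "norm a * \<bar>u\<bar>"] by (intro sums_mult) (simp add: divide_inverse mult.commute scaleR_conv_of_real)
    have leG: "\<bar>\<rho> u\<bar> * exp (norm a * \<bar>u\<bar>) \<le> G u" for u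
      unfolding G_def \<rho>_def by (cases "u \<ge> 0") (auto simp: abs_mult)
    have partial: "(\<Sum>n<N. norm (f n u)) \<le> G u" for N u
      using sum_le_suminf[OF sums_summable[OF esums[of u]], of "{..<N}"] leG[of u] sums_unique[OF esums[of u]] by simp
    have single: "norm (f n u) \<le> G u" for n u
      using partial[where N = "Suc n" and u = u] sum_nonneg[of "{..<n}" "\<lambda>n. norm (f n u)"] by simp
    have [measurable]: "f n \<in> borel_measurable borel" for n unfolding f_def by measurable
    have intf: "integrable lborel (f n)" for n
      by (rule Bochner_Integration.integrable_bound[OF intG]) (use single in \<open>auto intro!: AE_I2 order_trans[OF _ abs_ge_self]\<close>)
    have "(\<lambda>n. integral\<^sup>L lborel (f n)) sums (LINT u|lborel. (\<Sum>n. f n u))"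
    proof (rule sums_integral[OF intf])
      show "AE u in lborel. summable (\<lambda>n. norm (f n u))" using esums by (auto simp: sums_iff)
      show "summable (\<lambda>n. LINT u|lborel. norm (f n u))"
      proof (rule summableI_nonneg_bounded)
        fix N
        have "(\<Sum>n<N. LINT u|lborel. norm (f n u)) = (LINT u|lborel. (\<Sum>n<N. norm (f n u)))"
          by (rule Bochner_Integration.integral_sum[symmetric]) (use intf in auto)
        also have "\<dots> \<le> (LINT u|lborel. G u)"
          using intf intG partial by (intro integral_mono Bochner_Integration.integrable_sum) auto
        finally show "(\<Sum>n<N. LINT u|lborel. norm (f n u)) \<le> (LINT u|lborel. G u)" .
      qed auto
    qed
    also have "(\<lambda>u. \<Sum>n. f n u) = (\<lambda>u. of_real (\<rho> u) * exp (a * of_real u))"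
    proof
      fix u
      have "(\<lambda>n. f n u) sums (of_real (\<rho> u) * exp (a * of_real u))"
        unfolding f_def using exp_converges[of "a * of_real u"] by (intro sums_mult) (simp add: divide_inverse mult.commute scaleR_conv_of_real)
      thus "(\<Sum>n. f n u) = of_real (\<rho> u) * exp (a * of_real u)" by (rule sums_unique[symmetric])
    qed
    also have "(\<lambda>n. integral\<^sup>L lborel (f n)) = (\<lambda>n. c n * (a - 0) ^ n)"
    proof
      fix n
      have "f n = (\<lambda>u. of_real (\<rho> u) * (of_real u ^ n / fact n) * a ^ n)"
        by (auto simp: f_def fun_eq_iff power_mult_distrib)
      thus "integral\<^sup>L lborel (f n) = c n * (a - 0) ^ n" by (simp only: c_def integral_mult_left_zero diff_zero)
    qed
    finally show ?thesis unfolding Phi_transform_def \<rho>_def .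
  qed
  hence "Phi_transform T holomorphic_on ball 0 R" for R by (intro power_series_holomorphic) auto
  hence "Phi_transform T field_differentiable at a" for a
    using holomorphic_on_imp_differentiable_at[of _ "ball 0 (norm a + 1)" a] by simp
  thus ?thesis by (simp add: holomorphic_on_def field_differentiable_at_within)
qed

section \<open>Asymptotics along a logarithmic curve\<close>

text \<open>Completing the square bounds the exponent by a constant minus \<open>2 * l\<close>, and
  \<open>exp (- 2 * l)\<close> is the inverse square of \<open>Suc k\<close>.\<close>

lemma summable_exp_ln_quadratic:
  assumes \<kappa>: "\<kappa> > 0"
  shows "summable (\<lambda>k. exp (c * ln (real (Suc k)) - \<kappa> * (ln (real (Suc k)))\<^sup>2))"
proof (rule summable_comparison_test'[OF summable_inverse_square_Suc])
  fix k
  define l where "l = ln (real (Suc k))"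
  have "0 \<le> (2 * \<kappa> * l - (c + 2))\<^sup>2 / (4 * \<kappa>)" using \<kappa> by simp
  also have "\<dots> = \<kappa> * l\<^sup>2 - (c + 2) * l + (c + 2)\<^sup>2 / (4 * \<kappa>)"
    using \<kappa> by (simp add: power2_eq_square field_simps)
  finally have "c * l - \<kappa> * l\<^sup>2 \<le> (c + 2)\<^sup>2 / (4 * \<kappa>) - (l + l)" by (simp add: algebra_simps)
  hence "exp (c * l - \<kappa> * l\<^sup>2) \<le> exp ((c + 2)\<^sup>2 / (4 * \<kappa>) - (l + l))" by simp
  also have "\<dots> = exp ((c + 2)\<^sup>2 / (4 * \<kappa>)) / (exp l)\<^sup>2"
    by (simp only: exp_diff exp_add power2_eq_square)
  also have "exp l = real (Suc k)" by (simp add: l_def)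
  finally show "norm (exp (c * ln (real (Suc k)) - \<kappa> * (ln (real (Suc k)))\<^sup>2)) \<le> exp ((c + 2)\<^sup>2 / (4 * \<kappa>)) / (real (Suc k))\<^sup>2"
    by (simp add: l_def)
qed

definition Gamma_ratio' :: "real \<Rightarrow> complex \<Rightarrow> complex" where
  "Gamma_ratio' Y d = Gamma_ratio Y d * (2 * (1 + \<i> * of_real Y + d) - 3) / (2 * (1 + \<i> * of_real Y))"

lemma tendsto_Gamma_ratio':
  assumes "Re d \<ge> 0"
  shows "((\<lambda>Y. Gamma_ratio' Y d) \<longlongrightarrow> 1) at_top"
proof -
  have "filterlim (\<lambda>Y::real. norm (2 * (1 + \<i> * of_real Y))) at_top at_top"
  proof (rule filterlim_at_top_mono[OF filterlim_ident])
    show "\<forall>\<^sub>F Y in at_top. Y \<le> norm (2 * (1 + \<i> * complex_of_real Y))"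
    proof (rule always_eventually, rule allI)
      fix Y :: real
      show "Y \<le> norm (2 * (1 + \<i> * complex_of_real Y))"
        using abs_Im_le_cmod[of "2 * (1 + \<i> * complex_of_real Y)"] by simp
    qed
  qed
  hence "filterlim (\<lambda>Y::real. 2 * (1 + \<i> * complex_of_real Y)) at_infinity at_top"
    by (simp add: filterlim_at_infinity_conv_norm_at_top)
  hence "((\<lambda>Y::real. (2 * d - 3) / (2 * (1 + \<i> * complex_of_real Y))) \<longlongrightarrow> 0) at_top"
    by (intro tendsto_divide_0[OF tendsto_const])
  hence "((\<lambda>Y::real. 1 + (2 * d - 3) / (2 * (1 + \<i> * complex_of_real Y))) \<longlongrightarrow> 1 + 0) at_top"
    by (intro tendsto_intros)
  moreover have "1 + (2 * d - 3) / (2 * (1 + \<i> * complex_of_real Y)) = (2 * (1 + \<i> * of_real Y + d) - 3) / (2 * (1 + \<i> * of_real Y))" for Y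
  proof -
    have "2 * (1 + \<i> * complex_of_real Y) \<noteq> 0" by (auto simp: complex_eq_iff)
    thus ?thesis by (simp add: add_divide_distrib[symmetric] divide_simps)
  qed
  ultimately have "((\<lambda>Y::real. (2 * (1 + \<i> * of_real Y + d) - 3) / (2 * (1 + \<i> * complex_of_real Y))) \<longlongrightarrow> 1) at_top"
    by simp
  from tendsto_mult[OF tendsto_Gamma_ratio[OF assms] this] show ?thesis
    unfolding Gamma_ratio'_def times_divide_eq_right by simp
qed

text \<open>\<open>log_scale Y\<close> is \<open>Ln (\<i> * Y / pi)\<close>: Stirling's approximation is centred at \<open>\<i> * Y\<close> and not at \<open>1 + \<i> * Y\<close>,
  so that its imaginary part does not depend on \<open>Y\<close>.\<close>

definition log_scale :: "real \<Rightarrow> complex" where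
  "log_scale Y = of_real (ln (Y / pi)) + \<i> * of_real (pi / 2)"

text \<open>The value of the transform of the first term at \<open>p = 1 + \<i> * Y\<close>, with
  \<open>2 * p\<close> in place of \<open>2 * p - 3\<close>; the quotient of these two factors is
  part of \<open>Gamma_ratio'\<close>.\<close>

definition Gamma_factor :: "real \<Rightarrow> complex" where
  "Gamma_factor Y = exp (- (\<i> * of_real Y) * of_real (ln pi)) * Gamma (1 + \<i> * of_real Y) * (2 * (1 + \<i> * of_real Y)) / 4"

lemma Gamma_factor_nonzero: "Gamma_factor Y \<noteq> 0"
proof -
  have "1 + \<i> * complex_of_real Y \<notin> \<int>\<^sub>\<le>\<^sub>0" by (auto elim!: nonpos_Ints_cases simp: complex_eq_iff)
  moreover have "2 * (1 + \<i> * complex_of_real Y) \<noteq> 0" by (auto simp: complex_eq_iff)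
  ultimately show ?thesis unfolding Gamma_factor_def using Gamma_nonzero by auto
qed

lemma Gamma_factor_shift:
  assumes Y: "Y > 0"
  defines "P \<equiv> 1 + \<i> * of_real Y"
  shows "exp ((1 - (P + d)) * of_real (ln pi)) * Gamma (P + d) * (2 * (P + d) - 3) / 4 =
    Gamma_factor Y * (exp (log_scale Y * d) * Gamma_ratio' Y d)"
proof -
  have nz: "P \<noteq> 0" "Gamma P \<noteq> 0" using Gamma_factor_nonzero[of Y] unfolding Gamma_factor_def P_def by auto
  have l: "log_scale Y = Ln (\<i> * of_real Y) - of_real (ln pi)"
    using Y by (simp add: log_scale_def Ln_i_times ln_div)
  have e: "exp ((1 - (P + d)) * of_real (ln pi)) = exp (- (\<i> * of_real Y) * of_real (ln pi)) * exp (log_scale Y * d) * exp (- d * Ln (\<i> * of_real Y))"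
    unfolding exp_add[symmetric] l P_def by (intro arg_cong[where f = exp]) (simp add: algebra_simps)
  show ?thesis
    unfolding e Gamma_factor_def Gamma_ratio'_def Gamma_ratio_def P_def[symmetric] using nz by (simp add: field_simps)
qed

text \<open>The shift \<open>b\<close> moves the centre of the Gaussian. It cancels in the limit \<open>Y \<rightarrow> \<infinity>\<close> and only serves
  to keep the argument of \<open>Gamma\<close> in the half-plane \<open>Re \<ge> 1\<close> when \<open>Re \<zeta>\<close> is negative.\<close>

definition weight_integrand :: "real \<Rightarrow> real \<Rightarrow> real \<Rightarrow> complex \<Rightarrow> real \<Rightarrow> real \<Rightarrow> complex" where
  "weight_integrand T Y b \<zeta> l r = exp (of_real (- (1 / (4 * T) * r\<^sup>2)) + (\<i> * of_real b - of_real (pi / 8)) * of_real r) *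
     Gamma_ratio' Y (\<zeta> / 2 + of_real (T * b / 2) + (of_real (T * l) + \<i> * of_real r) / 4)"

text \<open>In the limit the integral contributes
  \<open>exp (T * (\<i> * b - pi / 8)\<^sup>2)\<close>. The exponential in front is chosen to cancel
  the terms of this exponent that contain \<open>b\<close>.\<close>

definition weight :: "real \<Rightarrow> real \<Rightarrow> real \<Rightarrow> complex \<Rightarrow> real \<Rightarrow> complex" where
  "weight T Y b \<zeta> l = exp (of_real (T * b\<^sup>2) + \<i> * of_real (pi * T * b / 4)) / of_real (sqrt (4 * pi * T)) *
     (LINT r|lborel. weight_integrand T Y b \<zeta> l r)"

text \<open>Up to the factor 2 and the normalization this is \<open>H (- T)\<close> on the curve.
  With \<open>m = ln (Y / pi) / 4\<close>, the real part of the saddle, the divisor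
  \<open>exp (T * m\<^sup>2)\<close> is the size left over from recentring the Gaussian;
  \<open>exp (- log_scale Y * \<zeta> / 2)\<close> undoes the Stirling power caused by the shift of
  \<open>p\<close> by \<open>\<zeta> / 2\<close>.\<close>

definition scaled_transform :: "real \<Rightarrow> real \<Rightarrow> complex \<Rightarrow> complex" where
  "scaled_transform T Y \<zeta> = Phi_transform T (- 1 + 4 * \<i> * of_real Y + of_real (T * ln (Y / pi) / 2) + 2 * \<zeta>) *
     exp (- log_scale Y * \<zeta> / 2) / (Gamma_factor Y * of_real (exp (T * (ln (Y / pi))\<^sup>2 / 16)))"

lemma weight_integrand_measurable:
  assumes T: "T > 0" and l: "l \<ge> 0" and b: "Re \<zeta> + T * b \<ge> 0"
  shows "weight_integrand T Y b \<zeta> l \<in> borel_measurable borel"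
proof (rule borel_measurable_continuous_onI)
  let ?d = "\<lambda>r. \<zeta> / 2 + of_real (T * b / 2) + (of_real (T * l) + \<i> * of_real r) / 4"
  have np: "1 + \<i> * of_real Y + ?d r \<notin> \<int>\<^sub>\<le>\<^sub>0" for r :: real
  proof
    assume "1 + \<i> * of_real Y + ?d r \<in> \<int>\<^sub>\<le>\<^sub>0"
    then obtain n where n: "n \<le> 0" "1 + \<i> * of_real Y + ?d r = of_int n" by (auto elim: nonpos_Ints_cases)
    have "T * l \<ge> 0" using T l by simp
    moreover have "Re (1 + \<i> * of_real Y + ?d r) = of_int n" using n(2) by simp
    ultimately show False using n(1) b by simp
  qed
  have "continuous_on UNIV (\<lambda>r. Gamma (1 + \<i> * of_real Y + ?d r))"
    using np by (intro continuous_on_compose2[OF continuous_on_Gamma[of "- \<int>\<^sub>\<le>\<^sub>0"]] continuous_intros) auto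
  thus "continuous_on UNIV (weight_integrand T Y b \<zeta> l)"
    unfolding weight_integrand_def[abs_def] Gamma_ratio'_def Gamma_ratio_def times_divide_eq_right[symmetric] divide_inverse
    by (intro continuous_intros)
qed

text \<open>The choice \<open>\<epsilon> = 1 / (2 * T)\<close> keeps two reserves. The part
  \<open>(T * l + \<i> * r) / 4\<close> of the argument costs \<open>r\<^sup>2 / (16 * T)\<close>
  out of the available \<open>r\<^sup>2 / (4 * T)\<close>, and \<open>T * l\<^sup>2 / 16\<close>,
  which is less than the \<open>T * l\<^sup>2 / 4\<close> supplied by the Dirichlet
  coefficients.\<close>

lemma weight_integrand_bound:
  assumes T: "T > 0"
  obtains K where "K \<ge> 0" "\<And>Y b \<zeta> (l::real) r D::real. Y \<ge> 1 \<Longrightarrow> l \<ge> 0 \<Longrightarrow> Re \<zeta> + T * b \<ge> 0 \<Longrightarrow> norm (\<zeta> / 2 + of_real (T * b / 2)) \<le> D \<Longrightarrow>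
     norm (weight_integrand T Y b \<zeta> l r) \<le> K * exp (D\<^sup>2 / T + T * l\<^sup>2 / 16) * exp (- (3 / (16 * T) * r\<^sup>2) + (- pi / 8) * r)"
proof -
  define \<epsilon> where "\<epsilon> = 1 / (2 * T)"
  have \<epsilon>: "\<epsilon> > 0" using T by (simp add: \<epsilon>_def)
  obtain K where K: "K > 0" "\<And>Y d. Y \<ge> 1 \<Longrightarrow> Re d \<ge> 0 \<Longrightarrow> norm (Gamma_ratio' Y d) \<le> K * exp (\<epsilon> * (norm d)\<^sup>2)"
    using Gamma_ratio_gaussian_bound[OF \<epsilon>] unfolding Gamma_ratio'_def by metis
  show ?thesis
  proof (rule that[of K])
    fix Y b l r D :: real and \<zeta> :: complex
    assume Y: "Y \<ge> 1" and l: "l \<ge> 0" and b: "Re \<zeta> + T * b \<ge> 0" and D: "norm (\<zeta> / 2 + of_real (T * b / 2)) \<le> D"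
    define d0 where "d0 = \<zeta> / 2 + of_real (T * b / 2)"
    define d1 where "d1 = (of_real (T * l) + \<i> * complex_of_real r) / 4"
    have "T * l \<ge> 0" using T l by simp
    hence re: "Re (d0 + d1) \<ge> 0" using b by (simp add: d0_def d1_def field_simps)
    have n1: "(norm d1)\<^sup>2 = (T\<^sup>2 * l\<^sup>2 + r\<^sup>2) / 16"
      unfolding d1_def cmod_power2 by (simp add: power2_eq_square field_simps)
    have "(norm (d0 + d1))\<^sup>2 \<le> (norm d0 + norm d1)\<^sup>2" by (intro power_mono norm_triangle_ineq) auto
    also have "\<dots> \<le> 2 * (norm d0)\<^sup>2 + 2 * (norm d1)\<^sup>2"
      using sum_squares_bound[of "norm d0" "norm d1"] by (simp add: power2_sum)
    also have "(norm d0)\<^sup>2 \<le> D\<^sup>2" using D unfolding d0_def by (intro power_mono) auto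
    finally have nd: "(norm (d0 + d1))\<^sup>2 \<le> 2 * D\<^sup>2 + (T\<^sup>2 * l\<^sup>2 + r\<^sup>2) / 8" unfolding n1 by (simp add: field_simps)
    have "\<epsilon> * (norm (d0 + d1))\<^sup>2 \<le> \<epsilon> * (2 * D\<^sup>2 + (T\<^sup>2 * l\<^sup>2 + r\<^sup>2) / 8)" using \<epsilon> nd by (intro mult_left_mono) auto
    also have "\<dots> = D\<^sup>2 / T + T * l\<^sup>2 / 16 + r\<^sup>2 / (16 * T)" using T unfolding \<epsilon>_def by (simp add: power2_eq_square field_simps)
    finally have e: "\<epsilon> * (norm (d0 + d1))\<^sup>2 \<le> D\<^sup>2 / T + T * l\<^sup>2 / 16 + r\<^sup>2 / (16 * T)" .
    have "norm (weight_integrand T Y b \<zeta> l r) = exp (- (1 / (4 * T) * r\<^sup>2) - pi / 8 * r) * norm (Gamma_ratio' Y (d0 + d1))"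
      unfolding weight_integrand_def norm_mult norm_exp_eq_Re d0_def d1_def by simp
    also have "\<dots> \<le> exp (- (1 / (4 * T) * r\<^sup>2) - pi / 8 * r) * (K * exp (D\<^sup>2 / T + T * l\<^sup>2 / 16 + r\<^sup>2 / (16 * T)))"
      using K(2)[OF Y re] e K(1) by (intro mult_left_mono order_trans[OF K(2)[OF Y re]]) auto
    also have "\<dots> = K * (exp (D\<^sup>2 / T + T * l\<^sup>2 / 16) * exp (- (1 / (4 * T) * r\<^sup>2) - pi / 8 * r + r\<^sup>2 / (16 * T)))"
      unfolding exp_add[symmetric] by (simp add: exp_add[symmetric] algebra_simps)
    also have "- (1 / (4 * T) * r\<^sup>2) - pi / 8 * r + r\<^sup>2 / (16 * T) = - (3 / (16 * T) * r\<^sup>2) + (- pi / 8) * r"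
      using T by (simp add: field_simps)
    finally show "norm (weight_integrand T Y b \<zeta> l r) \<le> K * exp (D\<^sup>2 / T + T * l\<^sup>2 / 16) * exp (- (3 / (16 * T) * r\<^sup>2) + (- pi / 8) * r)"
      by (simp only: mult.assoc)
  qed (use K in auto)
qed

lemma weight_tendsto:
  assumes T: "T > 0" and l: "l \<ge> 0" and b: "Re \<zeta> + T * b \<ge> 0"
  shows "((\<lambda>Y. weight T Y b \<zeta> l) \<longlongrightarrow> of_real (exp (T * pi\<^sup>2 / 64))) at_top"
proof -
  let ?d = "\<lambda>r. \<zeta> / 2 + of_real (T * b / 2) + (of_real (T * l) + \<i> * of_real r) / 4"
  define w where "w = \<i> * of_real b - complex_of_real (pi / 8)"
  obtain K where K: "K \<ge> 0" "\<And>Y b \<zeta> (l::real) r D::real. Y \<ge> 1 \<Longrightarrow> l \<ge> 0 \<Longrightarrow> Re \<zeta> + T * b \<ge> 0 \<Longrightarrow> norm (\<zeta> / 2 + of_real (T * b / 2)) \<le> D \<Longrightarrow>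
     norm (weight_integrand T Y b \<zeta> l r) \<le> K * exp (D\<^sup>2 / T + T * l\<^sup>2 / 16) * exp (- (3 / (16 * T) * r\<^sup>2) + (- pi / 8) * r)"
    using weight_integrand_bound[OF T] by metis
  have "((\<lambda>Y. LINT r|lborel. weight_integrand T Y b \<zeta> l r) \<longlongrightarrow> (LINT r|lborel. exp (of_real (- (1 / (4 * T) * r\<^sup>2)) + w * of_real r))) at_top"
  proof (rule integral_dominated_convergence_at_top)
    let ?D = "norm (\<zeta> / 2 + of_real (T * b / 2))"
    show "integrable lborel (\<lambda>r. K * exp (?D\<^sup>2 / T + T * l\<^sup>2 / 16) * exp (- (3 / (16 * T) * r\<^sup>2) + (- pi / 8) * r))"
      using T by (intro integrable_mult_right integrable_gaussian_exp_real) auto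
    show "\<forall>\<^sub>F Y in at_top. AE r in lborel. norm (weight_integrand T Y b \<zeta> l r) \<le> K * exp (?D\<^sup>2 / T + T * l\<^sup>2 / 16) * exp (- (3 / (16 * T) * r\<^sup>2) + (- pi / 8) * r)"
      using eventually_ge_at_top[of 1] by eventually_elim (intro AE_I2 K(2) l b order_refl, assumption)
    show "AE r in lborel. ((\<lambda>Y. weight_integrand T Y b \<zeta> l r) \<longlongrightarrow> exp (of_real (- (1 / (4 * T) * r\<^sup>2)) + w * of_real r)) at_top"
    proof (rule AE_I2)
      fix r :: real
      have "T * l \<ge> 0" using T l by simp
      hence "Re (?d r) \<ge> 0" using b by (simp add: field_simps)
      from tendsto_mult[OF tendsto_const[of "exp (of_real (- (1 / (4 * T) * r\<^sup>2)) + w * of_real r)"] tendsto_Gamma_ratio'[OF this]]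
      show "((\<lambda>Y. weight_integrand T Y b \<zeta> l r) \<longlongrightarrow> exp (of_real (- (1 / (4 * T) * r\<^sup>2)) + w * of_real r)) at_top"
        unfolding weight_integrand_def w_def by (simp only: mult_1_right)
    qed
    show "(\<lambda>r. exp (of_real (- (1 / (4 * T) * r\<^sup>2)) + w * of_real r)) \<in> borel_measurable lborel"
      using integrable_gaussian[of "1 / (4 * T)" w] T by simp
    show "weight_integrand T Y b \<zeta> l \<in> borel_measurable lborel" for Y
      using weight_integrand_measurable[OF T l b] by simp
  qed
  also have "(LINT r|lborel. exp (of_real (- (1 / (4 * T) * r\<^sup>2)) + w * of_real r)) = of_real (sqrt (4 * pi * T)) * exp (of_real T * w\<^sup>2)"
  proof -
    have 1: "pi / (1 / (4 * T)) = 4 * pi * T" "4 * (1 / (4 * T)) = 1 / T" using T by simp_all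
    have 2: "w\<^sup>2 / of_real (1 / T) = of_real T * w\<^sup>2" by simp
    have "1 / (4 * T) > 0" using T by simp
    from gaussian_integral[OF this, of w] show ?thesis unfolding 1 2 .
  qed
  finally have "((\<lambda>Y. weight T Y b \<zeta> l) \<longlongrightarrow> exp (of_real (T * b\<^sup>2) + \<i> * of_real (pi * T * b / 4)) / of_real (sqrt (4 * pi * T)) *
      (of_real (sqrt (4 * pi * T)) * exp (of_real T * w\<^sup>2))) at_top"
    unfolding weight_def by (intro tendsto_mult tendsto_const)
  also have "exp (of_real (T * b\<^sup>2) + \<i> * of_real (pi * T * b / 4)) / of_real (sqrt (4 * pi * T)) * (of_real (sqrt (4 * pi * T)) * exp (of_real T * w\<^sup>2))
     = exp (of_real (T * b\<^sup>2) + \<i> * of_real (pi * T * b / 4) + of_real T * w\<^sup>2)"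
  proof -
    have "complex_of_real (sqrt (4 * pi * T)) \<noteq> 0" using T by simp
    moreover have "X / s * (s * Z) = X * Z" if "s \<noteq> 0" for X s Z :: complex using that by simp
    ultimately show ?thesis
      unfolding exp_add[of "of_real (T * b\<^sup>2) + \<i> * of_real (pi * T * b / 4)" "of_real T * w\<^sup>2"] by blast
  qed
  also have "of_real (T * b\<^sup>2) + \<i> * of_real (pi * T * b / 4) + of_real T * w\<^sup>2 = complex_of_real (T * pi\<^sup>2 / 64)"
    unfolding w_def by (simp add: power2_eq_square field_simps)
  finally show ?thesis by (simp only: exp_of_real)
qed

text \<open>\<open>b = R / T\<close> gives \<open>Re \<zeta> + T * b \<ge> 0\<close> on the whole
  disc \<open>norm \<zeta> \<le> R\<close>, so one centre serves the disc.\<close>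

lemma weight_bound:
  assumes T: "T > 0" and R: "R \<ge> 0"
  obtains M where "M \<ge> 0" "\<And>Y (\<zeta>::complex) (l::real). Y \<ge> 1 \<Longrightarrow> l \<ge> 0 \<Longrightarrow> norm \<zeta> \<le> R \<Longrightarrow> norm (weight T Y (R / T) \<zeta> l) \<le> M * exp (T * l\<^sup>2 / 16)"
proof -
  obtain K where K: "K \<ge> 0" "\<And>Y b \<zeta> (l::real) r D::real. Y \<ge> 1 \<Longrightarrow> l \<ge> 0 \<Longrightarrow> Re \<zeta> + T * b \<ge> 0 \<Longrightarrow> norm (\<zeta> / 2 + of_real (T * b / 2)) \<le> D \<Longrightarrow>
     norm (weight_integrand T Y b \<zeta> l r) \<le> K * exp (D\<^sup>2 / T + T * l\<^sup>2 / 16) * exp (- (3 / (16 * T) * r\<^sup>2) + (- pi / 8) * r)"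
    using weight_integrand_bound[OF T] by metis
  define b where "b = R / T"
  have Tb: "T * b = R" using T by (simp add: b_def)
  define c where "c = exp (of_real (T * b\<^sup>2) + \<i> * of_real (pi * T * b / 4)) / complex_of_real (sqrt (4 * pi * T))"
  define I where "I = (LINT r|lborel. exp (- (3 / (16 * T) * r\<^sup>2) + (- pi / 8) * r))"
  have I0: "I \<ge> 0" unfolding I_def by (rule Bochner_Integration.integral_nonneg) simp
  define M where "M = norm c * (K * exp (R\<^sup>2 / T) * I)"
  show ?thesis
  proof (rule that[of M])
    show "M \<ge> 0" unfolding M_def using K(1) I0 by simp
    fix Y l :: real and \<zeta> :: complex assume Y: "Y \<ge> 1" and l: "l \<ge> 0" and \<zeta>: "norm \<zeta> \<le> R"
    have re: "Re \<zeta> + T * b \<ge> 0" unfolding Tb using \<zeta> abs_Re_le_cmod[of \<zeta>] by linarith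
    have "norm (\<zeta> / 2 + of_real (T * b / 2)) \<le> norm (\<zeta> / 2) + norm (complex_of_real (T * b / 2))" by (rule norm_triangle_ineq)
    also have "\<dots> \<le> R" unfolding Tb norm_of_real using \<zeta> R by (simp add: norm_divide)
    finally have D: "norm (\<zeta> / 2 + of_real (T * b / 2)) \<le> R" .
    let ?w = "\<lambda>r. K * exp (R\<^sup>2 / T + T * l\<^sup>2 / 16) * exp (- (3 / (16 * T) * r\<^sup>2) + (- pi / 8) * r)"
    have intw: "integrable lborel ?w"
      using T by (intro integrable_mult_right integrable_gaussian_exp_real) auto
    have intW: "integrable lborel (weight_integrand T Y b \<zeta> l)"
    proof (rule Bochner_Integration.integrable_bound[OF intw])
      show "AE r in lborel. norm (weight_integrand T Y b \<zeta> l r) \<le> norm (?w r)"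
        using K(2)[OF Y l re D] by (intro AE_I2) (auto intro: order_trans[OF _ abs_ge_self])
    qed (use weight_integrand_measurable[OF T l re] in simp)
    have "norm (LINT r|lborel. weight_integrand T Y b \<zeta> l r) \<le> (LINT r|lborel. norm (weight_integrand T Y b \<zeta> l r))"
      by (rule integral_norm_bound)
    also have "\<dots> \<le> (LINT r|lborel. ?w r)"
      using intw intW K(2)[OF Y l re D] by (intro integral_mono) auto
    also have "\<dots> = K * exp (R\<^sup>2 / T + T * l\<^sup>2 / 16) * I" unfolding I_def by (rule integral_mult_right_zero)
    finally have "norm (LINT r|lborel. weight_integrand T Y b \<zeta> l r) \<le> K * exp (R\<^sup>2 / T + T * l\<^sup>2 / 16) * I" .
    hence "norm c * norm (LINT r|lborel. weight_integrand T Y b \<zeta> l r) \<le> norm c * (K * exp (R\<^sup>2 / T + T * l\<^sup>2 / 16) * I)"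
      by (intro mult_left_mono) auto
    also have "\<dots> = M * exp (T * l\<^sup>2 / 16)" unfolding M_def exp_add by (simp only: mult_ac)
    finally show "norm (weight T Y (R / T) \<zeta> l) \<le> M * exp (T * l\<^sup>2 / 16)"
      unfolding weight_def b_def[symmetric] c_def[symmetric] norm_mult .
  qed
qed

text \<open>With \<open>n = Suc k\<close> the phase is
  \<open>n powr (- 2 * \<i> * Y + \<i> * pi * T / 8)\<close>. Its first part stems from the
  translation by \<open>ln n / 2\<close> under the frequency \<open>4 * Y\<close>, its second from
  the imaginary part \<open>pi / 2\<close> of \<open>log_scale Y\<close> multiplied by
  \<open>T * ln n / 4\<close>.\<close>

definition dirichlet_term :: "real \<Rightarrow> real \<Rightarrow> complex \<Rightarrow> nat \<Rightarrow> complex" where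
  "dirichlet_term T Y \<zeta> k = exp ((- 2 * \<i> * of_real Y - \<zeta> + \<i> * of_real (pi * T / 8)) * of_real (ln (real (Suc k)))
     - of_real (T / 4 * (ln (real (Suc k)))\<^sup>2))"

lemma norm_dirichlet_term:
  "norm (dirichlet_term T Y \<zeta> k) = exp (- Re \<zeta> * ln (real (Suc k)) - T / 4 * (ln (real (Suc k)))\<^sup>2)"
  unfolding dirichlet_term_def norm_exp_eq_Re by simp

text \<open>An exact identity before any limit: the normalization removes every factor common to all
  \<open>k\<close>, and the whole Stirling error sits in the weights. The weights depend on
  \<open>b\<close>, their sum does not.\<close>

lemma scaled_transform_sums:
  assumes T: "T > 0" and Y: "Y > 0" and b: "Re \<zeta> + T * b \<ge> 0"
  shows "(\<lambda>k. dirichlet_term T Y \<zeta> k * weight T Y b \<zeta> (ln (real (Suc k)))) sums scaled_transform T Y \<zeta>"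
proof -
  \<comment> \<open>Here \<open>pi * exp (4 * m) = Y\<close>. Centring at \<open>m - b\<close>
    removes the drift \<open>2 * T * m\<close> of \<open>a\<close> from \<open>p\<close>, and the
    oscillation \<open>exp (- \<i> * r * m)\<close> cancels against
    \<open>exp (log_scale Y * \<i> * r / 4)\<close>, of which only the modulus
    \<open>exp (- pi / 8 * r)\<close> is left.\<close>
  define m where "m = ln (Y / pi) / 4"
  define a where "a = - 1 + 4 * \<i> * of_real Y + of_real (2 * T * m) + 2 * \<zeta>"
  define lam where "lam = log_scale Y"
  have lam: "lam = of_real (4 * m) + \<i> * of_real (pi / 2)" by (simp add: lam_def log_scale_def m_def)
  define \<mu> where "\<mu> = m - b"
  have st: "scaled_transform T Y \<zeta> = Phi_transform T a * (exp (- lam * \<zeta> / 2) / (Gamma_factor Y * of_real (exp (T * m\<^sup>2))))"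
    by (simp add: scaled_transform_def a_def m_def lam_def power_divide)
  have re: "Re a + 5 - 2 * T * \<mu> > 0" using b by (simp add: a_def \<mu>_def algebra_simps)
  have "(LINT u|lborel. of_real (exp (- T * u\<^sup>2) * Phi_term k u) * exp (a * of_real u)) * (exp (- lam * \<zeta> / 2) / (Gamma_factor Y * of_real (exp (T * m\<^sup>2))))
     = dirichlet_term T Y \<zeta> k * weight T Y b \<zeta> (ln (real (Suc k)))" for k
  proof -
    define l where "l = ln (real (Suc k))"
    define s where "s = complex_of_real (sqrt (4 * pi * T))"
    define p where "p r = (5 + a + of_real (T * l - 2 * T * \<mu>) + \<i> * of_real r) / 4" for r :: real
    define d where "d r = \<zeta> / 2 + of_real (T * b / 2) + (of_real (T * l) + \<i> * of_real r) / 4" for r :: real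
    have p: "p r = (1 + \<i> * of_real Y) + d r" for r
      by (simp add: p_def d_def a_def \<mu>_def field_simps)
    define E where "E = - (1 + a) / 2 * of_real l + of_real (- T * l\<^sup>2 / 4 + T * \<mu>\<^sup>2)"
    define L where "L = lam * (\<zeta> / 2 + of_real (T * b / 2) + of_real (T * l) / 4)"
    have integrand: "exp (of_real (- r\<^sup>2 / (4 * T)) - \<i> * of_real (r * \<mu>)) * (exp ((1 - p r) * of_real (ln pi)) * Gamma (p r) * (2 * p r - 3) / 4)
        = Gamma_factor Y * exp L * weight_integrand T Y b \<zeta> l r" for r
    proof -
      have "of_real (- r\<^sup>2 / (4 * T)) - \<i> * of_real (r * \<mu>) + lam * d r = L + (of_real (- (1 / (4 * T) * r\<^sup>2)) + (\<i> * of_real b - of_real (pi / 8)) * of_real r)"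
        unfolding d_def L_def lam \<mu>_def by (simp add: field_simps)
      hence "exp (of_real (- r\<^sup>2 / (4 * T)) - \<i> * of_real (r * \<mu>)) * exp (lam * d r) = exp L * exp (of_real (- (1 / (4 * T) * r\<^sup>2)) + (\<i> * of_real b - of_real (pi / 8)) * of_real r)"
        unfolding exp_add[symmetric] by (rule arg_cong)
      note eq = this
      have gen: "x * (g * (y * z)) = g * u * (v * z)" if "x * y = u * v" for x y u v g z :: complex
        using arg_cong[OF that, of "\<lambda>t. g * t * z"] by (simp only: mult_ac)
      show ?thesis unfolding p Gamma_factor_shift[OF Y] weight_integrand_def d_def[symmetric] lam_def[symmetric]
        by (rule gen[OF eq])
    qed
    have "(LINT u|lborel. of_real (exp (- T * u\<^sup>2) * Phi_term k u) * exp (a * of_real u)) =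
       exp E / s * (LINT r|lborel. Gamma_factor Y * exp L * weight_integrand T Y b \<zeta> l r)"
      using Phi_term_gaussian_transform[OF T re, of k] unfolding l_def[symmetric] p_def[symmetric] E_def[symmetric] s_def[symmetric] integrand .
    also have "\<dots> = exp E / s * (Gamma_factor Y * exp L * (LINT r|lborel. weight_integrand T Y b \<zeta> l r))"
      by (simp only: integral_mult_right_zero)
    finally have 1: "(LINT u|lborel. of_real (exp (- T * u\<^sup>2) * Phi_term k u) * exp (a * of_real u)) =
       exp E / s * (Gamma_factor Y * exp L * (LINT r|lborel. weight_integrand T Y b \<zeta> l r))" .
    define B where "B = of_real (T * b\<^sup>2) + \<i> * complex_of_real (pi * T * b / 4)"
    have ex: "E + L + (- lam * \<zeta> / 2) - of_real (T * m\<^sup>2) = ((- 2 * \<i> * of_real Y - \<zeta> + \<i> * of_real (pi * T / 8)) * of_real l - of_real (T / 4 * l\<^sup>2)) + B"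
      unfolding E_def L_def B_def lam a_def \<mu>_def by (simp add: field_simps power2_eq_square)
    have 2: "exp E * exp L * exp (- lam * \<zeta> / 2) / of_real (exp (T * m\<^sup>2)) = dirichlet_term T Y \<zeta> k * exp B"
      using arg_cong[OF ex, of exp] unfolding exp_add exp_diff dirichlet_term_def l_def[symmetric] exp_of_real[symmetric] .
    have gen: "x / s * (g * y * i) * (z / (g * w)) = (x * y * z / w) * i / s" if "g \<noteq> 0" for x y z g i w :: complex
      using that by (simp add: field_simps)
    show ?thesis unfolding 1 gen[OF Gamma_factor_nonzero] 2 weight_def l_def[symmetric] B_def[symmetric] s_def[symmetric] by simp
  qed
  note terms = this
  from sums_mult2[OF Phi_transform_sums[OF T, of a], of "exp (- lam * \<zeta> / 2) / (Gamma_factor Y * of_real (exp (T * m\<^sup>2)))"]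
  show ?thesis unfolding terms st .
qed

lemma holomorphic_scaled_transform:
  assumes T: "T > 0"
  shows "scaled_transform T Y holomorphic_on A"
proof -
  let ?a = "\<lambda>\<zeta>. - 1 + 4 * \<i> * of_real Y + of_real (T * ln (Y / pi) / 2) + 2 * \<zeta>"
  have "?a holomorphic_on UNIV" by (intro holomorphic_intros)
  from holomorphic_on_compose[OF this holomorphic_on_subset[OF holomorphic_Phi_transform[OF T]]]
  have "(\<lambda>\<zeta>. Phi_transform T (?a \<zeta>)) holomorphic_on UNIV" by (simp only: o_def subset_UNIV)
  hence "scaled_transform T Y holomorphic_on UNIV"
    unfolding scaled_transform_def[abs_def] using Gamma_factor_nonzero by (intro holomorphic_intros) auto
  thus ?thesis by (rule holomorphic_on_subset) simp
qed

lemma scaled_transform_zero_imp: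
  assumes T: "T > 0" and rz: "only_real_zeros (H (- T))" and zero: "scaled_transform T Y \<zeta> = 0"
  shows "2 * Re \<zeta> = 1 - T * ln (Y / pi) / 2"
proof -
  define a where "a = - 1 + 4 * \<i> * of_real Y + of_real (T * ln (Y / pi) / 2) + 2 * \<zeta>"
  have "Phi_transform T a = 0"
    using zero Gamma_factor_nonzero[of Y] unfolding scaled_transform_def a_def by simp
  hence "H (- T) (- \<i> * a) = 0" using H_eq_Phi_transform[OF T, of "- \<i> * a"] by simp
  hence "- \<i> * a \<in> \<real>" using rz unfolding only_real_zeros_def by blast
  hence "Im (- \<i> * a) = 0" by (simp add: complex_is_Real_iff)
  thus ?thesis by (simp add: a_def)
qed

text \<open>The uniformity in \<open>Y\<close> that Montel's theorem requires. The decay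
  \<open>3 * T / 16\<close> is \<open>T / 4\<close> from the coefficients minus
  \<open>T / 16\<close> spent on the weights.\<close>

lemma scaled_transform_locally_bounded:
  assumes T: "T > 0" and R: "R \<ge> 0"
  obtains B where "\<And>Y \<zeta>. Y \<ge> 1 \<Longrightarrow> norm \<zeta> \<le> R \<Longrightarrow> norm (scaled_transform T Y \<zeta>) \<le> B"
proof -
  obtain M where M: "M \<ge> 0" "\<And>Y (\<zeta>::complex) (l::real). Y \<ge> 1 \<Longrightarrow> l \<ge> 0 \<Longrightarrow> norm \<zeta> \<le> R \<Longrightarrow> norm (weight T Y (R / T) \<zeta> l) \<le> M * exp (T * l\<^sup>2 / 16)"
    using weight_bound[OF T R] by metis
  let ?e = "\<lambda>k. M * exp (R * ln (real (Suc k)) - 3 * T / 16 * (ln (real (Suc k)))\<^sup>2)"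
  have sm: "summable ?e" using T by (intro summable_mult summable_exp_ln_quadratic) auto
  have "norm (scaled_transform T Y \<zeta>) \<le> (\<Sum>k. ?e k)" if Y: "Y \<ge> 1" and \<zeta>: "norm \<zeta> \<le> R" for Y \<zeta>
  proof -
    have re: "Re \<zeta> + T * (R / T) \<ge> 0" using T \<zeta> abs_Re_le_cmod[of \<zeta>] by simp
    have bd: "norm (dirichlet_term T Y \<zeta> k * weight T Y (R / T) \<zeta> (ln (real (Suc k)))) \<le> ?e k" for k
    proof -
      define l where "l = ln (real (Suc k))"
      have l: "l \<ge> 0" by (simp add: l_def)
      have "- Re \<zeta> * l \<le> R * l" using \<zeta> abs_Re_le_cmod[of \<zeta>] l by (intro mult_right_mono) auto
      hence "norm (dirichlet_term T Y \<zeta> k) \<le> exp (R * l - T / 4 * l\<^sup>2)"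
        unfolding norm_dirichlet_term l_def[symmetric] by simp
      hence "norm (dirichlet_term T Y \<zeta> k * weight T Y (R / T) \<zeta> l) \<le> exp (R * l - T / 4 * l\<^sup>2) * (M * exp (T * l\<^sup>2 / 16))"
        unfolding norm_mult by (intro mult_mono M(2) Y l \<zeta>) auto
      also have "\<dots> = M * exp ((R * l - T / 4 * l\<^sup>2) + T * l\<^sup>2 / 16)" unfolding exp_add by simp
      also have "(R * l - T / 4 * l\<^sup>2) + T * l\<^sup>2 / 16 = R * l - 3 * T / 16 * l\<^sup>2" by (simp add: field_simps)
      finally show ?thesis unfolding l_def .
    qed
    have "scaled_transform T Y \<zeta> = (\<Sum>k. dirichlet_term T Y \<zeta> k * weight T Y (R / T) \<zeta> (ln (real (Suc k))))"
      using scaled_transform_sums[OF T _ re, of Y] Y by (simp add: sums_unique)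
    also have "norm \<dots> \<le> (\<Sum>k. ?e k)" by (rule norm_suminf_le[OF bd sm])
    finally show ?thesis .
  qed
  thus ?thesis by (rule that)
qed

definition dirichlet_series :: "real \<Rightarrow> real \<Rightarrow> complex \<Rightarrow> complex" where
  "dirichlet_series T Y \<zeta> = (\<Sum>k. dirichlet_term T Y \<zeta> k)"

lemma summable_norm_dirichlet_term: "T > 0 \<Longrightarrow> summable (\<lambda>k. norm (dirichlet_term T Y \<zeta> k))"
  unfolding norm_dirichlet_term by (intro summable_exp_ln_quadratic) simp

text \<open>Stated as a difference because the phases of \<open>dirichlet_series T Y\<close> keep
  rotating with \<open>Y\<close>. The moduli of its terms are fixed, so convergence of each weight
  to the constant is enough, and Tannery's theorem carries it through the sum.\<close>

lemma scaled_transform_asymptotics: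
  assumes T: "T > 0"
  shows "((\<lambda>Y. scaled_transform T Y \<zeta> - of_real (exp (T * pi\<^sup>2 / 64)) * dirichlet_series T Y \<zeta>) \<longlongrightarrow> 0) at_top"
proof -
  define R where "R = norm \<zeta>"
  define C where "C = complex_of_real (exp (T * pi\<^sup>2 / 64))"
  define b where "b = R / T"
  have R: "R \<ge> 0" by (simp add: R_def)
  obtain M where M: "M \<ge> 0" "\<And>Y (\<zeta>::complex) (l::real). Y \<ge> 1 \<Longrightarrow> l \<ge> 0 \<Longrightarrow> norm \<zeta> \<le> R \<Longrightarrow> norm (weight T Y (R / T) \<zeta> l) \<le> M * exp (T * l\<^sup>2 / 16)"
    using weight_bound[OF T R] by metis
  have re: "Re \<zeta> + T * b \<ge> 0" using T abs_Re_le_cmod[of \<zeta>] by (simp add: R_def b_def)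
  let ?a = "\<lambda>k Y. dirichlet_term T Y \<zeta> k * (weight T Y b \<zeta> (ln (real (Suc k))) - C)"
  let ?m = "\<lambda>k. (M + norm C) * exp (R * ln (real (Suc k)) - 3 * T / 16 * (ln (real (Suc k)))\<^sup>2)"
  have sm: "summable ?m" using T by (intro summable_mult summable_exp_ln_quadratic) auto
  have lim: "((\<lambda>Y. ?a k Y) \<longlongrightarrow> 0) at_top" for k
  proof -
    define l where "l = ln (real (Suc k))"
    have l: "l \<ge> 0" by (simp add: l_def)
    \<comment> \<open>The norm of a Dirichlet term does not depend on \<open>Y\<close>, so
      \<open>Y = 0\<close> can represent it as a constant.\<close>
    have "((\<lambda>Y. norm (dirichlet_term T 0 \<zeta> k) * norm (weight T Y b \<zeta> l - C)) \<longlongrightarrow> norm (dirichlet_term T 0 \<zeta> k) * norm (C - C)) at_top"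
      unfolding C_def by (intro tendsto_intros weight_tendsto T l re)
    hence "((\<lambda>Y. norm (?a k Y)) \<longlongrightarrow> 0) at_top" unfolding norm_mult norm_dirichlet_term l_def by simp
    thus ?thesis by (rule tendsto_norm_zero_cancel)
  qed
  have bd: "norm (?a k Y) \<le> ?m k" if Y: "Y \<ge> 1" for k Y
  proof -
    define l where "l = ln (real (Suc k))"
    have l: "l \<ge> 0" by (simp add: l_def)
    have "- Re \<zeta> * l \<le> R * l" using abs_Re_le_cmod[of \<zeta>] l unfolding R_def by (intro mult_right_mono) auto
    hence 1: "norm (dirichlet_term T Y \<zeta> k) \<le> exp (R * l - T / 4 * l\<^sup>2)"
      unfolding norm_dirichlet_term l_def[symmetric] by simp
    have e1: "1 \<le> exp (T * l\<^sup>2 / 16)" using T by simp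
    have "norm (weight T Y b \<zeta> l - C) \<le> M * exp (T * l\<^sup>2 / 16) + norm C * 1"
      using norm_triangle_ineq4[of "weight T Y b \<zeta> l" C] M(2)[OF Y l, of \<zeta>] by (simp add: b_def R_def)
    also have "\<dots> \<le> M * exp (T * l\<^sup>2 / 16) + norm C * exp (T * l\<^sup>2 / 16)"
      by (intro add_left_mono mult_left_mono e1) auto
    finally have 2: "norm (weight T Y b \<zeta> l - C) \<le> (M + norm C) * exp (T * l\<^sup>2 / 16)" by (simp add: distrib_right)
    have "norm (dirichlet_term T Y \<zeta> k * (weight T Y b \<zeta> l - C)) \<le> exp (R * l - T / 4 * l\<^sup>2) * ((M + norm C) * exp (T * l\<^sup>2 / 16))"
      unfolding norm_mult by (intro mult_mono 1 2) auto
    also have "\<dots> = (M + norm C) * exp ((R * l - T / 4 * l\<^sup>2) + T * l\<^sup>2 / 16)" unfolding exp_add by simp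
    also have "(R * l - T / 4 * l\<^sup>2) + T * l\<^sup>2 / 16 = R * l - 3 * T / 16 * l\<^sup>2" by (simp add: field_simps)
    finally show ?thesis unfolding l_def .
  qed
  have "((\<lambda>Y. \<Sum>k. ?a k Y) \<longlongrightarrow> (\<Sum>k. 0)) at_top"
  proof -
    have "\<forall>\<^sub>F p in (at_top :: nat filter) \<times>\<^sub>F at_top. snd p \<ge> (1::real)"
      using eventually_prod2[of "at_top :: nat filter" "\<lambda>Y. Y \<ge> (1::real)" at_top] eventually_ge_at_top[of "1::real"] by (simp add: case_prod_beta')
    hence ev: "\<forall>\<^sub>F (k, Y) in at_top \<times>\<^sub>F at_top. norm (?a k Y) \<le> ?m k"
      by (rule eventually_mono) (use bd in \<open>auto simp: case_prod_beta'\<close>)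
    show ?thesis using tannerys_theorem[of ?a "\<lambda>_. 0" at_top ?m, OF lim ev sm] by simp
  qed
  moreover have "\<forall>\<^sub>F Y in at_top. (\<Sum>k. ?a k Y) = scaled_transform T Y \<zeta> - C * dirichlet_series T Y \<zeta>"
    using eventually_ge_at_top[of 1]
  proof eventually_elim
    case (elim Y)
    have "(\<lambda>k. dirichlet_term T Y \<zeta> k * weight T Y b \<zeta> (ln (real (Suc k))) - dirichlet_term T Y \<zeta> k * C) sums
       (scaled_transform T Y \<zeta> - dirichlet_series T Y \<zeta> * C)"
      unfolding dirichlet_series_def using elim
      by (intro sums_diff sums_mult2 scaled_transform_sums T re summable_sums summable_norm_cancel[OF summable_norm_dirichlet_term[OF T]]) auto
    thus ?case by (simp add: sums_iff right_diff_distrib mult.commute)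
  qed
  ultimately show ?thesis unfolding C_def by (simp add: tendsto_cong)
qed

text \<open>Half of the weight \<open>T / 4 * l\<^sup>2\<close> is kept for summability; the other
  half absorbs \<open>norm \<zeta> * l\<close> by completing a square. The result is growth of order
  2, uniformly in \<open>Y\<close>.\<close>

lemma dirichlet_series_bound:
  assumes T: "T > 0"
  shows "norm (dirichlet_series T Y \<zeta>) \<le> (\<Sum>k. exp (- (T / 8) * (ln (real (Suc k)))\<^sup>2)) * exp (2 / T * (norm \<zeta>)\<^sup>2)"
proof -
  have sm: "summable (\<lambda>k. exp (- (T / 8) * (ln (real (Suc k)))\<^sup>2))"
    using summable_exp_ln_quadratic[of "T / 8" 0] T by simp
  have "norm (dirichlet_series T Y \<zeta>) \<le> (\<Sum>k. exp (- (T / 8) * (ln (real (Suc k)))\<^sup>2) * exp (2 / T * (norm \<zeta>)\<^sup>2))"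
    unfolding dirichlet_series_def
  proof (rule norm_suminf_le[OF _ summable_mult2[OF sm]])
    fix k
    define l where "l = ln (real (Suc k))"
    have l: "l \<ge> 0" by (simp add: l_def)
    have "- Re \<zeta> * l \<le> norm \<zeta> * l" using abs_Re_le_cmod[of \<zeta>] l by (intro mult_right_mono) auto
    moreover have "norm \<zeta> * l \<le> T / 8 * l\<^sup>2 + 2 / T * (norm \<zeta>)\<^sup>2"
    proof -
      have "0 \<le> (T * l - 4 * norm \<zeta>)\<^sup>2 / (8 * T)" using T by simp
      also have "\<dots> = T / 8 * l\<^sup>2 + 2 / T * (norm \<zeta>)\<^sup>2 - norm \<zeta> * l" using T by (simp add: power2_eq_square field_simps)
      finally show ?thesis by simp
    qed
    moreover have "T / 4 * l\<^sup>2 = T / 8 * l\<^sup>2 + T / 8 * l\<^sup>2" by simp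
    ultimately have "- Re \<zeta> * l - T / 4 * l\<^sup>2 \<le> - (T / 8) * l\<^sup>2 + 2 / T * (norm \<zeta>)\<^sup>2"
      unfolding mult_minus_left by linarith
    thus "norm (dirichlet_term T Y \<zeta> k) \<le> exp (- (T / 8) * (ln (real (Suc k)))\<^sup>2) * exp (2 / T * (norm \<zeta>)\<^sup>2)"
      unfolding norm_dirichlet_term l_def[symmetric] exp_add[symmetric] by simp
  qed
  also have "\<dots> = (\<Sum>k. exp (- (T / 8) * (ln (real (Suc k)))\<^sup>2)) * exp (2 / T * (norm \<zeta>)\<^sup>2)"
    by (rule suminf_mult2[OF sm, symmetric])
  finally show ?thesis .
qed

text \<open>The tail begins with the integer \<open>Suc n\<close>: \<open>n = 1\<close> leaves
  everything beyond the constant term at rate \<open>2 powr (- Re \<zeta>)\<close>, and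
  \<open>n = 2\<close> everything beyond the second term at rate
  \<open>3 powr (- Re \<zeta>)\<close>.\<close>

lemma dirichlet_tail_bound:
  assumes T: "T > 0" and x: "Re \<zeta> \<ge> 0"
  shows "norm (\<Sum>k. dirichlet_term T Y \<zeta> (k + n)) \<le> (\<Sum>k. exp (- (T / 4) * (ln (real (Suc k)))\<^sup>2)) * exp (- Re \<zeta> * ln (real (Suc n)))"
proof -
  have sm: "summable (\<lambda>k. exp (- (T / 4) * (ln (real (Suc k)))\<^sup>2))"
    using summable_exp_ln_quadratic[of "T / 4" 0] T by simp
  have "norm (\<Sum>k. dirichlet_term T Y \<zeta> (k + n)) \<le> (\<Sum>k. exp (- (T / 4) * (ln (real (Suc k)))\<^sup>2) * exp (- Re \<zeta> * ln (real (Suc n))))"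
  proof (rule norm_suminf_le[OF _ summable_mult2[OF sm]])
    fix k
    have "Re \<zeta> * ln (real (Suc n)) \<le> Re \<zeta> * ln (real (Suc (k + n)))" using x by (intro mult_left_mono) auto
    moreover have "T / 4 * (ln (real (Suc k)))\<^sup>2 \<le> T / 4 * (ln (real (Suc (k + n))))\<^sup>2"
      using T by (intro mult_left_mono power_mono) auto
    ultimately show "norm (dirichlet_term T Y \<zeta> (k + n)) \<le> exp (- (T / 4) * (ln (real (Suc k)))\<^sup>2) * exp (- Re \<zeta> * ln (real (Suc n)))"
      unfolding norm_dirichlet_term exp_add[symmetric] by simp
  qed
  also have "\<dots> = (\<Sum>k. exp (- (T / 4) * (ln (real (Suc k)))\<^sup>2)) * exp (- Re \<zeta> * ln (real (Suc n)))"
    by (rule suminf_mult2[OF sm, symmetric])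
  finally show ?thesis .
qed

lemma not_only_real_zeros_H_neg:
  assumes T: "T > 0"
  shows "\<not> only_real_zeros (H (- T))"
proof
  assume rz: "only_real_zeros (H (- T))"
  define C where "C = exp (T * pi\<^sup>2 / 64)"
  define S where "S = (\<Sum>k. exp (- (T / 4) * (ln (real (Suc k)))\<^sup>2))"
  define S8 where "S8 = (\<Sum>k. exp (- (T / 8) * (ln (real (Suc k)))\<^sup>2))"
  \<comment> \<open>Modulus of the coefficient of \<open>2 powr (- \<zeta>)\<close>. Unimodular
    phases do not affect it, so it survives in every subsequential limit.\<close>
  define q where "q = exp (- T / 4 * (ln 2)\<^sup>2)"
  \<comment> \<open>Adding 1 ensures \<open>Y \<ge> 1\<close>, where the uniform bounds
    hold.\<close>
  define F where "F k = scaled_transform T (real k + 1)" for k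
  have C: "C > 0" and q: "q > 0" by (simp_all add: C_def q_def)
  obtain G r where G: "G holomorphic_on UNIV" and r: "strict_mono (r :: nat \<Rightarrow> nat)"
    and lim: "\<And>x. (\<lambda>n. F (r n) x) \<longlonglongrightarrow> G x"
    and ulim: "\<And>K. compact K \<Longrightarrow> uniform_limit K (F \<circ> r) G sequentially"
  proof (rule Montel[of UNIV "range F" F])
    show "h holomorphic_on UNIV" if "h \<in> range F" for h
      using that holomorphic_scaled_transform[OF T] by (auto simp: F_def)
    show "\<exists>B. \<forall>h\<in>range F. \<forall>z\<in>K. norm (h z) \<le> B" if K: "compact K" for K
    proof -
      obtain R where R: "R > 0" "\<And>z. z \<in> K \<Longrightarrow> norm z \<le> R"
        using compact_imp_bounded[OF K] by (auto simp: bounded_pos)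
      obtain B where "\<And>Y \<zeta>. Y \<ge> 1 \<Longrightarrow> norm \<zeta> \<le> R \<Longrightarrow> norm (scaled_transform T Y \<zeta>) \<le> B"
        using scaled_transform_locally_bounded[OF T, of R] R by auto
      thus ?thesis using R by (intro exI[of _ B]) (auto simp: F_def)
    qed
  qed auto
  define D where "D n \<zeta> = dirichlet_series T (real (r n) + 1) \<zeta>" for n \<zeta>
  have limD: "(\<lambda>n. of_real C * D n \<zeta>) \<longlonglongrightarrow> G \<zeta>" for \<zeta>
  proof -
    have "filterlim (\<lambda>x::real. x + 1) at_top at_top" by real_asymp
    from filterlim_compose[OF this filterlim_compose[OF filterlim_real_sequentially filterlim_subseq[OF r]]]
    have "filterlim (\<lambda>n. real (r n) + 1) at_top sequentially" .
    from filterlim_compose[OF scaled_transform_asymptotics[OF T, of \<zeta>] this]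
    have "(\<lambda>n. F (r n) \<zeta> - of_real C * D n \<zeta>) \<longlonglongrightarrow> 0" unfolding F_def C_def D_def .
    from tendsto_diff[OF lim[of \<zeta>] this] show ?thesis by simp
  qed
  have sm: "summable (dirichlet_term T Y \<zeta>)" for Y \<zeta> by (rule summable_norm_cancel[OF summable_norm_dirichlet_term[OF T]])
  have D1: "D n \<zeta> - 1 = (\<Sum>k. dirichlet_term T (real (r n) + 1) \<zeta> (k + 1))" for n \<zeta>
    using suminf_minus_initial_segment[OF sm[of "real (r n) + 1" \<zeta>], of 1] by (simp add: D_def dirichlet_series_def dirichlet_term_def)
  have D2: "D n \<zeta> - 1 - dirichlet_term T (real (r n) + 1) \<zeta> 1 = (\<Sum>k. dirichlet_term T (real (r n) + 1) \<zeta> (k + 2))" for n \<zeta>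
    using suminf_minus_initial_segment[OF sm[of "real (r n) + 1" \<zeta>], of 2] by (simp add: D_def dirichlet_series_def dirichlet_term_def numeral_2_eq_2)
  have bd: "norm (G \<zeta>) \<le> (C * S8) * exp (2 / T * (norm \<zeta>)\<^sup>2)" for \<zeta>
  proof (rule tendsto_upperbound[OF tendsto_norm[OF limD[of \<zeta>]]])
    show "\<forall>\<^sub>F n in sequentially. norm (of_real C * D n \<zeta>) \<le> (C * S8) * exp (2 / T * (norm \<zeta>)\<^sup>2)"
    proof (intro always_eventually allI)
      fix n
      show "norm (of_real C * D n \<zeta>) \<le> (C * S8) * exp (2 / T * (norm \<zeta>)\<^sup>2)"
        using mult_left_mono[OF dirichlet_series_bound[OF T, of "real (r n) + 1" \<zeta>], of C] C
        by (simp add: norm_mult D_def S8_def mult.assoc)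
    qed
  qed auto
  have up: "norm (G \<zeta> - of_real C) \<le> (C * S) * 2 powr (- Re \<zeta>)" if x: "Re \<zeta> \<ge> 0" for \<zeta>
  proof (rule tendsto_upperbound)
    show "(\<lambda>n. norm (of_real C * D n \<zeta> - of_real C)) \<longlonglongrightarrow> norm (G \<zeta> - of_real C)"
      by (intro tendsto_intros limD)
    show "\<forall>\<^sub>F n in sequentially. norm (of_real C * D n \<zeta> - of_real C) \<le> (C * S) * 2 powr (- Re \<zeta>)"
    proof (intro always_eventually allI)
      fix n
      have "norm (of_real C * D n \<zeta> - of_real C) = C * norm (D n \<zeta> - 1)"
      proof -
        have "of_real C * D n \<zeta> - of_real C = of_real C * (D n \<zeta> - 1)" by (simp add: algebra_simps)
        thus ?thesis using C by (simp add: norm_mult)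
      qed
      also have "norm (D n \<zeta> - 1) \<le> S * exp (- Re \<zeta> * ln 2)"
        using dirichlet_tail_bound[OF T x, of "real (r n) + 1" 1] unfolding D1 S_def by simp
      also have "exp (- Re \<zeta> * ln 2) = 2 powr (- Re \<zeta>)" by (simp add: powr_def)
      finally show "norm (of_real C * D n \<zeta> - of_real C) \<le> (C * S) * 2 powr (- Re \<zeta>)" using C by (simp add: mult.assoc mult_left_mono)
    qed
  qed auto
  \<comment> \<open>Far to the right the term for 2 outweighs the tail from 3 onwards, whatever its
    phase; this keeps \<open>G\<close> away from its limit value there.\<close>
  have low: "norm (G (of_real x) - of_real C) \<ge> C * (q * 2 powr (- x) - S * 3 powr (- x))" if x: "x \<ge> 0" for x :: real
  proof (rule tendsto_lowerbound)
    show "(\<lambda>n. norm (of_real C * D n (of_real x) - of_real C)) \<longlonglongrightarrow> norm (G (of_real x) - of_real C)"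
      by (intro tendsto_intros limD)
    show "\<forall>\<^sub>F n in sequentially. C * (q * 2 powr (- x) - S * 3 powr (- x)) \<le> norm (of_real C * D n (of_real x) - of_real C)"
    proof (intro always_eventually allI)
      fix n
      define t where "t = dirichlet_term T (real (r n) + 1) (of_real x) 1"
      have "norm t = exp (- x * ln 2 + - T / 4 * (ln 2)\<^sup>2)" unfolding t_def norm_dirichlet_term by simp
      also have "\<dots> = q * 2 powr (- x)" unfolding exp_add by (simp add: q_def powr_def)
      finally have t: "norm t = q * 2 powr (- x)" .
      have "norm (D n (of_real x) - 1 - t) \<le> S * exp (- x * ln 3)"
        using dirichlet_tail_bound[OF T, of "of_real x" "real (r n) + 1" 2] x unfolding D2 S_def t_def by simp
      also have "exp (- x * ln 3) = 3 powr (- x)" by (simp add: powr_def)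
      finally have "q * 2 powr (- x) - S * 3 powr (- x) \<le> norm (D n (of_real x) - 1)"
        using norm_triangle_ineq2[of t "- (D n (of_real x) - 1 - t)"] norm_triangle_ineq4[of "D n (of_real x) - 1" "D n (of_real x) - 1 - t"] t by simp
      hence "C * (q * 2 powr (- x) - S * 3 powr (- x)) \<le> C * norm (D n (of_real x) - 1)" using C by simp
      also have "\<dots> = norm (of_real C * D n (of_real x) - of_real C)"
      proof -
        have "of_real C * D n (of_real x) - of_real C = of_real C * (D n (of_real x) - 1)" by (simp add: algebra_simps)
        thus ?thesis using C by (simp add: norm_mult)
      qed
      finally show "C * (q * 2 powr (- x) - S * 3 powr (- x)) \<le> norm (of_real C * D n (of_real x) - of_real C)" .
    qed
  qed auto
  have "((\<lambda>x. S * (2/3) powr x) \<longlongrightarrow> 0) at_top" by real_asymp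
  hence "\<forall>\<^sub>F x in at_top. S * (2/3) powr x < q" using q by (rule order_tendstoD)
  then obtain x1 where x1: "\<And>x. x \<ge> x1 \<Longrightarrow> S * (2/3) powr x < q" by (auto simp: eventually_at_top_linorder)
  have ne: "G (of_real x) \<noteq> of_real C" if x: "x \<ge> max 0 x1" for x :: real
  proof -
    have "3 powr (- x) = (2/3) powr x * 2 powr (- x)" by (simp add: powr_divide powr_minus field_simps)
    hence "q * 2 powr (- x) - S * 3 powr (- x) = (q - S * (2/3) powr x) * 2 powr (- x)" by (simp add: algebra_simps)
    also have "\<dots> > 0" using x1[of x] x by (intro mult_pos_pos) auto
    finally have "C * (q * 2 powr (- x) - S * 3 powr (- x)) > 0" using C by simp
    thus ?thesis using low[of x] x by auto
  qed
  \<comment> \<open>Hurwitz's theorem demands a nonconstant limit. A constant value on the real line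
    would have to be the limit \<open>C\<close>, contrary to \<open>ne\<close>.\<close>
  have nonconst: "\<exists>x::real. G (of_real x) \<noteq> G (of_real (max 0 x1))"
  proof (rule ccontr)
    assume "\<not> ?thesis"
    then obtain g0 where const: "G (of_real x) = g0" for x :: real by blast
    have "((\<lambda>x::real. (C * S) * 2 powr (- x)) \<longlongrightarrow> 0) at_top" by real_asymp
    hence "((\<lambda>x::real. G (of_real x) - of_real C) \<longlongrightarrow> 0) at_top"
    proof (rule Lim_null_comparison[rotated])
      show "\<forall>\<^sub>F x::real in at_top. norm (G (of_real x) - of_real C) \<le> (C * S) * 2 powr (- x)"
        using eventually_ge_at_top[of 0]
      proof eventually_elim
        case (elim x)
        thus ?case using up[of "of_real x"] by simp
      qed
    qed
    hence "g0 - of_real C = 0" unfolding const by (simp add: tendsto_const_iff)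
    thus False using ne[of "max 0 x1"] const[of "max 0 x1"] by simp
  qed
  txt \<open>By assumption the zeros of \<open>scaled_transform T Y\<close> lie on a vertical line that moves off to \<open>-\<infinity>\<close> as \<open>Y\<close> grows.\<close>
  have nz: "G z0 \<noteq> 0" for z0
  proof -
    obtain x2 :: real where x2: "G (of_real x2) \<noteq> G (of_real (max 0 x1))" using nonconst by blast
    \<comment> \<open>The ball has to contain \<open>z0\<close> and both real points that witness
      nonconstancy. The threshold \<open>2 * R + 2\<close> below then puts the line of possible
      zeros at \<open>Re z \<le> - R - 1/2\<close>, outside the ball.\<close>
    define R where "R = norm z0 + \<bar>x2\<bar> + \<bar>max 0 x1\<bar> + 1"
    have "filterlim (\<lambda>n. T * ln ((real (r n) + 1) / pi) / 2) at_top sequentially"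
    proof -
      have "filterlim (\<lambda>Y. T * ln ((Y + 1) / pi) / 2) at_top at_top" using T by real_asymp
      from filterlim_compose[OF this filterlim_compose[OF filterlim_real_sequentially filterlim_subseq[OF r]]]
      show ?thesis .
    qed
    hence "\<forall>\<^sub>F n in sequentially. T * ln ((real (r n) + 1) / pi) / 2 \<ge> 2 * R + 2"
      unfolding filterlim_at_top by (rule spec)
    then obtain N where N: "\<And>n. n \<ge> N \<Longrightarrow> T * ln ((real (r n) + 1) / pi) / 2 \<ge> 2 * R + 2"
      by (auto simp: eventually_sequentially)
    show ?thesis
    proof (rule Hurwitz_no_zeros[of "ball 0 R" "\<lambda>n. F (r (n + N))" G])
      show "F (r (n + N)) holomorphic_on ball 0 R" for n unfolding F_def by (rule holomorphic_scaled_transform[OF T])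
      show "G holomorphic_on ball 0 R" by (rule holomorphic_on_subset[OF G]) simp
      show "uniform_limit K (\<lambda>n. F (r (n + N))) G sequentially" if "compact K" for K
        using filterlim_compose[OF ulim[OF that] filterlim_add_const_nat_at_top[of N]] by (simp add: o_def)
      show "\<not> G constant_on ball 0 R"
      proof
        assume "G constant_on ball 0 R"
        then obtain c where c: "\<And>z. z \<in> ball 0 R \<Longrightarrow> G z = c" unfolding constant_on_def by blast
        have "of_real x2 \<in> ball (0::complex) R" "of_real (max 0 x1) \<in> ball (0::complex) R"
          unfolding mem_ball_0 norm_of_real R_def by (simp_all add: add_pos_nonneg add_nonneg_pos add.assoc) (smt (verit) norm_ge_zero)+
        thus False using c x2 by metis
      qed
      show "F (r (n + N)) z \<noteq> 0" if z: "z \<in> ball 0 R" for n z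
      proof
        assume "F (r (n + N)) z = 0"
        hence "2 * Re z = 1 - T * ln ((real (r (n + N)) + 1) / pi) / 2"
          unfolding F_def by (rule scaled_transform_zero_imp[OF T rz])
        moreover have "T * ln ((real (r (n + N)) + 1) / pi) / 2 \<ge> 2 * R + 2" by (rule N) simp
        moreover have "\<bar>Re z\<bar> < R" using z abs_Re_le_cmod[of z] by (simp add: dist_norm)
        ultimately show False by linarith
      qed
      show "z0 \<in> ball 0 R" by (simp add: R_def add_nonneg_pos)
    qed auto
  qed
  have "complex_of_real C \<noteq> 0" using C by simp
  thus False by (rule zero_free_entire_impossible[OF G nz bd _ up ne])
qed

theorem theorem1:
  fixes \<Lambda> :: real
  assumes "is_de_Bruijn_Newman_constant \<Lambda>"
  shows "0 \<le> \<Lambda>"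
proof (rule ccontr)
  assume "\<not> 0 \<le> \<Lambda>"
  hence "- \<Lambda> > 0" by simp
  moreover have "only_real_zeros (H (- (- \<Lambda>)))"
    using assms unfolding is_de_Bruijn_Newman_constant_def by simp
  ultimately show False using not_only_real_zeros_H_neg by blast
qed

end
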